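(* Let $\alpha\ge1/2$, $\lambda>0$, and let $X$ be an almost surely positive random variable with $\mathbb{E}[X^{\alpha+4}]<\infty$ and $\mathbb{E}[X]=\alpha/\lambda$. Then $$D(X\|\gamma_{\alpha,\lambda})=\int_0^1\frac{1}{\lambda\tau}J_{st,\gamma}(X_\tau)\,d\tau .$$
   Context: Fix $\alpha>0,\lambda>0$. Let $\gamma_{\alpha,\lambda}(u)=\frac{\lambda^\alpha}{\Gamma(\alpha)}u^{\alpha-1}e^{-\lambda u}$, $u>0$, and let $\gamma(\alpha,\lambda)$ denote a random variable with this density. For a random variable $X$ with values in $(0,\infty)$ a.s. and $\tau\in(0,1)$, the gamma smart path $X_\tau$ is defined as follows: conditionally on $X=x$, let $K$ be Poisson with mean $\lambda\tau x/(1-\tau)$; conditionally on $X=x,K=k$, let $Y=0$ if $k=0$ and let $Y$ be gamma distributed with shape $k$ and rate $\lambda\tau/(1-\tau)$ if $k\ge1$; let $\gamma(\alpha,\lambda)$ be independent of $(X,K,Y)$; set $X_\tau=(1-\tau)\gamma(\alpha,\lambda)+\tau Y$ ($X_\tau$ always has a Lebesgue density). For a positive random variable $W$ with density $f$, $D(W\|\gamma_{\alpha,\lambda})=\int_0^\infty f\log(f/\gamma_{\alpha,\lambda})$, and $D(W\|\gamma_{\alpha,\lambda})=+\infty$ if $W$ has no density. For $W$ with differentiable positive density $f_W$, $\rho_W=(\log f_W)'$ and $J_{st,\gamma}(W)=\mathbb{E}\big[W\big(\rho_W(W)-\frac{\alpha-1}{W}+\lambda\big)^2\big]$. *)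

theory Defs
  imports "HOL-Probability.Probability"
begin

definition gamma_density :: "real \<Rightarrow> real \<Rightarrow> real \<Rightarrow> real" where
  "gamma_density a l u =
     (if 0 < u then l powr a / Gamma a * u powr (a - 1) * exp (- l * u) else 0)"

definition gamma_law :: "real \<Rightarrow> real \<Rightarrow> real measure" where
  "gamma_law a l = density lborel (\<lambda>u. ennreal (gamma_density a l u))"

definition poisson_law :: "real \<Rightarrow> nat measure" where
  "poisson_law r = density (count_space UNIV) (\<lambda>k. ennreal (r ^ k / fact k * exp (- r)))"

definition smart_path_law :: "real \<Rightarrow> real \<Rightarrow> real measure \<Rightarrow> real \<Rightarrow> real measure" where
  "smart_path_law a l \<mu> \<tau> =
     \<mu> \<bind> (\<lambda>x.
     poisson_law (l * \<tau> * x / (1 - \<tau>)) \<bind> (\<lambda>k.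
     (if k = 0 then return borel 0 else gamma_law (real k) (l * \<tau> / (1 - \<tau>))) \<bind> (\<lambda>y.
     distr (gamma_law a l) borel (\<lambda>g. (1 - \<tau>) * g + \<tau> * y))))"

definition rel_entropy_gamma :: "real \<Rightarrow> real \<Rightarrow> real measure \<Rightarrow> ereal" where
  "rel_entropy_gamma a l \<nu> =
     (if \<exists>f. f \<in> borel_measurable borel \<and> (\<forall>u. 0 \<le> f u) \<and> \<nu> = density lborel (\<lambda>u. ennreal (f u))
      then (let f = (SOME f. f \<in> borel_measurable borel \<and> (\<forall>u. 0 \<le> f u) \<and>
                         \<nu> = density lborel (\<lambda>u. ennreal (f u)));
                h = (\<lambda>u. f u * ln (f u / gamma_density a l u))
            in enn2ereal (\<integral>\<^sup>+ u \<in> {0<..}. ennreal (max 0 (h u)) \<partial>lborel)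
               - enn2ereal (\<integral>\<^sup>+ u \<in> {0<..}. ennreal (max 0 (- h u)) \<partial>lborel))
      else \<infinity>)"

definition diff_pos_density :: "real measure \<Rightarrow> (real \<Rightarrow> real) \<Rightarrow> bool" where
  "diff_pos_density \<nu> f \<longleftrightarrow>
     (\<forall>u>0. 0 < f u \<and> f differentiable (at u)) \<and>
     \<nu> = density lborel (\<lambda>u. ennreal (indicator {0<..} u * f u))"

text \<open>Stein--Fisher information J_{st,gamma}(W) = E[ W (rho_W(W) - (a-1)/W + l)^2 ],
  with rho_W = (log f_W)' = f_W'/f_W.  (Convention: +oo if W has no differentiable positive density.)\<close>
definition stein_fisher_gamma :: "real \<Rightarrow> real \<Rightarrow> real measure \<Rightarrow> ennreal" where
  "stein_fisher_gamma a l \<nu> =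
     (if \<exists>f. diff_pos_density \<nu> f
      then (let f = (SOME f. diff_pos_density \<nu> f)
            in \<integral>\<^sup>+ u \<in> {0<..}.
                 ennreal (f u * (u * (deriv (\<lambda>v. ln (f v)) u - (a - 1) / u + l)\<^sup>2)) \<partial>lborel)
      else \<infinity>)"

end

theory Submission
  imports Defs
begin

text \<open>
  Relative to the gamma law, the path started at \<open>x\<close> has at \<open>u\<close> the density \<open>q t u x\<close>, a kernel built from the
  Bessel-type function \<open>I z = (\<Sum>k. z ^ k / (k! (a)_k))\<close>. It is symmetric in \<open>x\<close> and \<open>u\<close> and solves
  \<open>d/du (u \<gamma> dq/du) = - l t \<gamma> dq/dt\<close>. For \<open>a \<ge> 1/2\<close> one has \<open>I z \<le> exp (2 sqrt z)\<close> and \<open>I' \<le> 2 I\<close>, so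
  that \<open>h t u = E (q t u X)\<close> satisfies linear bounds on \<open>ln h\<close>, and the derivatives of \<open>h\<close> are controlled by
  moments of \<open>X\<close> up to order four. Integrating \<open>d/dt (h ln h)\<close> by parts in \<open>u\<close> shows that the entropy
  \<open>E t = \<integral> \<gamma> h ln h\<close> of the path has derivative \<open>J / (l t)\<close>.

  At \<open>t = 0\<close> the entropy vanishes, by convexity and \<open>ln q \<le> - a ln (1 - t) + l sqrt t (x + u) / (1 - t)\<close>. At \<open>t = 1\<close> it converges
  to the entropy of \<open>X\<close>: Jensen's inequality for the symmetric kernel bounds \<open>E t\<close> from above, and the dual
  inequality \<open>\<integral> \<psi> h \<gamma> - \<integral> exp \<psi> \<gamma> + 1 \<le> E t\<close> passes to the limit for bounded continuous \<open>\<psi>\<close>. If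
  the \<open>E t\<close> are bounded, this forces \<open>X\<close> to have a density \<open>f\<close>, after which truncations of \<open>ln (f / \<gamma>)\<close> may be
  inserted for \<open>\<psi>\<close>.
\<close>

section \<open>The confluent hypergeometric limit function\<close>

text \<open>Both ends of the path are singular: at time 1 the kernel concentrates and its constants
  blow up, at time 0 the weight \<open>1 / (l * t)\<close> does. De Bruijn's identity is therefore
  proved on compact intervals \<open>{s..t}\<close> and extended by monotone convergence, the
  integrand being nonnegative; both sides may be infinite. The condition \<open>a \<ge> 1/2\<close>
  comes from comparison with \<open>hyp (1/2) z = cosh (2 * sqrt z)\<close> for
  \<open>z \<ge> 0\<close>. The exponent \<open>2 * sqrt z\<close> is what the arithmetic-geometric
  mean inequality can absorb into the exponentials of the kernel. The factor
  \<open>exp (l * u)\<close> that remains cancels the decay of the gamma density, so this bound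
  serves expectations over the starting point at fixed \<open>u\<close>; integrals in
  \<open>u\<close> rest on exact moments of the Poisson-gamma mixture. The fourth moment is a
  product of two squares: \<open>(1 + x)^2\<close> from Cauchy-Schwarz for the Fisher term, and
  \<open>(1 + x)^2\<close> as the price of integrating \<open>(1 + u)^2\<close>, which pays for one
  factor \<open>1 + u\<close> from \<open>ln h\<close> and one from the time derivative. The
  prescribed mean \<open>a / l\<close> is that of the gamma law and stays constant along the
  path.\<close>

definition hyp :: "real \<Rightarrow> real \<Rightarrow> real" where
  "hyp a z = (\<Sum>k. inverse (fact k * pochhammer a k) * z ^ k)"

lemma inverse_fact_Suc: "real (Suc n) * inverse (fact (Suc n)) = inverse (fact n)"
  by (simp add: field_simps del: of_nat_Suc)

text \<open>The Pochhammer symbols stay above \<open>min 1 a\<close>, so a multiple of the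
  exponential series dominates.\<close>

lemma hyp_summable:
  assumes "a > 0"
  shows "summable (\<lambda>k. inverse (fact k * pochhammer a k) * z ^ k :: real)"
proof (rule summable_comparison_test)
  have *: "a * fact k \<le> a * pochhammer (a + 1) k" for k
  proof -
    have "fact k = pochhammer (1::real) k" by (simp add: pochhammer_fact)
    also have "\<dots> \<le> pochhammer (a + 1) k"
      using assms by (auto simp: pochhammer_prod intro!: prod_mono)
    finally show ?thesis using assms by simp
  qed
  have **: "min 1 a \<le> pochhammer a k" for k
  proof (cases k)
    case (Suc n)
    have "a * 1 \<le> a * pochhammer (a + 1) n"
      using *[of n] assms fact_ge_1[of n, where ?'a=real] by (meson mult_left_mono order_trans less_imp_le)
    then show ?thesis by (simp add: Suc pochhammer_rec)
  qed simp
  show "\<exists>N. \<forall>n\<ge>N. norm (inverse (fact n * pochhammer a n) * z ^ n) \<le> inverse (min 1 a) * (inverse (fact n) * \<bar>z\<bar> ^ n)"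
  proof (intro exI allI impI)
    fix n
    have "inverse (pochhammer a n) \<le> inverse (min 1 a)"
      using **[of n] assms by (intro le_imp_inverse_le) auto
    then have "inverse (pochhammer a n) * (inverse (fact n) * \<bar>z\<bar> ^ n) \<le> inverse (min 1 a) * (inverse (fact n) * \<bar>z\<bar> ^ n)"
      by (intro mult_right_mono) auto
    then show "norm (inverse (fact n * pochhammer a n) * z ^ n) \<le> inverse (min 1 a) * (inverse (fact n) * \<bar>z\<bar> ^ n)"
      using pochhammer_pos[OF assms, of n]
      by (simp add: norm_mult norm_inverse norm_power abs_mult abs_inverse power_abs algebra_simps)
  qed
  show "summable (\<lambda>n. inverse (min 1 a) * (inverse (fact n) * \<bar>z\<bar> ^ n))"
    by (intro summable_mult summable_exp)
qed

lemma hyp_sums: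
  "a > 0 \<Longrightarrow> (\<lambda>k. inverse (fact k * pochhammer a k) * z ^ k) sums hyp a z"
  unfolding hyp_def by (intro summable_sums hyp_summable)

lemma hyp_has_field_derivative:
  assumes "a > 0"
  shows "(hyp a has_field_derivative hyp (a + 1) z / a) (at z)"
proof -
  have "((\<lambda>x. \<Sum>n. inverse (fact n * pochhammer a n) * x ^ n) has_field_derivative
      (\<Sum>n. diffs (\<lambda>n. inverse (fact n * pochhammer a n)) n * z ^ n)) (at z)"
    by (rule termdiffs_strong_converges_everywhere[OF hyp_summable[OF assms]])
  moreover have "diffs (\<lambda>n. inverse (fact n * pochhammer a n)) n * z ^ n
     = (inverse (fact n * pochhammer (a+1) n) * z ^ n) / a" for n
    using inverse_fact_Suc[of n] by (simp add: diffs_def pochhammer_rec divide_inverse del: fact_Suc of_nat_Suc)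
  moreover have "(\<Sum>n. (inverse (fact n * pochhammer (a+1) n) * z ^ n) / a) = hyp (a + 1) z / a"
    using sums_unique[OF sums_divide[OF hyp_sums[of "a+1" z], of a]] assms by simp
  ultimately show ?thesis by (simp add: hyp_def[abs_def])
qed

lemmas hyp_deriv [derivative_intros] = DERIV_chain'[OF _ hyp_has_field_derivative]

lemma hyp_continuous: "a > 0 \<Longrightarrow> continuous_on A (hyp a)"
  by (meson DERIV_isCont continuous_at_imp_continuous_on hyp_has_field_derivative)

lemma hyp_measurable [measurable]: "a > 0 \<Longrightarrow> hyp a \<in> borel_measurable borel"
  by (intro borel_measurable_continuous_onI hyp_continuous)

text \<open>Since \<open>hyp a' = hyp (a + 1) / a\<close>, this is the Bessel-type equation \<open>z I'' + a I' = I\<close>.\<close>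

lemma hyp_contiguous:
  assumes "a > 0"
  shows "z * hyp (a + 2) z / (a * (a + 1)) + hyp (a + 1) z = hyp a z"
proof -
  \<comment> \<open>Both summands become series in
    \<open>inverse (fact k * pochhammer a (Suc k)) * z ^ k\<close>, with coefficients
    \<open>k\<close> and \<open>a\<close>; their sum \<open>k + a\<close> is the last factor of the
    Pochhammer symbol and cancels it.\<close>
  have 1: "(\<lambda>k. of_nat k * (inverse (fact k * pochhammer a (Suc k)) * z ^ k)) sums (z * hyp (a + 2) z / (a * (a + 1)))"
  proof -
    have *: "pochhammer a (Suc (Suc k)) = a * (a + 1) * pochhammer (a + 2) k" for k
      by (simp only: pochhammer_rec mult.assoc) (simp add: add.assoc)
    have "(\<lambda>k. z / (a * (a + 1)) * (inverse (fact k * pochhammer (a + 2) k) * z ^ k)) sums (z / (a * (a + 1)) * hyp (a + 2) z)"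
      using assms by (intro sums_mult hyp_sums) auto
    moreover have "z / (a * (a + 1)) * (inverse (fact k * pochhammer (a + 2) k) * z ^ k)
        = real (Suc k) * (inverse (fact (Suc k) * pochhammer a (Suc (Suc k))) * z ^ Suc k)" for k
      using assms inverse_fact_Suc[of k] unfolding * by (simp add: divide_inverse mult.assoc del: fact_Suc of_nat_Suc)
    ultimately have "(\<lambda>k. real (Suc k) * (inverse (fact (Suc k) * pochhammer a (Suc (Suc k))) * z ^ Suc k)) sums
         (z * hyp (a + 2) z / (a * (a + 1)))" by simp
    then show ?thesis
      by (subst (asm) sums_Suc_iff) simp
  qed
  have "(\<lambda>k. a * (inverse (fact k * pochhammer a (Suc k)) * z ^ k)) sums hyp (a + 1) z"
  proof -
    have "a * (inverse (fact k * pochhammer a (Suc k)) * z ^ k) = inverse (fact k * pochhammer (a + 1) k) * z ^ k" for k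
      using assms by (simp add: pochhammer_rec field_simps)
    then show ?thesis using hyp_sums[of "a+1" z] assms by (simp only:)
  qed
  from sums_add[OF 1 this]
  have "(\<lambda>k. (of_nat k + a) * (inverse (fact k * pochhammer a (Suc k)) * z ^ k)) sums (z * hyp (a + 2) z / (a * (a + 1)) + hyp (a + 1) z)"
    by (simp add: algebra_simps)
  moreover have "(of_nat k + a) * (inverse (fact k * pochhammer a (Suc k)) * z ^ k) = inverse (fact k * pochhammer a k) * z ^ k" for k
  proof -
    have "a + real k \<noteq> 0" using assms by (simp add: add_pos_nonneg less_imp_neq[symmetric])
    then have "(real k + a) * inverse (fact k * (pochhammer a k * (a + real k))) = inverse (fact k * pochhammer a k)"
      by (simp add: add.commute)
    then show ?thesis by (simp only: pochhammer_Suc mult.assoc[symmetric] of_nat_id)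
  qed
  ultimately have "(\<lambda>k. inverse (fact k * pochhammer a k) * z ^ k) sums (z * hyp (a + 2) z / (a * (a + 1)) + hyp (a + 1) z)"
    by (simp only:)
  then show ?thesis by (rule sums_unique2) (rule hyp_sums[OF assms])
qed

lemma hyp_ge_1:
  assumes "a > 0" "z \<ge> 0"
  shows "1 \<le> hyp a z"
proof -
  have "(\<Sum>k<1. inverse (fact k * pochhammer a k) * z ^ k) \<le> hyp a z"
    unfolding hyp_def using assms pochhammer_pos[of a]
    by (intro sum_le_suminf hyp_summable) (auto intro!: mult_nonneg_nonneg simp: less_imp_le)
  then show ?thesis by simp
qed

lemma hyp_antimono:
  assumes "0 < a" "a \<le> b" "z \<ge> 0"
  shows "hyp b z \<le> hyp a z"
  unfolding hyp_def
proof (intro suminf_le hyp_summable allI)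
  fix k
  have "pochhammer a k \<le> pochhammer b k"
    using assms by (auto simp: pochhammer_prod intro!: prod_mono)
  then show "inverse (fact k * pochhammer a k) * z ^ k \<ge> inverse (fact k * pochhammer b k) * z ^ k"
    using assms pochhammer_pos[of a k]
    by (intro mult_right_mono le_imp_inverse_le mult_left_mono) auto
qed (use assms in auto)

text \<open>For \<open>a = 1/2\<close> the duplication formula makes
  \<open>fact k * pochhammer (1/2) k\<close> equal to \<open>fact (2 * k) / 4 ^ k\<close>, so the
  series is the even part of the exponential series at \<open>2 * sqrt z\<close>. Larger parameters
  only decrease the terms.\<close>

lemma hyp_le_exp:
  assumes "a \<ge> 1/2" "z \<ge> 0"
  shows "hyp a z \<le> exp (2 * sqrt z)"
proof -
  have term_eq: "inverse (fact k * pochhammer (1/2) k) * z ^ k = inverse (fact (2*k)) * (2 * sqrt z) ^ (2*k)" for k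
  proof -
    have "(fact (2*k) :: real) = 4 ^ k * pochhammer (1/2) k * fact k"
      by (simp add: fact_double power_mult)
    moreover have "(2 * sqrt z) ^ (2*k) = 4 ^ k * z ^ k"
    proof -
      have "(2 * sqrt z) ^ (2*k) = ((2 * sqrt z)^2) ^ k" by (simp only: power_mult)
      also have "(2 * sqrt z)^2 = 4 * z" using assms by (simp add: power_mult_distrib)
      finally show ?thesis by (simp only: power_mult_distrib)
    qed
    ultimately show ?thesis using pochhammer_pos[of "1/2::real" k] by (simp add: field_simps)
  qed
  let ?y = "2 * sqrt z"
  have y: "?y \<ge> 0" using assms by simp
  have even_part: "(\<Sum>k<N. inverse (fact (2*k)) * ?y ^ (2*k)) \<le> (\<Sum>m<2*N. inverse (fact m) * ?y ^ m)" for N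
  proof (induction N)
    case (Suc N)
    have "0 \<le> inverse (fact (Suc (2*N))) * ?y ^ (Suc (2*N))"
      using y by (intro mult_nonneg_nonneg) (auto simp del: fact_Suc)
    then show ?case using Suc by (simp del: fact_Suc power_Suc)
  qed simp
  have "hyp a z \<le> hyp (1/2) z" using assms by (intro hyp_antimono) auto
  also have "\<dots> \<le> exp ?y"
    unfolding hyp_def
  proof (rule suminf_le_const[OF hyp_summable])
    fix N
    have "(\<Sum>k<N. inverse (fact k * pochhammer (1/2) k) * z ^ k) \<le> (\<Sum>m<2*N. inverse (fact m) * ?y ^ m)"
      unfolding term_eq by (rule even_part)
    also have "\<dots> \<le> (\<Sum>m. inverse (fact m) * ?y ^ m)"
      using y by (intro sum_le_suminf summable_exp) auto
    also have "\<dots> = exp ?y" by (simp add: exp_def)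
    finally show "(\<Sum>k<N. inverse (fact k * pochhammer (1/2) k) * z ^ k) \<le> exp ?y" .
  qed simp
  finally show ?thesis .
qed

section \<open>Integrals and derivatives\<close>

text \<open>The mean value inequality on the convex set \<open>U\<close> dominates the difference
  quotients by \<open>g\<close>. The exceptional points are described by one predicate
  \<open>P\<close> independent of \<open>t\<close>, so a single null set serves all parameters; in
  the applications \<open>P\<close> says that the starting point is positive.\<close>

lemma has_derivative_under_integral:
  fixes f f' :: "real \<Rightarrow> 'a \<Rightarrow> real"
  assumes "open U" "convex U" "t0 \<in> U"
    and int: "\<And>t. t \<in> U \<Longrightarrow> integrable M (f t)"
    and meas: "f' t0 \<in> borel_measurable M"
    and deriv: "\<And>t x. t \<in> U \<Longrightarrow> x \<in> space M \<Longrightarrow> P x \<Longrightarrow> ((\<lambda>t. f t x) has_real_derivative f' t x) (at t)"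
    and bound: "\<And>t x. t \<in> U \<Longrightarrow> x \<in> space M \<Longrightarrow> P x \<Longrightarrow> \<bar>f' t x\<bar> \<le> g x"
    and P: "AE x in M. P x"
    and g: "integrable M g"
  shows "((\<lambda>t. \<integral>x. f t x \<partial>M) has_real_derivative (\<integral>x. f' t0 x \<partial>M)) (at t0)"
    and "integrable M (f' t0)"
proof -
  show int': "integrable M (f' t0)"
  proof (rule Bochner_Integration.integrable_bound[OF g meas])
    show "AE x in M. norm (f' t0 x) \<le> norm (g x)"
      using P AE_space by eventually_elim (use bound[OF \<open>t0 \<in> U\<close>] in force)
  qed
  show "((\<lambda>t. \<integral>x. f t x \<partial>M) has_real_derivative (\<integral>x. f' t0 x \<partial>M)) (at t0)"
    unfolding has_field_derivative_iff
  proof (subst tendsto_at_iff_sequentially, intro allI impI)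
    fix X :: "nat \<Rightarrow> real"
    assume X: "\<forall>i. X i \<in> UNIV - {t0}" and lim: "X \<longlonglongrightarrow> t0"
    have evU: "\<forall>\<^sub>F n in sequentially. X n \<in> U"
      using lim \<open>open U\<close> \<open>t0 \<in> U\<close> by (rule topological_tendstoD)
    then obtain N where N: "\<And>n. n \<ge> N \<Longrightarrow> X n \<in> U" by (auto simp: eventually_sequentially)
    define Y where "Y n = X (n + N)" for n
    have YU: "Y n \<in> U" "Y n \<noteq> t0" for n using N X by (auto simp: Y_def)
    have Y: "Y \<longlonglongrightarrow> t0" using lim unfolding Y_def by (rule LIMSEQ_ignore_initial_segment)
    have "(\<lambda>n. \<integral>x. (f (Y n) x - f t0 x) / (Y n - t0) \<partial>M) \<longlonglongrightarrow> (\<integral>x. f' t0 x \<partial>M)"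
    proof (rule integral_dominated_convergence[where w=g])
      show "AE x in M. (\<lambda>n. (f (Y n) x - f t0 x) / (Y n - t0)) \<longlonglongrightarrow> f' t0 x"
        using P
      proof (rule AE_mp, intro AE_I2 impI)
        fix x assume x: "x \<in> space M" "P x"
        have "((\<lambda>t. (f t x - f t0 x) / (t - t0)) \<longlongrightarrow> f' t0 x) (at t0)"
          using deriv[OF \<open>t0 \<in> U\<close> x] by (simp add: has_field_derivative_iff)
        then show "(\<lambda>n. (f (Y n) x - f t0 x) / (Y n - t0)) \<longlonglongrightarrow> f' t0 x"
          unfolding tendsto_at_iff_sequentially comp_def using YU Y by auto
      qed
      show "AE x in M. norm ((f (Y n) x - f t0 x) / (Y n - t0)) \<le> g x" for n
        using P
      proof (rule AE_mp, intro AE_I2 impI)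
        fix x assume x: "x \<in> space M" "P x"
        have "norm (f (Y n) x - f t0 x) \<le> g x * norm (Y n - t0)"
          by (rule field_differentiable_bound[OF \<open>convex U\<close>, where f'="\<lambda>t. f' t x"])
             (use deriv x bound YU \<open>t0 \<in> U\<close> in \<open>auto intro: has_field_derivative_at_within\<close>)
        then show "norm ((f (Y n) x - f t0 x) / (Y n - t0)) \<le> g x"
          using YU[of n] by (simp add: field_simps)
      qed
      show "(\<lambda>x. (f (Y n) x - f t0 x) / (Y n - t0)) \<in> borel_measurable M" for n
        using int[OF YU(1)] int[OF \<open>t0 \<in> U\<close>] by (intro borel_measurable_divide borel_measurable_diff borel_measurable_const borel_measurable_integrable)
    qed (use meas g in auto)
    moreover have "(\<integral>x. (f (Y n) x - f t0 x) / (Y n - t0) \<partial>M) = ((\<integral>x. f (Y n) x \<partial>M) - (\<integral>x. f t0 x \<partial>M)) / (Y n - t0)" for n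
      using int[OF YU(1)[of n]] int[OF \<open>t0 \<in> U\<close>] by simp
    ultimately have "(\<lambda>n. ((\<integral>x. f (Y n) x \<partial>M) - (\<integral>x. f t0 x \<partial>M)) / (Y n - t0)) \<longlonglongrightarrow> (\<integral>x. f' t0 x \<partial>M)"
      by (simp only:)
    then show "((\<lambda>y. ((\<integral>x. f y x \<partial>M) - (\<integral>x. f t0 x \<partial>M)) / (y - t0)) \<circ> X) \<longlonglongrightarrow> (\<integral>x. f' t0 x \<partial>M)"
      unfolding Y_def comp_def by (rule LIMSEQ_offset)
  qed
qed

lemma integral_FTC_interval:
  fixes F f :: "real \<Rightarrow> real"
  assumes "a \<le> b" and D: "\<And>x. a \<le> x \<Longrightarrow> x \<le> b \<Longrightarrow> (F has_real_derivative f x) (at x)"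
    and i: "set_integrable lborel {a..b} f"
  shows "(LINT x:{a..b}|lborel. f x) = F b - F a"
proof -
  have "(f has_integral (F b - F a)) {a..b}"
    by (rule fundamental_theorem_of_calculus[OF \<open>a \<le> b\<close>])
       (use D in \<open>auto simp: has_real_derivative_iff_has_vector_derivative[symmetric] intro: has_field_derivative_at_within\<close>)
  then show ?thesis using set_borel_integral_eq_integral(2)[OF i] by (simp add: integral_unique)
qed

text \<open>Averaging \<open>F (2 * u) - F u\<close> against the scale-invariant measure \<open>du / u\<close> kills the
  boundary terms without any pointwise information on \<open>F\<close> at \<open>0\<close> and \<open>\<infinity>\<close>.\<close>

lemma integral_deriv_halfline_eq_0:
  fixes F f :: "real \<Rightarrow> real"
  assumes D: "\<And>u. u > 0 \<Longrightarrow> (F has_real_derivative f u) (at u)"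
    and f: "set_integrable lborel {0<..} f"
    and F: "set_integrable lborel {0<..} (\<lambda>u. F u / u)"
  shows "(LINT u:{0<..}|lborel. f u) = 0"
proof -
  define f0 where "f0 u = indicator {0<..} u * f u" for u
  define G where "G u = indicator {0<..} u * (F u / u)" for u
  have f0: "integrable lborel f0" and G: "integrable lborel G"
    using f F by (simp_all add: f0_def[abs_def] G_def[abs_def] set_integrable_def)
  have f0m [measurable]: "f0 \<in> borel_measurable borel" using f0 by auto
  have scal: "integrable lborel (\<lambda>u. f0 (s * u))" "(\<integral>u. f0 (s * u) \<partial>lborel) = (\<integral>u. f0 u \<partial>lborel) / s"
    if "s > 0" for s
    using lborel_integrable_real_affine[OF f0, of s 0] lborel_integral_real_affine[of s f0 0] that by auto
  \<comment> \<open>Fubini for \<open>f (s * u)\<close> over \<open>1 \<le> s \<le> 2\<close> and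
    \<open>u > 0\<close>: integrating in \<open>u\<close> first gives \<open>ln 2\<close> times the
    integral of \<open>f\<close>, integrating in \<open>s\<close> first gives
    \<open>(F (2 * u) - F u) / u\<close>, whose integral vanishes by scaling.\<close>
  define H where "H = (\<lambda>(s::real,u::real). indicator {1..2} s * f0 (s * u))"
  have Hm [measurable]: "H \<in> borel_measurable (lborel \<Otimes>\<^sub>M lborel)"
    unfolding H_def by measurable
  have Hint: "integrable (lborel \<Otimes>\<^sub>M lborel) H"
  proof (rule lborel_pair.Fubini_integrable)
    have "(\<integral>u. norm (H (s, u)) \<partial>lborel) = indicator {1..2} s * (\<integral>u. norm (f0 u) \<partial>lborel) / s" for s
      using lborel_integral_real_affine[of s "\<lambda>u. norm (f0 u)" 0]
      by (cases "s \<in> {1..2}") (auto simp: H_def)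
    moreover have "set_integrable lborel {1..2} (\<lambda>s. (\<integral>u. norm (f0 u) \<partial>lborel) / s)"
      by (intro borel_integrable_atLeastAtMost' continuous_intros) auto
    ultimately show "integrable lborel (\<lambda>s. \<integral>u. norm (H (s, u)) \<partial>lborel)"
      by (simp add: set_integrable_def)
    show "AE s in lborel. integrable lborel (\<lambda>u. H (s, u))"
      using scal by (auto simp: H_def indicator_def intro!: AE_I2 integrable_mult_right)
  qed simp
  have "(\<integral>s. (\<integral>u. H (s, u) \<partial>lborel) \<partial>lborel) = (LINT s:{1..2}|lborel. (\<integral>u. f0 u \<partial>lborel) * inverse s)"
    unfolding set_lebesgue_integral_def
    by (intro Bochner_Integration.integral_cong) (auto simp: H_def scal indicator_def divide_inverse)
  also have "\<dots> = (\<integral>u. f0 u \<partial>lborel) * ln 2 - (\<integral>u. f0 u \<partial>lborel) * ln 1"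
    by (rule integral_FTC_interval)
       (auto intro!: derivative_eq_intros borel_integrable_atLeastAtMost' continuous_intros simp: divide_inverse)
  finally have 1: "(\<integral>s. (\<integral>u. H (s, u) \<partial>lborel) \<partial>lborel) = (\<integral>u. f0 u \<partial>lborel) * ln 2" by simp
  have "(\<integral>u. (\<integral>s. H (s, u) \<partial>lborel) \<partial>lborel) = (\<integral>u. 2 * G (2 * u) - G u \<partial>lborel)"
  proof (rule integral_cong_AE)
    show "(\<lambda>u. \<integral>s. H (s, u) \<partial>lborel) \<in> borel_measurable lborel" by measurable
    show "(\<lambda>u. 2 * G (2 * u) - G u) \<in> borel_measurable lborel"
      using G by (intro borel_measurable_diff borel_measurable_times borel_measurable_const)
        (auto intro!: measurable_compose[of _ lborel borel G])
    have "AE u in lborel. integrable lborel (\<lambda>s. H (s, u))"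
      using lborel_pair.AE_integrable_snd[of "\<lambda>s u. H (s, u)"] Hint by (simp add: case_prod_unfold)
    then show "AE u in lborel. (\<integral>s. H (s, u) \<partial>lborel) = 2 * G (2 * u) - G u"
    proof (rule AE_mp, intro AE_I2 impI)
      fix u assume i: "integrable lborel (\<lambda>s. H (s, u))"
      show "(\<integral>s. H (s, u) \<partial>lborel) = 2 * G (2 * u) - G u"
      proof (cases "u > 0")
        case False
        then show ?thesis by (auto simp: H_def G_def f0_def indicator_def zero_less_mult_iff intro!: integral_cong_AE Bochner_Integration.integral_eq_zero_AE)
      next
        case True
        have eq: "H (s, u) = indicator {1..2} s * f (s * u)" for s
          using True by (auto simp: H_def f0_def indicator_def)
        have i': "set_integrable lborel {1..2} (\<lambda>s. f (s * u))"
          using i unfolding eq by (simp add: set_integrable_def)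
        have "(\<integral>s. H (s, u) \<partial>lborel) = (LINT s:{1..2}|lborel. f (s * u))"
          unfolding eq by (simp add: set_lebesgue_integral_def)
        also have "\<dots> = F (2 * u) / u - F (1 * u) / u"
        proof (rule integral_FTC_interval[OF _ _ i'])
          fix s :: real assume "1 \<le> s" "s \<le> 2"
          then have "(F has_real_derivative f (s * u)) (at (s * u))" using True by (intro D) auto
          then show "((\<lambda>s. F (s * u) / u) has_real_derivative f (s * u)) (at s)"
            using True by (auto intro!: derivative_eq_intros DERIV_chain'[of "\<lambda>s. s * u" u])
        qed simp
        finally show ?thesis using True by (simp add: G_def)
      qed
    qed
  qed
  also have "\<dots> = 2 * (\<integral>u. G (2 * u) \<partial>lborel) - (\<integral>u. G u \<partial>lborel)"
    using lborel_integrable_real_affine[OF G, of 2 0] G by simp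
  also have "\<dots> = 0"
    using lborel_integral_real_affine[of 2 G 0] by simp
  finally have 2: "(\<integral>u. (\<integral>s. H (s, u) \<partial>lborel) \<partial>lborel) = 0" .
  have "(\<integral>u. (\<integral>s. H (s, u) \<partial>lborel) \<partial>lborel) = (\<integral>s. (\<integral>u. H (s, u) \<partial>lborel) \<partial>lborel)"
    using lborel_pair.Fubini_integral[of "\<lambda>s u. H (s, u)"] Hint by (simp add: case_prod_unfold)
  then have "(\<integral>u. f0 u \<partial>lborel) = 0" using 1 2 by simp
  then show ?thesis by (simp add: f0_def set_lebesgue_integral_def)
qed

section \<open>The transition kernel\<close>

text \<open>\<open>kA l t * x\<close> is the mean of the Poisson index for the starting point
  \<open>x\<close>; the same constant multiplies \<open>u\<close> in the kernel because
  \<open>l + kA l t\<close> is the rate \<open>l / (1 - t)\<close> of the mixed gamma laws.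
  \<open>kB l t\<close> is the product of \<open>kA l t\<close> with this rate. The primed versions
  are the derivatives in \<open>t\<close>.\<close>

definition kA :: "real \<Rightarrow> real \<Rightarrow> real" where "kA l t = l * t / (1 - t)"
definition kB :: "real \<Rightarrow> real \<Rightarrow> real" where "kB l t = l\<^sup>2 * t / (1 - t)\<^sup>2"
definition kA' :: "real \<Rightarrow> real \<Rightarrow> real" where "kA' l t = l / (1 - t)\<^sup>2"
definition kB' :: "real \<Rightarrow> real \<Rightarrow> real" where "kB' l t = l\<^sup>2 * (1 + t) / (1 - t) ^ 3"

text \<open>The density of the path started at \<open>x\<close>, relative to the gamma law, at the point \<open>u\<close>:
  the Hardy--Hille kernel.\<close>

definition kern :: "real \<Rightarrow> real \<Rightarrow> real \<Rightarrow> real \<Rightarrow> real \<Rightarrow> real" where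
  "kern a l t u x = (1 - t) powr (- a) * exp (- (kA l t * (x + u))) * hyp a (kB l t * x * u)"

abbreviation gkern :: "real \<Rightarrow> real \<Rightarrow> real \<Rightarrow> real \<Rightarrow> real \<Rightarrow> real" where
  "gkern a l t u x \<equiv> gamma_density a l u * kern a l t u x"

definition kern_du :: "real \<Rightarrow> real \<Rightarrow> real \<Rightarrow> real \<Rightarrow> real \<Rightarrow> real" where
  "kern_du a l t u x = (1 - t) powr (- a) * exp (- (kA l t * (x + u))) *
     (kB l t * x * (hyp (a + 1) (kB l t * x * u) / a) - kA l t * hyp a (kB l t * x * u))"

definition kern_dt :: "real \<Rightarrow> real \<Rightarrow> real \<Rightarrow> real \<Rightarrow> real \<Rightarrow> real" where
  "kern_dt a l t u x = (1 - t) powr (- a) * exp (- (kA l t * (x + u))) *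
     ((a / (1 - t) - kA' l t * (x + u)) * hyp a (kB l t * x * u)
      + kB' l t * x * u * (hyp (a + 1) (kB l t * x * u) / a))"

lemma kA_nonneg: "l > 0 \<Longrightarrow> 0 \<le> t \<Longrightarrow> t < 1 \<Longrightarrow> 0 \<le> kA l t"
  by (simp add: kA_def)

lemma kB_nonneg: "l > 0 \<Longrightarrow> 0 \<le> t \<Longrightarrow> t < 1 \<Longrightarrow> 0 \<le> kB l t"
  by (simp add: kB_def)

lemma kA'_nonneg: "l > 0 \<Longrightarrow> 0 \<le> t \<Longrightarrow> t < 1 \<Longrightarrow> 0 \<le> kA' l t"
  by (simp add: kA'_def)

lemma kB'_nonneg: "l > 0 \<Longrightarrow> 0 \<le> t \<Longrightarrow> t < 1 \<Longrightarrow> 0 \<le> kB' l t"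
  by (simp add: kB'_def)

lemma kA_mono: "l > 0 \<Longrightarrow> 0 \<le> s \<Longrightarrow> s \<le> t \<Longrightarrow> t < 1 \<Longrightarrow> kA l s \<le> kA l t"
  unfolding kA_def by (intro frac_le mult_mono) auto

lemma kA'_mono: "l > 0 \<Longrightarrow> 0 \<le> s \<Longrightarrow> s \<le> t \<Longrightarrow> t < 1 \<Longrightarrow> kA' l s \<le> kA' l t"
  unfolding kA'_def by (intro frac_le mult_mono power_mono) auto

lemma kB'_mono: "l > 0 \<Longrightarrow> 0 \<le> s \<Longrightarrow> s \<le> t \<Longrightarrow> t < 1 \<Longrightarrow> kB' l s \<le> kB' l t"
  unfolding kB'_def by (intro frac_le mult_mono power_mono) auto

lemma kA_deriv: "t < 1 \<Longrightarrow> (kA l has_real_derivative kA' l t) (at t)"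
  unfolding kA_def[abs_def] kA'_def
  by (auto intro!: derivative_eq_intros simp: field_simps power2_eq_square)

lemma kB_deriv: "t < 1 \<Longrightarrow> (kB l has_real_derivative kB' l t) (at t)"
proof -
  assume "t < 1"
  moreover have "(l\<^sup>2 * (1 - t)\<^sup>2 - l\<^sup>2 * t * (2 * (1 - t) * - 1)) / ((1 - t)\<^sup>2 * (1 - t)\<^sup>2) = kB' l t" if "t < 1"
  proof -
    define v where "v = 1 - t"
    have v: "v \<noteq> 0" "t = 1 - v" using that by (auto simp: v_def)
    show ?thesis unfolding kB'_def v_def[symmetric] using v(1) unfolding v(2)
      by (simp add: field_simps power2_eq_square power3_eq_cube)
  qed
  ultimately show ?thesis
    unfolding kB_def[abs_def]
    by (auto intro!: derivative_eq_intros simp: power2_eq_square)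
qed

lemma kern_measurable [measurable]:
  assumes "a > 0" and [measurable]: "f \<in> borel_measurable M" "g \<in> borel_measurable M" "k \<in> borel_measurable M"
  shows "(\<lambda>w. kern a l (f w) (g w) (k w)) \<in> borel_measurable M"
proof -
  have [measurable]: "hyp a \<in> borel_measurable borel"
    using \<open>a > 0\<close> by (rule hyp_measurable)
  show ?thesis unfolding kern_def kA_def kB_def by measurable
qed

lemma kern_du_measurable [measurable]:
  assumes "a > 0" and [measurable]: "f \<in> borel_measurable M" "g \<in> borel_measurable M" "k \<in> borel_measurable M"
  shows "(\<lambda>w. kern_du a l (f w) (g w) (k w)) \<in> borel_measurable M"
proof -
  have [measurable]: "hyp a \<in> borel_measurable borel" "hyp (a + 1) \<in> borel_measurable borel"
    using \<open>a > 0\<close> by (auto intro!: hyp_measurable)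
  show ?thesis unfolding kern_du_def kA_def kB_def by measurable
qed

lemma kern_dt_measurable [measurable]:
  assumes "a > 0" and [measurable]: "f \<in> borel_measurable M" "g \<in> borel_measurable M" "k \<in> borel_measurable M"
  shows "(\<lambda>w. kern_dt a l (f w) (g w) (k w)) \<in> borel_measurable M"
proof -
  have [measurable]: "hyp a \<in> borel_measurable borel" "hyp (a + 1) \<in> borel_measurable borel"
    using \<open>a > 0\<close> by (auto intro!: hyp_measurable)
  show ?thesis unfolding kern_dt_def kA_def kB_def kA'_def kB'_def by measurable
qed

lemma gamma_density_measurable [measurable]: "gamma_density a l \<in> borel_measurable borel"
  unfolding gamma_density_def by measurable

text \<open>This is reversibility of the transition with respect to the gamma law. In
  \<open>Ent_le_entropy\<close> it lets the kernel be read as a probability density in the starting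
  point.\<close>

lemma kern_sym: "kern a l t u x = kern a l t x u"
  by (simp add: kern_def add.commute mult.commute mult.left_commute)

section \<open>Pointwise bounds on the kernel and its derivatives\<close>

context
  fixes a l t x u :: real
  assumes a: "a \<ge> 1/2" and l: "l > 0" and t: "0 < t" "t < 1" and xu: "x \<ge> 0" "u \<ge> 0"
begin

lemma kern_arg: "0 \<le> kB l t * x * u"
  using kB_nonneg[of l t] l t xu by simp

lemma kern_ge: "exp (- (kA l t * (x + u))) \<le> kern a l t u x"
proof -
  have "1 \<le> (1 - t) powr (- a)" using ge_one_powr_ge_zero[of "inverse (1 - t)" a] a t
    by (simp add: powr_minus inverse_powr one_le_inverse_iff)
  then have "1 * exp (- (kA l t * (x + u))) * 1 \<le> kern a l t u x"
    unfolding kern_def using hyp_ge_1[OF _ kern_arg, of a] a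
    by (intro mult_mono) auto
  then show ?thesis by simp
qed

lemma kern_pos: "0 < kern a l t u x"
  by (rule less_le_trans[OF _ kern_ge]) simp

text \<open>With \<open>r = l / (1 - t)\<close> the argument of \<open>hyp\<close> is the product of
  \<open>kA l t * x\<close> and \<open>r * u\<close>. The arithmetic-geometric mean inequality with
  this splitting cancels all growth in \<open>x\<close>; since \<open>r = kA l t + l\<close>,
  exactly \<open>exp (l * u)\<close> is left.\<close>

lemma kern_le: "kern a l t u x \<le> (1 - t) powr (- a) * exp (l * u)"
proof -
  define r where "r = l / (1 - t)"
  have B: "kB l t * x * u = (kA l t * x) * (r * u)"
    by (simp add: kB_def kA_def r_def power2_eq_square)
  have r: "r = kA l t + l" using t by (simp add: r_def kA_def field_simps)
  have nn: "0 \<le> kA l t * x" "0 \<le> r * u" using kA_nonneg[of l t] l t xu by (auto simp: r_def)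
  have "2 * sqrt (kB l t * x * u) \<le> kA l t * x + r * u"
    using arith_geo_mean_sqrt[OF nn] unfolding B by simp
  then have "2 * sqrt (kB l t * x * u) - kA l t * (x + u) \<le> l * u"
    by (simp add: r algebra_simps)
  then have "exp (- (kA l t * (x + u))) * exp (2 * sqrt (kB l t * x * u)) \<le> exp (l * u)"
    by (simp add: exp_add[symmetric])
  moreover have "exp (- (kA l t * (x + u))) * hyp a (kB l t * x * u) \<le> exp (- (kA l t * (x + u))) * exp (2 * sqrt (kB l t * x * u))"
    using hyp_le_exp[OF a kern_arg] by simp
  ultimately have "exp (- (kA l t * (x + u))) * hyp a (kB l t * x * u) \<le> exp (l * u)" by linarith
  then have "(1 - t) powr (- a) * (exp (- (kA l t * (x + u))) * hyp a (kB l t * x * u)) \<le> (1 - t) powr (- a) * exp (l * u)"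
    by (intro mult_left_mono) auto
  then show ?thesis unfolding kern_def by (simp only: mult.assoc)
qed

text \<open>Here the square root is split evenly between \<open>x\<close> and \<open>u\<close>. The
  bound grows in both variables, but unlike \<open>kern_le\<close> its coefficients tend to 0 with
  \<open>t\<close>, as needed for the entropy to vanish at time 0.\<close>

lemma ln_kern_le: "ln (kern a l t u x) \<le> - a * ln (1 - t) + sqrt (kB l t) * (x + u)"
proof -
  have "2 * sqrt (kB l t * x * u) = sqrt (kB l t) * (2 * sqrt (x * u))"
    by (simp add: real_sqrt_mult)
  also have "\<dots> \<le> sqrt (kB l t) * (x + u)"
    using arith_geo_mean_sqrt[OF xu] kB_nonneg[of l t] l t by (intro mult_left_mono) auto
  finally have "exp (2 * sqrt (kB l t * x * u)) \<le> exp (sqrt (kB l t) * (x + u))" by simp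
  with hyp_le_exp[OF a kern_arg] have h: "hyp a (kB l t * x * u) \<le> exp (sqrt (kB l t) * (x + u))"
    by (rule order_trans)
  have "exp (- (kA l t * (x + u))) \<le> 1"
    using kA_nonneg[of l t] l t xu by simp
  then have "exp (- (kA l t * (x + u))) * hyp a (kB l t * x * u) \<le> 1 * exp (sqrt (kB l t) * (x + u))"
    using hyp_ge_1[OF _ kern_arg, of a] a h by (intro mult_mono) auto
  then have "(1 - t) powr (- a) * (exp (- (kA l t * (x + u))) * hyp a (kB l t * x * u)) \<le> (1 - t) powr (- a) * exp (sqrt (kB l t) * (x + u))"
    by (intro mult_left_mono) auto
  then have "kern a l t u x \<le> (1 - t) powr (- a) * exp (sqrt (kB l t) * (x + u))"
    unfolding kern_def by (simp only: mult.assoc)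
  also have "\<dots> = exp (- a * ln (1 - t) + sqrt (kB l t) * (x + u))"
    using t by (simp add: powr_def exp_add[symmetric])
  finally show ?thesis using kern_pos by (metis ln_exp ln_le_cancel_iff exp_gt_zero)
qed

lemma hyp_Suc_bound: "0 \<le> hyp (a + 1) (kB l t * x * u) / a" "hyp (a + 1) (kB l t * x * u) / a \<le> 2 * hyp a (kB l t * x * u)"
proof -
  have *: "0 \<le> hyp (a + 1) (kB l t * x * u)" using hyp_ge_1[OF _ kern_arg, of "a+1"] a by simp
  then show "0 \<le> hyp (a + 1) (kB l t * x * u) / a" using a by simp
  have "hyp (a + 1) (kB l t * x * u) / a \<le> hyp (a + 1) (kB l t * x * u) / (1/2)"
    using a * by (intro divide_left_mono) auto
  also have "\<dots> \<le> 2 * hyp a (kB l t * x * u)"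
    using hyp_antimono[OF _ _ kern_arg, of a "a+1"] a by simp
  finally show "hyp (a + 1) (kB l t * x * u) / a \<le> 2 * hyp a (kB l t * x * u)" .
qed

lemma kern_du_bound: "\<bar>kern_du a l t u x\<bar> \<le> kern a l t u x * (kA l t + 2 * kB l t * x)"
proof -
  let ?I = "hyp a (kB l t * x * u)" and ?I' = "hyp (a + 1) (kB l t * x * u) / a"
  have nn: "0 \<le> kA l t" "0 \<le> kB l t * x" "0 \<le> ?I"
    using kA_nonneg[of l t] kB_nonneg[of l t] l t xu hyp_ge_1[OF _ kern_arg, of a] a by auto
  have "kB l t * x * ?I' \<le> kB l t * x * (2 * ?I)" "0 \<le> kB l t * x * ?I'" "0 \<le> kA l t * ?I"
    using hyp_Suc_bound nn by (auto intro: mult_left_mono simp del: times_divide_eq_right)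
  then have "\<bar>kB l t * x * ?I' - kA l t * ?I\<bar> \<le> ?I * (kA l t + 2 * kB l t * x)"
    by (simp add: algebra_simps abs_le_iff)
  then have "(1 - t) powr (- a) * exp (- (kA l t * (x + u))) * \<bar>kB l t * x * ?I' - kA l t * ?I\<bar> \<le>
     (1 - t) powr (- a) * exp (- (kA l t * (x + u))) * (?I * (kA l t + 2 * kB l t * x))"
    by (intro mult_left_mono) auto
  then show ?thesis unfolding kern_def kern_du_def abs_mult by (simp add: mult.assoc)
qed

lemma kern_dt_bound: "\<bar>kern_dt a l t u x\<bar> \<le> kern a l t u x * (a / (1 - t) + kA' l t * (x + u) + 2 * kB' l t * x * u)"
proof -
  let ?I = "hyp a (kB l t * x * u)" and ?I' = "hyp (a + 1) (kB l t * x * u) / a"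
  have nn: "0 \<le> a / (1 - t)" "0 \<le> kA' l t * (x + u)" "0 \<le> kB' l t * x * u" "0 \<le> ?I"
    using kA'_nonneg[of l t] kB'_nonneg[of l t] l t xu hyp_ge_1[OF _ kern_arg, of a] a by auto
  have "kB' l t * x * u * ?I' \<le> kB' l t * x * u * (2 * ?I)" "0 \<le> kB' l t * x * u * ?I'"
     "0 \<le> a / (1 - t) * ?I" "0 \<le> kA' l t * (x + u) * ?I"
    using hyp_Suc_bound nn by (auto intro: mult_left_mono simp del: times_divide_eq_right times_divide_eq_left)
  then have "\<bar>(a / (1 - t) - kA' l t * (x + u)) * ?I + kB' l t * x * u * ?I'\<bar> \<le>
      ?I * (a / (1 - t) + kA' l t * (x + u) + 2 * kB' l t * x * u)"
  proof -
    define c d e I I' where cde: "c = a / (1 - t)" "d = kA' l t * (x + u)" "e = kB' l t * x * u"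
      "I = ?I" "I' = ?I'"
    assume "kB' l t * x * u * ?I' \<le> kB' l t * x * u * (2 * ?I)" "0 \<le> kB' l t * x * u * ?I'"
     "0 \<le> a / (1 - t) * ?I" "0 \<le> kA' l t * (x + u) * ?I"
    then have "e * I' \<le> e * (2 * I)" "0 \<le> e * I'" "0 \<le> c * I" "0 \<le> d * I"
      unfolding cde .
    moreover have e2: "2 * kB' l t * x * u = 2 * e" by (simp add: cde)
    ultimately show ?thesis unfolding e2 cde[symmetric] by (simp add: algebra_simps abs_le_iff)
  qed
  then have "(1 - t) powr (- a) * exp (- (kA l t * (x + u))) * \<bar>(a / (1 - t) - kA' l t * (x + u)) * ?I + kB' l t * x * u * ?I'\<bar> \<le>
     (1 - t) powr (- a) * exp (- (kA l t * (x + u))) * (?I * (a / (1 - t) + kA' l t * (x + u) + 2 * kB' l t * x * u))"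
    by (intro mult_left_mono) auto
  then show ?thesis unfolding kern_def kern_dt_def abs_mult by (simp add: mult.assoc)
qed

end

lemma kern_has_du:
  assumes "a > 0"
  shows "((\<lambda>u. kern a l t u x) has_real_derivative kern_du a l t u x) (at u)"
  unfolding kern_def kern_du_def using assms
  by (auto intro!: derivative_eq_intros simp: algebra_simps)

lemma kern_has_dt:
  assumes "a > 0" "t < 1"
  shows "((\<lambda>t. kern a l t u x) has_real_derivative kern_dt a l t u x) (at t)"
proof -
  have p: "((\<lambda>t. (1 - t) powr (- a)) has_real_derivative (1 - t) powr (- a) * (a / (1 - t))) (at t)"
    using assms by (auto intro!: derivative_eq_intros simp: powr_diff field_simps)
  have e: "((\<lambda>t. exp (- (kA l t * (x + u)))) has_real_derivative exp (- (kA l t * (x + u))) * (- (kA' l t * (x + u)))) (at t)"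
    using assms by (auto intro!: derivative_eq_intros kA_deriv)
  have h: "((\<lambda>t. hyp a (kB l t * x * u)) has_real_derivative (hyp (a + 1) (kB l t * x * u) / a) * (kB' l t * x * u)) (at t)"
    using assms by (auto intro!: derivative_eq_intros kB_deriv)
  show ?thesis
    unfolding kern_def kern_dt_def
    by (rule DERIV_cong[OF DERIV_mult[OF DERIV_mult[OF p e] h]]) (simp add: algebra_simps)
qed

text \<open>After multiplication by the gamma density this is the evolution equation of the path in divergence
  form, \<open>d/du (u \<gamma> dq/du) = - l t \<gamma> dq/dt\<close> for \<open>q = kern a l t u x\<close>.\<close>

lemma kern_pde:
  assumes a: "a > 0" and t: "t < 1"
  shows "((\<lambda>u. u * kern_du a l t u x) has_real_derivative
     (- l * t * kern_dt a l t u x - (a - 1 - l * u) * kern_du a l t u x)) (at u)"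
proof -
  let ?z = "kB l t * x * u" and ?A = "kA l t" and ?B = "kB l t"
  let ?p = "(1 - t) powr (- a) * exp (- (?A * (x + u)))"
  define I I1 I2 where "I = hyp a ?z" and "I1 = hyp (a + 1) ?z / a" and "I2 = hyp (a + 2) ?z / (a * (a + 1))"
  have ode: "?z * I2 = I - a * I1"
    using hyp_contiguous[OF a, of ?z] a by (simp add: I_def I1_def I2_def)
  have D1: "((\<lambda>u. hyp a (?B * x * u)) has_real_derivative I1 * (?B * x)) (at u)"
    using a by (auto intro!: derivative_eq_intros simp: I1_def)
  have "((\<lambda>u. hyp (a + 1) (?B * x * u)) has_real_derivative hyp (a + 1 + 1) ?z / (a + 1) * (?B * x)) (at u)"
    using a by (auto intro!: derivative_eq_intros)
  then have D2: "((\<lambda>u. hyp (a + 1) (?B * x * u) / a) has_real_derivative I2 * (?B * x)) (at u)"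
    by (rule DERIV_cong[OF DERIV_cdivide]) (simp add: I2_def add.assoc mult_ac)
  have D3: "((\<lambda>u. (1 - t) powr (- a) * exp (- (?A * (x + u)))) has_real_derivative - ?A * ?p) (at u)"
    by (auto intro!: derivative_eq_intros)
  have D4: "((\<lambda>u. ?B * x * (hyp (a + 1) (?B * x * u) / a) - ?A * hyp a (?B * x * u)) has_real_derivative
      (?B * x) * (I2 * (?B * x)) - ?A * (I1 * (?B * x))) (at u)"
    by (rule DERIV_diff[OF DERIV_cmult[OF D2] DERIV_cmult[OF D1]])
  define v where "v = 1 - t"
  have v: "v \<noteq> 0" "t = 1 - v" using t by (auto simp: v_def)
  have D: "((\<lambda>u. u * kern_du a l t u x) has_real_derivative
     kern_du a l t u x + u * (- ?A * ?p * (?B * x * I1 - ?A * I) + ?p * ((?B * x) * (I2 * (?B * x)) - ?A * (I1 * (?B * x))))) (at u)"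
    unfolding kern_du_def I_def I1_def
    by (rule DERIV_cong[OF DERIV_mult[OF DERIV_ident DERIV_mult[OF D3 D4, unfolded I_def I1_def]]]) (simp add: algebra_simps)
  \<comment> \<open>Matching of coefficients: \<open>c3\<close> ties \<open>kA\<close> to
    \<open>kB\<close>, and the other three express \<open>l * t\<close> times the coefficients in
    \<open>kern_dt\<close> through \<open>kA\<close> and \<open>kB\<close>. The second derivative
    \<open>I2\<close> is removed by \<open>ode\<close>.\<close>
  have c1: "l * t * (a / (1 - t)) = a * ?A" by (simp add: kA_def)
  have c2: "l * t * kA' l t = ?B" by (simp add: kA'_def kB_def power2_eq_square)
  have c3: "?A * ?A + l * ?A = ?B" using v(1) unfolding kA_def kB_def v_def[symmetric] v(2) by (simp add: field_simps power2_eq_square)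
  have c4: "l * t * kB' l t = ?B * (2 * ?A + l)" using v(1) unfolding kA_def kB_def kB'_def v_def[symmetric] v(2)
    by (simp add: field_simps power2_eq_square power3_eq_cube)
  have "u * (- ?A * ?p * (?B * x * I1 - ?A * I) + ?p * ((?B * x) * (I2 * (?B * x)) - ?A * (I1 * (?B * x))))
     = ?p * (- 2 * ?A * ?z * I1 + u * ?A * ?A * I + ?B * x * (?z * I2))"
    by (simp add: algebra_simps)
  also have "\<dots> = ?p * (- 2 * ?A * ?z * I1 + u * ?A * ?A * I + ?B * x * (I - a * I1))"
    by (simp only: ode)
  also have "\<dots> = - (l * t) * kern_dt a l t u x - (a - l * u) * kern_du a l t u x"
  proof -
    have "- (l * t) * kern_dt a l t u x = ?p * ((- (l * t * (a / (1 - t))) + l * t * kA' l t * (x + u)) * I - l * t * kB' l t * x * u * I1)"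
      unfolding kern_dt_def I_def[symmetric] I1_def[symmetric] by (simp add: algebra_simps)
    also have "\<dots> = ?p * ((- (a * ?A) + (?A * ?A + l * ?A) * u + ?B * x) * I - ?B * (2 * ?A + l) * x * u * I1)"
      unfolding c1 c2 c4 c3 by (simp add: algebra_simps)
    finally show ?thesis
      unfolding kern_du_def I_def[symmetric] I1_def[symmetric] by (simp add: algebra_simps)
  qed
  finally show ?thesis
    by (intro DERIV_cong[OF D]) (simp add: algebra_simps)
qed

section \<open>The kernel as a Poisson mixture of gamma densities\<close>

lemma gamma_density_nonneg: "a > 0 \<Longrightarrow> 0 \<le> gamma_density a l u"
  by (simp add: gamma_density_def Gamma_real_nonneg)

lemma gamma_density_pos: "a > 0 \<Longrightarrow> l > 0 \<Longrightarrow> u > 0 \<Longrightarrow> 0 < gamma_density a l u"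
  by (simp add: gamma_density_def Gamma_real_pos)

lemma gamma_density_neg [simp]: "u \<le> 0 \<Longrightarrow> gamma_density a l u = 0"
  by (simp add: gamma_density_def)

lemma nn_integral_gamma_density:
  assumes "a > 0" "l > 0"
  shows "(\<integral>\<^sup>+u. ennreal (gamma_density a l u) \<partial>lborel) = 1"
proof -
  have G: "Gamma a > 0" using assms by (simp add: Gamma_real_pos)
  have "(\<integral>\<^sup>+u. ennreal (gamma_density a 1 u) \<partial>lborel)
     = (\<integral>\<^sup>+u. ennreal (inverse (Gamma a)) * ennreal (indicator {0..} u * (u powr (a - 1) / exp u)) \<partial>lborel)"
    using G by (intro nn_integral_cong)
      (auto simp: gamma_density_def exp_minus field_simps ennreal_mult[symmetric] indicator_def)
  also have "\<dots> = ennreal (inverse (Gamma a)) * ennreal (Gamma a)"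
    using Gamma_conv_nn_integral_real[OF assms(1)] by (subst nn_integral_cmult) auto
  also have "\<dots> = 1" using G by (simp add: ennreal_mult[symmetric])
  finally have 1: "(\<integral>\<^sup>+u. ennreal (gamma_density a 1 u) \<partial>lborel) = 1" .
  have "gamma_density a 1 (l * u) * l = gamma_density a l u" for u
  proof (cases "u > 0")
    case True
    have "l powr (a - 1) * l = l powr a" using assms by (simp add: powr_diff)
    then show ?thesis using True assms by (simp add: gamma_density_def powr_mult)
  next
    case False
    then have "l * u \<le> 0" using assms by (simp add: mult_le_0_iff)
    then show ?thesis using False by simp
  qed
  then have "(\<integral>\<^sup>+u. ennreal (gamma_density a l u) \<partial>lborel) = (\<integral>\<^sup>+u. ennreal l * ennreal (gamma_density a 1 (l * u)) \<partial>lborel)"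
    using assms gamma_density_nonneg[of a 1] by (simp add: ennreal_mult[symmetric] mult.commute)
  also have "\<dots> = ennreal l * (\<integral>\<^sup>+u. ennreal (gamma_density a 1 (l * u)) \<partial>lborel)"
    by (rule nn_integral_cmult) measurable
  also have "\<dots> = (\<integral>\<^sup>+u. ennreal (gamma_density a 1 u) \<partial>lborel)"
    using assms nn_integral_real_affine[of "\<lambda>u. ennreal (gamma_density a 1 u)" l 0] by simp
  finally show ?thesis using 1 by simp
qed

text \<open>Multiplication by \<open>u\<close> raises the shape by one, so every moment reduces to
  the total mass of another gamma density.\<close>

lemma gamma_density_Suc:
  assumes "b > 0" "r > 0"
  shows "u * gamma_density b r u = b / r * gamma_density (b + 1) r u"
proof (cases "u > 0")
  case True
  have "Gamma (b + 1) = b * Gamma b" using assms by (intro Gamma_plus1) (auto elim!: nonpos_Ints_cases)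
  moreover have "u * u powr (b - 1) = u powr b" using True by (simp add: powr_diff)
  moreover have "r powr (b + 1) = r powr b * r" using assms by (simp add: powr_add)
  moreover have "Gamma b > 0" using assms Gamma_real_pos by simp
  ultimately show ?thesis
    using assms True by (simp add: gamma_density_def)
qed simp

lemma nn_integral_gamma_density_moment1:
  assumes "b > 0" "r > 0"
  shows "(\<integral>\<^sup>+u. ennreal (gamma_density b r u) * ennreal u \<partial>lborel) = ennreal (b / r)"
proof -
  have "(\<integral>\<^sup>+u. ennreal (gamma_density b r u) * ennreal u \<partial>lborel) = (\<integral>\<^sup>+u. ennreal (b / r) * ennreal (gamma_density (b + 1) r u) \<partial>lborel)"
  proof (intro nn_integral_cong)
    fix u :: real
    show "ennreal (gamma_density b r u) * ennreal u = ennreal (b / r) * ennreal (gamma_density (b + 1) r u)"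
      using gamma_density_Suc[OF assms, of u] assms gamma_density_nonneg[of b r u] gamma_density_nonneg[of "b+1" r u]
      by (cases "u > 0") (simp_all add: ennreal_mult[symmetric] mult.commute)
  qed
  also have "\<dots> = ennreal (b / r)"
    using nn_integral_gamma_density[of "b+1" r] assms by (subst nn_integral_cmult) auto
  finally show ?thesis .
qed

lemma nn_integral_gamma_density_moment2:
  assumes "b > 0" "r > 0"
  shows "(\<integral>\<^sup>+u. ennreal (gamma_density b r u) * ennreal (u\<^sup>2) \<partial>lborel) = ennreal (b * (b + 1) / r\<^sup>2)"
proof -
  have "(\<integral>\<^sup>+u. ennreal (gamma_density b r u) * ennreal (u\<^sup>2) \<partial>lborel) = (\<integral>\<^sup>+u. ennreal (b / r) * (ennreal (gamma_density (b + 1) r u) * ennreal u) \<partial>lborel)"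
  proof (intro nn_integral_cong)
    fix u :: real
    have "gamma_density b r u * u\<^sup>2 = b / r * (gamma_density (b + 1) r u * u)"
      using gamma_density_Suc[OF assms, of u] by (simp add: power2_eq_square mult_ac)
    then show "ennreal (gamma_density b r u) * ennreal (u\<^sup>2) = ennreal (b / r) * (ennreal (gamma_density (b + 1) r u) * ennreal u)"
      using assms gamma_density_nonneg[of b r u] gamma_density_nonneg[of "b+1" r u]
      by (cases "u > 0") (simp_all add: ennreal_mult[symmetric])
  qed
  also have "\<dots> = ennreal (b / r) * ennreal ((b + 1) / r)"
    using nn_integral_gamma_density_moment1[of "b+1" r] assms by (subst nn_integral_cmult) auto
  also have "\<dots> = ennreal (b * (b + 1) / r\<^sup>2)"
    using assms by (simp add: ennreal_mult[symmetric] power2_eq_square)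
  finally show ?thesis .
qed

section \<open>Poisson weights and the moments of the mixture\<close>

definition pois :: "real \<Rightarrow> nat \<Rightarrow> real" where "pois m k = m ^ k / fact k * exp (- m)"

lemma pois_nonneg: "m \<ge> 0 \<Longrightarrow> 0 \<le> pois m k"
  by (simp add: pois_def)

lemma pois_sums: "pois m sums 1"
proof -
  have "(\<lambda>k. inverse (fact k) * m ^ k) sums exp m"
    unfolding exp_def using summable_exp[of m] by (simp add: summable_sums)
  from sums_mult[OF this, of "exp (- m)"] show ?thesis
    by (simp add: pois_def[abs_def] divide_inverse mult_ac exp_minus)
qed

lemma pois_Suc: "pois m (Suc k) * real (Suc k) = m * pois m k"
  unfolding pois_def fact_Suc power_Suc by (simp del: of_nat_Suc fact_Suc)

lemma pois_moment1: "(\<lambda>k. pois m k * real k) sums m"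
proof -
  have "(\<lambda>k. pois m (Suc k) * real (Suc k)) sums (m * 1)"
    unfolding pois_Suc by (intro sums_mult pois_sums)
  then show ?thesis by (subst (asm) sums_Suc_iff) simp
qed

lemma pois_moment2: "(\<lambda>k. pois m k * (real k * (real k - 1))) sums m\<^sup>2"
proof -
  have "(\<lambda>k. pois m (Suc k) * (real (Suc k) * (real (Suc k) - 1))) sums (m * m)"
  proof -
    have "pois m (Suc k) * (real (Suc k) * (real (Suc k) - 1)) = m * (pois m k * real k)" for k
      unfolding mult.assoc[symmetric] pois_Suc by simp
    then show ?thesis using sums_mult[OF pois_moment1[of m], of m] by (simp only:)
  qed
  then show ?thesis by (subst (asm) sums_Suc_iff) (simp add: power2_eq_square)
qed

lemma suminf_ennreal_eq: "(\<And>k. 0 \<le> f k) \<Longrightarrow> f sums c \<Longrightarrow> (\<Sum>k. ennreal (f k)) = ennreal c"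
  using suminf_ennreal2[of f] sums_summable[of f c] sums_unique[of f c] by metis

text \<open>The identity holds term by term: the Pochhammer symbol turns \<open>Gamma a\<close> into
  \<open>Gamma (a + k)\<close>, the power of \<open>kB l t * x * u\<close> splits into one of
  \<open>kA l t * x\<close> for the Poisson weight and one of \<open>r * u\<close> for the gamma
  density, and \<open>l + kA l t = r\<close> matches the exponentials.\<close>

lemma gamma_kern_sums:
  assumes a: "a > 0" and l: "l > 0" and t: "0 \<le> t" "t < 1"
  shows "(\<lambda>k. pois (kA l t * x) k * gamma_density (a + real k) (l / (1 - t)) u)
     sums (gkern a l t u x)"
proof (cases "u > 0")
  case True
  define r where "r = l / (1 - t)"
  have r: "r > 0" using l t by (simp add: r_def)
  define c where "c = l powr a / Gamma a * u powr (a - 1) * exp (- l * u) * (1 - t) powr (- a) * exp (- (kA l t * (x + u)))"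
  have G: "Gamma a > 0" using a by (simp add: Gamma_real_pos)
  have "(\<lambda>k. c * (inverse (fact k * pochhammer a k) * (kB l t * x * u) ^ k)) sums (c * hyp a (kB l t * x * u))"
    using a by (intro sums_mult hyp_sums)
  moreover have "c * hyp a (kB l t * x * u) = gkern a l t u x"
    using True by (simp add: c_def kern_def gamma_density_def)
  moreover have "c * (inverse (fact k * pochhammer a k) * (kB l t * x * u) ^ k) = pois (kA l t * x) k * gamma_density (a + real k) r u" for k
  proof -
    have 1: "Gamma (a + real k) = Gamma a * pochhammer a k"
    proof -
      have "a \<notin> \<int>\<^sub>\<le>\<^sub>0" using a by (auto elim!: nonpos_Ints_cases)
      then show ?thesis using G by (simp add: pochhammer_Gamma)
    qed
    have 2: "r powr (a + real k) = l powr a * (1 - t) powr (- a) * r ^ k"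
      using l t r by (simp add: powr_add powr_realpow r_def powr_divide powr_minus divide_inverse powr_mult inverse_powr power_mult_distrib power_inverse)
    have 3: "u powr (a + real k - 1) = u powr (a - 1) * u ^ k"
      using True by (simp add: powr_add powr_diff powr_realpow)
    have 4: "kB l t * x * u = (kA l t * x) * (r * u)"
      by (simp add: kB_def kA_def r_def power2_eq_square)
    have "l * u + kA l t * u = r * u" using t by (simp add: r_def kA_def field_simps)
    then have 5: "exp (- l * u) * exp (- (kA l t * (x + u))) = exp (- (kA l t * x)) * exp (- r * u)"
      by (simp add: exp_add[symmetric] algebra_simps)
    have "c * (inverse (fact k * pochhammer a k) * (kB l t * x * u) ^ k)
       = (l powr a * (1 - t) powr (- a)) * (exp (- l * u) * exp (- (kA l t * (x + u)))) * (u powr (a - 1)) / (Gamma a * pochhammer a k) * (kB l t * x * u) ^ k / fact k"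
      by (simp add: c_def divide_inverse)
    also have "\<dots> = pois (kA l t * x) k * gamma_density (a + real k) r u"
      unfolding 4 5 power_mult_distrib[of "kA l t * x"] power_mult_distrib[of r]
      using True by (simp add: gamma_density_def pois_def 1 2 3 mult_ac)
    finally show ?thesis .
  qed
  ultimately show ?thesis by (simp add: r_def)
qed simp

lemma nn_integral_gamma_kern:
  assumes a: "a > 0" and l: "l > 0" and t: "0 \<le> t" "t < 1" and x: "x \<ge> 0"
    and [measurable]: "w \<in> borel_measurable borel"
  shows "(\<integral>\<^sup>+u. ennreal (gkern a l t u x) * w u \<partial>lborel)
     = (\<Sum>k. ennreal (pois (kA l t * x) k) * (\<integral>\<^sup>+u. ennreal (gamma_density (a + real k) (l / (1 - t)) u) * w u \<partial>lborel))"
proof -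
  have m: "0 \<le> kA l t * x" using kA_nonneg[of l t] l t x by simp
  have nn: "0 \<le> pois (kA l t * x) k" "0 \<le> gamma_density (a + real k) r u" for k r u
    using pois_nonneg[OF m] gamma_density_nonneg a by auto
  have "(\<integral>\<^sup>+u. ennreal (gkern a l t u x) * w u \<partial>lborel) =
     (\<integral>\<^sup>+u. (\<Sum>k. ennreal (pois (kA l t * x) k) * (ennreal (gamma_density (a + real k) (l / (1 - t)) u) * w u)) \<partial>lborel)"
  proof (rule nn_integral_cong)
    fix u
    have "ennreal (gkern a l t u x) = (\<Sum>k. ennreal (pois (kA l t * x) k * gamma_density (a + real k) (l / (1 - t)) u))"
      using nn by (intro suminf_ennreal_eq[symmetric] gamma_kern_sums a l t) auto
    then show "ennreal (gkern a l t u x) * w u = (\<Sum>k. ennreal (pois (kA l t * x) k) * (ennreal (gamma_density (a + real k) (l / (1 - t)) u) * w u))"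
      using nn by (simp add: ennreal_mult mult.assoc ennreal_suminf_multc[symmetric])
  qed
  also have "\<dots> = (\<Sum>k. (\<integral>\<^sup>+u. ennreal (pois (kA l t * x) k) * (ennreal (gamma_density (a + real k) (l / (1 - t)) u) * w u) \<partial>lborel))"
    by (rule nn_integral_suminf) measurable
  also have "\<dots> = (\<Sum>k. ennreal (pois (kA l t * x) k) * (\<integral>\<^sup>+u. ennreal (gamma_density (a + real k) (l / (1 - t)) u) * w u \<partial>lborel))"
    by (intro suminf_cong nn_integral_cmult) measurable
  finally show ?thesis .
qed

context
  fixes a l t x :: real
  assumes a: "a > 0" and l: "l > 0" and t: "0 \<le> t" "t < 1" and x: "x \<ge> 0"
begin

lemma gamma_kern_mass: "(\<integral>\<^sup>+u. ennreal (gkern a l t u x) \<partial>lborel) = 1"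
proof -
  have m: "0 \<le> kA l t * x" using kA_nonneg[of l t] l t x by simp
  have "(\<integral>\<^sup>+u. ennreal (gkern a l t u x) * 1 \<partial>lborel) = (\<Sum>k. ennreal (pois (kA l t * x) k))"
    using nn_integral_gamma_kern[OF a l t x, of "\<lambda>_. 1"] a l t by (simp add: nn_integral_gamma_density)
  also have "\<dots> = ennreal 1"
    using pois_nonneg[OF m] pois_sums by (rule suminf_ennreal_eq)
  finally show ?thesis by simp
qed

lemma gamma_kern_mean:
  "(\<integral>\<^sup>+u. ennreal (gkern a l t u x) * ennreal u \<partial>lborel) = ennreal ((1 - t) * a / l + t * x)"
proof -
  define r where "r = l / (1 - t)"
  define m where "m = kA l t * x"
  have m: "0 \<le> m" using kA_nonneg[of l t] l t x by (simp add: m_def)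
  have r: "r > 0" using l t by (simp add: r_def)
  have "(\<integral>\<^sup>+u. ennreal (gkern a l t u x) * ennreal u \<partial>lborel) = (\<Sum>k. ennreal (pois m k * ((a + real k) / r)))"
    using nn_integral_gamma_kern[OF a l t x, of ennreal] a r m pois_nonneg[OF m]
    by (simp add: nn_integral_gamma_density_moment1 r_def[symmetric] m_def[symmetric] ennreal_mult del: times_divide_eq_right)
  also have "\<dots> = ennreal ((a + m) / r)"
  proof (rule suminf_ennreal_eq)
    have "(\<lambda>k. (a / r) * pois m k + inverse r * (pois m k * real k)) sums ((a / r) * 1 + inverse r * m)"
      by (intro sums_add sums_mult pois_sums pois_moment1)
    then show "(\<lambda>k. pois m k * ((a + real k) / r)) sums ((a + m) / r)"
      by (simp add: divide_inverse algebra_simps)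
  qed (use a r pois_nonneg[OF m] in auto)
  also have "(a + m) / r = (1 - t) * a / l + t * x"
    using l t by (simp add: r_def m_def kA_def field_simps)
  finally show ?thesis .
qed

text \<open>The result is arranged as squared mean plus variance. The variance carries a factor
  \<open>1 - t\<close>, which is behind the concentration at the starting point used in
  \<open>gamma_kern_weak\<close>.\<close>

lemma gamma_kern_moment2:
  "(\<integral>\<^sup>+u. ennreal (gkern a l t u x) * ennreal (u\<^sup>2) \<partial>lborel)
    = ennreal (((1 - t) * a / l + t * x)\<^sup>2 + (1 - t)\<^sup>2 * a / l\<^sup>2 + 2 * t * (1 - t) * x / l)"
proof -
  define r where "r = l / (1 - t)"
  define m where "m = kA l t * x"
  have m: "0 \<le> m" using kA_nonneg[of l t] l t x by (simp add: m_def)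
  have r: "r > 0" using l t by (simp add: r_def)
  have "(\<integral>\<^sup>+u. ennreal (gkern a l t u x) * ennreal (u\<^sup>2) \<partial>lborel) = (\<Sum>k. ennreal (pois m k * ((a + real k) * (a + real k + 1) / r\<^sup>2)))"
    using nn_integral_gamma_kern[OF a l t x, of "\<lambda>u. ennreal (u\<^sup>2)"] a r m pois_nonneg[OF m]
    by (simp add: nn_integral_gamma_density_moment2 r_def[symmetric] m_def[symmetric] ennreal_mult del: times_divide_eq_right)
  \<comment> \<open>Expand \<open>(a + k) * (a + k + 1)\<close> as
    \<open>a * (a + 1) + (2 * a + 2) * k + k * (k - 1)\<close>, so that only factorial moments of
    the Poisson law occur.\<close>
  also have "\<dots> = ennreal ((a * (a + 1) + (2 * a + 2) * m + m\<^sup>2) * inverse (r\<^sup>2))"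
  proof (rule suminf_ennreal_eq)
    have "(\<lambda>k. (a * (a + 1) * pois m k + (2 * a + 2) * (pois m k * real k) + pois m k * (real k * (real k - 1))) * inverse (r\<^sup>2))
       sums ((a * (a + 1) * 1 + (2 * a + 2) * m + m\<^sup>2) * inverse (r\<^sup>2))"
      by (intro sums_add sums_mult sums_mult2 pois_sums pois_moment1 pois_moment2)
    moreover have "(a * (a + 1) * pois m k + (2 * a + 2) * (pois m k * real k) + pois m k * (real k * (real k - 1))) * inverse (r\<^sup>2)
       = pois m k * ((a + real k) * (a + real k + 1) / r\<^sup>2)" for k
      by (simp add: divide_inverse algebra_simps)
    ultimately show "(\<lambda>k. pois m k * ((a + real k) * (a + real k + 1) / r\<^sup>2)) sums ((a * (a + 1) + (2 * a + 2) * m + m\<^sup>2) * inverse (r\<^sup>2))"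
      by simp
  qed (use a r pois_nonneg[OF m] in auto)
  also have "(a * (a + 1) + (2 * a + 2) * m + m\<^sup>2) * inverse (r\<^sup>2) = ((1 - t) * a / l + t * x)\<^sup>2 + (1 - t)\<^sup>2 * a / l\<^sup>2 + 2 * t * (1 - t) * x / l"
  proof -
    define y where "y = inverse r"
    have my: "m * y = t * x" using l t by (simp add: y_def m_def r_def kA_def)
    have "(a * (a + 1) + (2 * a + 2) * m + m\<^sup>2) * inverse (r\<^sup>2) = a * (a + 1) * y\<^sup>2 + (2 * a + 2) * (m * y) * y + (m * y)\<^sup>2"
      by (simp add: y_def algebra_simps power2_eq_square)
    also have "\<dots> = (y * a + t * x)\<^sup>2 + y\<^sup>2 * a + 2 * t * y * x"
      unfolding my by (simp add: algebra_simps power2_eq_square)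
    also have "\<dots> = ((1 - t) * a / l + t * x)\<^sup>2 + (1 - t)\<^sup>2 * a / l\<^sup>2 + 2 * t * (1 - t) * x / l"
      by (simp add: y_def r_def power_divide)
    finally show ?thesis .
  qed
  finally show ?thesis .
qed

end

section \<open>The law of the path\<close>

lemma sets_gamma_law [simp, measurable_cong]: "sets (gamma_law a l) = sets borel"
  by (simp add: gamma_law_def)

lemma space_gamma_law [simp]: "space (gamma_law a l) = UNIV"
  by (simp add: gamma_law_def)

lemma prob_space_gamma_law: "a > 0 \<Longrightarrow> l > 0 \<Longrightarrow> prob_space (gamma_law a l)"
  by (intro prob_spaceI) (simp add: gamma_law_def emeasure_density nn_integral_gamma_density)

lemma gamma_law_in_subprob: "a > 0 \<Longrightarrow> l > 0 \<Longrightarrow> gamma_law a l \<in> space (subprob_algebra borel)"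
  by (simp add: space_subprob_algebra prob_space_imp_subprob_space prob_space_gamma_law)

section \<open>Scaling and convolution of gamma laws\<close>

lemma gamma_density_scale:
  assumes "a > 0" "l > 0" "c > 0"
  shows "gamma_density a l (v / c) / c = gamma_density a (l / c) v"
proof (cases "v > 0")
  case True
  have "c powr a = c * c powr (a - 1)" using assms by (simp add: powr_diff)
  then show ?thesis using True assms by (simp add: gamma_density_def powr_divide)
next
  case False
  then have "v / c \<le> 0" using assms by (simp add: divide_le_0_iff)
  then show ?thesis using False by simp
qed

lemma distr_gamma_law_scale:
  assumes "a > 0" "l > 0" "c > 0"
  shows "distr (gamma_law a l) borel (\<lambda>g. c * g) = gamma_law a (l / c)"
proof (rule measure_eqI)
  fix A assume "A \<in> sets (distr (gamma_law a l) borel (\<lambda>g. c * g))"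
  then have A [measurable]: "A \<in> sets borel" by simp
  have "emeasure (distr (gamma_law a l) borel (\<lambda>g. c * g)) A = (\<integral>\<^sup>+g. indicator A (c * g) \<partial>gamma_law a l)"
    by (subst nn_integral_indicator[symmetric], simp, subst nn_integral_distr) auto
  also have "\<dots> = (\<integral>\<^sup>+g. ennreal (gamma_density a l g) * indicator A (c * g) \<partial>lborel)"
    unfolding gamma_law_def by (subst nn_integral_density) auto
  also have "\<dots> = ennreal (1/c) * (\<integral>\<^sup>+v. ennreal (gamma_density a l (v / c)) * indicator A v \<partial>lborel)"
    using assms by (subst nn_integral_real_affine[where c="1/c" and t=0]) auto
  also have "\<dots> = (\<integral>\<^sup>+v. ennreal (1/c) * (ennreal (gamma_density a l (v / c)) * indicator A v) \<partial>lborel)"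
    by (rule nn_integral_cmult[symmetric]) measurable
  also have "\<dots> = (\<integral>\<^sup>+v. ennreal (gamma_density a (l / c) v) * indicator A v \<partial>lborel)"
  proof (rule nn_integral_cong)
    fix v
    have "gamma_density a (l / c) v = (1/c) * gamma_density a l (v / c)"
      using gamma_density_scale[OF assms, of v] by simp
    also have "ennreal \<dots> = ennreal (1/c) * ennreal (gamma_density a l (v / c))"
      using assms gamma_density_nonneg[of a l] by (intro ennreal_mult) auto
    finally show "ennreal (1/c) * (ennreal (gamma_density a l (v / c)) * indicator A v) = ennreal (gamma_density a (l / c) v) * indicator A v"
      by (simp only: mult.assoc)
  qed
  also have "\<dots> = emeasure (gamma_law a (l / c)) A"
    unfolding gamma_law_def by (simp add: emeasure_density)
  finally show "emeasure (distr (gamma_law a l) borel (\<lambda>g. c * g)) A = emeasure (gamma_law a (l / c)) A" .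
qed simp

text \<open>The substitution \<open>y = x * s\<close> turns the convolution integral at
  \<open>x\<close> into a Beta integral over the unit interval; outside it one of the two densities
  vanishes.\<close>

lemma gamma_law_convolution:
  assumes a: "a > 0" and b: "b > 0" and r: "r > 0"
  shows "convolution (gamma_law a r) (gamma_law b r) = gamma_law (a + b) r"
proof -
  have fin: "finite_measure (density lborel (\<lambda>u. ennreal (gamma_density c r u)))" if "c > 0" for c
    using prob_space.finite_measure[OF prob_space_gamma_law[OF that r]] by (simp add: gamma_law_def)
  have "(\<integral>\<^sup>+y. ennreal (gamma_density a r (x - y)) * ennreal (gamma_density b r y) \<partial>lborel) = ennreal (gamma_density (a + b) r x)" for x
  proof (cases "x > 0")
    case False
    then have "ennreal (gamma_density a r (x - y)) * ennreal (gamma_density b r y) = 0" for y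
      by (cases "y > 0") auto
    then have "(\<integral>\<^sup>+y. ennreal (gamma_density a r (x - y)) * ennreal (gamma_density b r y) \<partial>lborel) = (\<integral>\<^sup>+(y::real). 0 \<partial>lborel)"
      by (simp only:)
    then show ?thesis using False by simp
  next
    case True
    define K where "K = r powr a / Gamma a * (r powr b / Gamma b) * x powr (a - 1) * x powr (b - 1) * exp (- r * x)"
    have G: "Gamma a > 0" "Gamma b > 0" "Gamma (a + b) > 0" using a b by (auto simp: Gamma_real_pos)
    have K: "K \<ge> 0" using G by (simp add: K_def)
    have "(\<integral>\<^sup>+y. ennreal (gamma_density a r (x - y)) * ennreal (gamma_density b r y) \<partial>lborel)
       = ennreal x * (\<integral>\<^sup>+s. ennreal (gamma_density a r (x - x * s)) * ennreal (gamma_density b r (x * s)) \<partial>lborel)"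
      using True by (subst nn_integral_real_affine[where c=x and t=0]) auto
    also have "(\<integral>\<^sup>+s. ennreal (gamma_density a r (x - x * s)) * ennreal (gamma_density b r (x * s)) \<partial>lborel)
       = (\<integral>\<^sup>+s. ennreal K * ennreal (indicator {0..1} s * (s powr (b - 1) * (1 - s) powr (a - 1))) \<partial>lborel)"
    proof (rule nn_integral_cong)
      fix s :: real
      consider "s \<le> 0" | "s \<ge> 1" | "0 < s" "s < 1" by linarith
      then show "ennreal (gamma_density a r (x - x * s)) * ennreal (gamma_density b r (x * s)) =
        ennreal K * ennreal (indicator {0..1} s * (s powr (b - 1) * (1 - s) powr (a - 1)))"
      proof cases
        case 1
        then have "x * s \<le> 0" using True by (simp add: mult_le_0_iff)
        then show ?thesis using 1 by (cases "s = 0") auto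
      next
        case 2
        then have "x - x * s \<le> 0" using True by simp
        then show ?thesis using 2 by (cases "s = 1") auto
      next
        case 3
        have xs: "x - x * s = x * (1 - s)" by (simp add: algebra_simps)
        have "exp (- r * (x * (1 - s))) * exp (- r * (x * s)) = exp (- r * x)"
          by (simp add: exp_add[symmetric] algebra_simps)
        then have "gamma_density a r (x - x * s) * gamma_density b r (x * s) = K * (s powr (b - 1) * (1 - s) powr (a - 1))"
          unfolding xs using True 3 by (simp add: gamma_density_def K_def powr_mult)
        then show ?thesis using 3 K gamma_density_nonneg a b by (simp add: ennreal_mult[symmetric])
      qed
    qed
    also have "\<dots> = ennreal K * ennreal (Beta b a)"
      using nn_integral_has_integral_lebesgue[OF _ has_integral_Beta_real[OF b a]]
      by (subst nn_integral_cmult) auto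
    also have "ennreal x * (ennreal K * ennreal (Beta b a)) = ennreal (x * (K * Beta b a))"
      using True K G by (simp add: ennreal_mult[symmetric] Beta_def add.commute)
    also have "x * (K * Beta b a) = gamma_density (a + b) r x"
    proof -
      have "x * (x powr (a - 1) * x powr (b - 1)) = x powr (a + b - 1)"
        using True by (simp add: powr_diff powr_add)
      moreover have "r powr a * r powr b = r powr (a + b)" by (simp add: powr_add)
      moreover have "K * Beta b a = (r powr a * r powr b) / Gamma (a + b) * (x powr (a - 1) * x powr (b - 1)) * exp (- r * x)"
        using G by (simp add: K_def Beta_def add.commute)
      ultimately show ?thesis using True by (simp add: gamma_density_def)
    qed
    finally show ?thesis .
  qed
  then show ?thesis
    unfolding gamma_law_def using fin a b by (subst convolution_density) auto
qed

lemma measurable_distr_affine [measurable]: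
  assumes "a > 0" "l > 0"
  shows "(\<lambda>y. distr (gamma_law a l) borel (\<lambda>g. c * g + d * y)) \<in> measurable borel (subprob_algebra borel)"
proof (rule measurable_distr2[where M="gamma_law a l"])
  show "(\<lambda>(y, g). c * g + d * y) \<in> borel \<Otimes>\<^sub>M gamma_law a l \<rightarrow>\<^sub>M borel" by measurable
  show "(\<lambda>x. gamma_law a l) \<in> borel \<rightarrow>\<^sub>M subprob_algebra (gamma_law a l)"
    using gamma_law_in_subprob[OF assms] subprob_algebra_cong[OF sets_gamma_law[of a l]] by simp
qed

text \<open>Scaling by \<open>1 - t\<close> and by \<open>t\<close> brings both gamma summands to
  the common rate \<open>l / (1 - t)\<close>, so their shapes add. For \<open>k = 0\<close> the
  second summand is the constant 0.\<close>

lemma smart_path_step: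
  assumes a: "a > 0" and l: "l > 0" and t: "0 < t" "t < 1"
  shows "(if k = 0 then return borel 0 else gamma_law (real k) (l * t / (1 - t))) \<bind>
      (\<lambda>y. distr (gamma_law a l) borel (\<lambda>g. (1 - t) * g + t * y)) = gamma_law (a + real k) (l / (1 - t))"
proof (cases "k = 0")
  case True
  then show ?thesis
    using a l t by (simp add: bind_return[OF measurable_distr_affine] distr_gamma_law_scale)
next
  case False
  define N where "N = gamma_law (real k) (l * t / (1 - t))"
  have pos: "real k > 0" "l * t / (1 - t) > 0" "l / (1 - t) > 0" using False l t by auto
  have Ns [simp, measurable_cong]: "sets N = sets borel" by (simp add: N_def)
  have N': "gamma_law (real k) (l / (1 - t)) = distr N borel (\<lambda>y. t * y)"
    using distr_gamma_law_scale[OF pos(1,2) t(1)] t by (simp add: N_def)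
  have a': "gamma_law a (l / (1 - t)) = distr (gamma_law a l) borel (\<lambda>g. (1 - t) * g)"
    using distr_gamma_law_scale[OF a l, of "1 - t"] t by simp
  let ?B = "N \<bind> (\<lambda>y. distr (gamma_law a l) borel (\<lambda>g. (1 - t) * g + t * y))"
  let ?C = "convolution (gamma_law (real k) (l / (1 - t))) (gamma_law a (l / (1 - t)))"
  have "?B = ?C"
  proof (rule measure_eqI)
    show "sets ?B = sets ?C"
      by (subst sets_bind[where N=borel]) (auto simp: N_def)
    fix A assume "A \<in> sets ?B"
    then have A [measurable]: "A \<in> sets borel"
      by (subst (asm) sets_bind[where N=borel]) (auto simp: N_def)
    have "emeasure ?B A
        = (\<integral>\<^sup>+y. emeasure (distr (gamma_law a l) borel (\<lambda>g. (1 - t) * g + t * y)) A \<partial>N)"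
    proof (rule emeasure_bind)
      show "(\<lambda>y. distr (gamma_law a l) borel (\<lambda>g. (1 - t) * g + t * y)) \<in> N \<rightarrow>\<^sub>M subprob_algebra borel"
        using measurable_distr_affine[OF a l] by (simp add: measurable_cong_sets[OF Ns refl])
    qed (auto simp: N_def)
    also have "\<dots> = (\<integral>\<^sup>+y. (\<integral>\<^sup>+g. indicator A ((1 - t) * g + t * y) \<partial>gamma_law a l) \<partial>N)"
      by (intro nn_integral_cong, subst nn_integral_indicator[symmetric], simp, subst nn_integral_distr) auto
    also have "\<dots> = emeasure ?C A"
    proof -
      have "emeasure ?C A
        = (\<integral>\<^sup>+y. (\<integral>\<^sup>+g. indicator A (y + g) \<partial>gamma_law a (l / (1 - t))) \<partial>gamma_law (real k) (l / (1 - t)))"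
        using prob_space.finite_measure[OF prob_space_gamma_law] a pos by (intro convolution_emeasure') auto
      also have "\<dots> = (\<integral>\<^sup>+y. (\<integral>\<^sup>+g. indicator A (y + g) \<partial>gamma_law a (l / (1 - t))) \<partial>distr N borel (\<lambda>y. t * y))"
        by (simp only: N')
      also have "\<dots> = (\<integral>\<^sup>+y. (\<integral>\<^sup>+g. indicator A (t * y + g) \<partial>gamma_law a (l / (1 - t))) \<partial>N)"
      proof (rule nn_integral_distr)
        interpret prob_space "gamma_law a (l / (1 - t))" using a pos by (intro prob_space_gamma_law)
        show "(\<lambda>y. \<integral>\<^sup>+g. indicator A (y + g) \<partial>gamma_law a (l / (1 - t))) \<in> borel_measurable (distr N borel (\<lambda>y. t * y))"
          by measurable
      qed simp
      also have "\<dots> = (\<integral>\<^sup>+y. (\<integral>\<^sup>+g. indicator A (t * y + (1 - t) * g) \<partial>gamma_law a l) \<partial>N)"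
        unfolding a' by (intro nn_integral_cong nn_integral_distr) auto
      finally show ?thesis by (simp add: add.commute)
    qed
    finally show "emeasure ?B A = emeasure ?C A" .
  qed
  then show ?thesis using False a pos by (simp add: N_def gamma_law_convolution add.commute)
qed

lemma sets_poisson_law [simp]: "sets (poisson_law m) = UNIV"
  by (simp add: poisson_law_def)

lemma space_poisson_law [simp]: "space (poisson_law m) = UNIV"
  by (simp add: poisson_law_def)

lemma emeasure_poisson_gamma:
  assumes a: "a > 0" and r: "r > 0" and A: "A \<in> sets borel"
  shows "emeasure (poisson_law m \<bind> (\<lambda>k. gamma_law (a + real k) r)) A
     = (\<Sum>k. ennreal (pois m k) * (\<integral>\<^sup>+u. ennreal (gamma_density (a + real k) r u) * indicator A u \<partial>lborel))"
proof -
  have m: "(\<lambda>k. gamma_law (a + real k) r) \<in> poisson_law m \<rightarrow>\<^sub>M subprob_algebra borel"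
  proof -
    have "(\<lambda>k. gamma_law (a + real k) r) \<in> count_space UNIV \<rightarrow>\<^sub>M subprob_algebra borel"
      using a r by (auto intro!: gamma_law_in_subprob)
    then show ?thesis by (subst measurable_cong_sets[where M'="count_space UNIV" and N'="subprob_algebra borel"]) auto
  qed
  have "emeasure (poisson_law m \<bind> (\<lambda>k. gamma_law (a + real k) r)) A = (\<integral>\<^sup>+k. emeasure (gamma_law (a + real k) r) A \<partial>poisson_law m)"
    by (rule emeasure_bind[OF _ m A]) simp
  also have "\<dots> = (\<Sum>k. ennreal (pois m k) * emeasure (gamma_law (a + real k) r) A)"
    unfolding poisson_law_def pois_def by (subst nn_integral_density) (auto simp: nn_integral_count_space_nat)
  finally show ?thesis using A by (simp add: gamma_law_def emeasure_density)
qed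

lemma sets_poisson_gamma [simp]: "sets (poisson_law m \<bind> (\<lambda>k. gamma_law (a + real k) r)) = sets borel"
  by (rule sets_bind) auto

text \<open>Negative starting points carry no mass, but there the Poisson weights are no
  subprobability and the kernel of the path is not measurable as a map into the
  subprobability algebra; the kernel is therefore replaced by its value at \<open>max 0 x\<close>.\<close>

lemma smart_path_law_eq:
  assumes a: "a > 0" and l: "l > 0" and t: "0 < t" "t < 1"
    and \<mu>: "prob_space \<mu>" "sets \<mu> = sets borel" "AE x in \<mu>. x > 0"
  shows "smart_path_law a l \<mu> t = density lborel (\<lambda>u. \<integral>\<^sup>+x. ennreal (gkern a l t u x) \<partial>\<mu>)"
proof -
  interpret \<mu>: prob_space \<mu> by fact
  note [measurable_cong] = \<mu>(2)
  have sp: "space \<mu> = UNIV" using sets_eq_imp_space_eq[OF \<mu>(2)] by simp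
  define r where "r = l / (1 - t)"
  have r: "r > 0" using l t by (simp add: r_def)
  define f where "f x = poisson_law (kA l t * x) \<bind> (\<lambda>k. gamma_law (a + real k) r)" for x
  define f' where "f' x = density lborel (\<lambda>u. ennreal (gamma_density a l u * kern a l t u (max 0 x)))" for x
  have path: "smart_path_law a l \<mu> t = \<mu> \<bind> f"
    unfolding smart_path_law_def smart_path_step[OF a l t] f_def r_def by (simp add: kA_def)
  have f_eq: "f x = f' x" if "x \<ge> 0" for x
  proof (rule measure_eqI)
    fix A assume "A \<in> sets (f x)"
    then have A [measurable]: "A \<in> sets borel" by (simp add: f_def)
    show "emeasure (f x) A = emeasure (f' x) A"
      unfolding f_def f'_def using nn_integral_gamma_kern[OF a l _ t(2) that, of "indicator A"] t a that
      by (simp add: emeasure_poisson_gamma[OF a r A, unfolded r_def] emeasure_density r_def max_absorb2)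
  qed (simp add: f_def f'_def)
  have f'_sub: "f' \<in> \<mu> \<rightarrow>\<^sub>M subprob_algebra borel"
  proof (rule measurable_subprob_algebra)
    fix x show "subprob_space (f' x)"
      using gamma_kern_mass[OF a l _ t(2), of "max 0 x"] t a
      by (intro subprob_spaceI) (auto simp: f'_def emeasure_density)
    show "sets (f' x) = sets borel" by (simp add: f'_def)
  next
    fix A :: "real set" assume [measurable]: "A \<in> sets borel"
    have [measurable]: "(\<lambda>(x, u). kern a l t u (max 0 x)) \<in> borel_measurable (\<mu> \<Otimes>\<^sub>M lborel)"
      using kern_measurable[OF a, of "\<lambda>_. t" "\<mu> \<Otimes>\<^sub>M lborel" snd "\<lambda>w. max 0 (fst w)" l] by (simp add: case_prod_unfold)
    show "(\<lambda>x. emeasure (f' x) A) \<in> borel_measurable \<mu>"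
      using a by (simp add: f'_def emeasure_density)
  qed
  have not_sub: "f x \<notin> space (subprob_algebra borel)" if "x < 0" for x
  proof
    assume "f x \<in> space (subprob_algebra borel)"
    then have s1: "emeasure (f x) UNIV \<le> 1"
      by (intro subprob_space.subprob_emeasure_le_1) (simp add: space_subprob_algebra)
    have s2: "emeasure (f x) UNIV = (\<Sum>k. ennreal (pois (kA l t * x) k))"
      unfolding f_def using a r by (simp add: emeasure_poisson_gamma nn_integral_gamma_density)
    \<comment> \<open>The first weight alone suffices: for a negative parameter \<open>m\<close> it
      equals \<open>exp (- m) > 1\<close>. The negative weights at odd \<open>k\<close> are
      truncated to 0 by \<open>ennreal\<close>, so they cannot compensate.\<close>
    have s3: "(\<Sum>k<1. ennreal (pois (kA l t * x) k)) \<le> (\<Sum>k. ennreal (pois (kA l t * x) k))"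
      by (rule sum_le_suminf) auto
    have "(\<Sum>k<1. ennreal (pois (kA l t * x) k)) \<le> 1"
      using s3 s1 unfolding s2 by (rule order_trans)
    then have "pois (kA l t * x) 0 \<le> 1" by simp
    moreover have "kA l t * x < 0" using that l t by (simp add: kA_def mult_pos_neg divide_neg_pos)
    ultimately show False by (simp add: pois_def)
  qed
  \<comment> \<open>As \<open>f\<close> is not measurable into the subprobability algebra,
    \<open>bind\<close> is unfolded down to \<open>distr\<close>. That only looks at preimages of
    sets of subprobability measures, which contain no negative point by \<open>not_sub\<close>;
    hence the preimages under \<open>f\<close> and \<open>f'\<close> differ by a null set.\<close>
  have "\<mu> \<bind> f = join (distr \<mu> (subprob_algebra borel) f)"
  proof -
    have "subprob_algebra (f (SOME x. x \<in> space \<mu>)) = subprob_algebra borel"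
      by (rule subprob_algebra_cong) (simp add: f_def)
    then show ?thesis using sp by (simp add: bind_nonempty)
  qed
  also have "distr \<mu> (subprob_algebra borel) f = distr \<mu> (subprob_algebra borel) f'"
    unfolding distr_def
  proof (rule measure_of_eq[OF sets.space_closed])
    fix A :: "real measure set"
    assume "A \<in> sigma_sets (space (subprob_algebra borel)) (sets (subprob_algebra borel))"
    then have A: "A \<in> sets (subprob_algebra borel)" by (simp add: sets.sigma_sets_eq)
    then have As: "A \<subseteq> space (subprob_algebra borel)" by (rule sets.sets_into_space)
    have m: "f' -` A \<inter> space \<mu> \<in> sets \<mu>" using f'_sub A by (rule measurable_sets)
    have "f -` A \<inter> space \<mu> = (f' -` A \<inter> space \<mu>) \<inter> {0..}"
    proof (rule set_eqI)
      fix x show "x \<in> f -` A \<inter> space \<mu> \<longleftrightarrow> x \<in> (f' -` A \<inter> space \<mu>) \<inter> {0..}"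
        using not_sub[of x] As f_eq[of x] by (cases "x \<ge> 0") (auto simp: sp)
    qed
    also have "emeasure \<mu> \<dots> = emeasure \<mu> (f' -` A \<inter> space \<mu>)"
      using \<mu>(3) m by (intro emeasure_eq_AE) (auto simp: \<mu>(2))
    finally show "emeasure \<mu> (f -` A \<inter> space \<mu>) = emeasure \<mu> (f' -` A \<inter> space \<mu>)" .
  qed
  also have "join (distr \<mu> (subprob_algebra borel) f') = \<mu> \<bind> f'"
    using bind_nonempty''[OF f'_sub] sp by simp
  finally have bind_eq: "\<mu> \<bind> f = \<mu> \<bind> f'" .
  interpret pair_sigma_finite \<mu> lborel by unfold_locales
  let ?d = "\<lambda>u. \<integral>\<^sup>+x. ennreal (gkern a l t u x) \<partial>\<mu>"
  show ?thesis unfolding path bind_eq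
  proof (rule measure_eqI)
    show "sets (\<mu> \<bind> f') = sets (density lborel ?d)"
      by (subst sets_bind[where N=borel]) (auto simp: f'_def sp)
    fix A assume "A \<in> sets (\<mu> \<bind> f')"
    then have A [measurable]: "A \<in> sets borel"
      by (subst (asm) sets_bind[where N=borel]) (auto simp: f'_def sp)
    have m [measurable]: "(\<lambda>w. kern a l t (snd w) (max 0 (fst w))) \<in> borel_measurable (\<mu> \<Otimes>\<^sub>M lborel)"
        "(\<lambda>w. kern a l t (snd w) (fst w)) \<in> borel_measurable (\<mu> \<Otimes>\<^sub>M lborel)"
      by (intro kern_measurable a; measurable)+
    have "emeasure (\<mu> \<bind> f') A = (\<integral>\<^sup>+x. emeasure (f' x) A \<partial>\<mu>)"
      by (rule emeasure_bind[OF _ f'_sub A]) (simp add: sp)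
    also have "\<dots> = (\<integral>\<^sup>+x. emeasure (density lborel (\<lambda>u. ennreal (gkern a l t u x))) A \<partial>\<mu>)"
      by (intro nn_integral_cong_AE, use \<mu>(3) in eventually_elim) (simp add: f'_def)
    also have "\<dots> = (\<integral>\<^sup>+x. (\<integral>\<^sup>+u. ennreal (gkern a l t u x) * indicator A u \<partial>lborel) \<partial>\<mu>)"
    proof (intro nn_integral_cong emeasure_density)
      fix x
      have "(\<lambda>u. kern a l t u x) \<in> borel_measurable lborel"
        by (intro kern_measurable a; measurable)
      then show "(\<lambda>u. ennreal (gkern a l t u x)) \<in> borel_measurable lborel" by measurable
    qed simp
    also have "\<dots> = (\<integral>\<^sup>+u. (\<integral>\<^sup>+x. ennreal (gkern a l t u x) * indicator A u \<partial>\<mu>) \<partial>lborel)"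
      by (rule Fubini'[symmetric]) (simp add: case_prod_unfold)
    also have "\<dots> = (\<integral>\<^sup>+u. (\<integral>\<^sup>+x. ennreal (gkern a l t u x) \<partial>\<mu>) * indicator A u \<partial>lborel)"
    proof (intro nn_integral_cong nn_integral_multc)
      fix u
      have "(\<lambda>x. kern a l t u x) \<in> borel_measurable \<mu>"
        by (intro kern_measurable a; measurable)
      then show "(\<lambda>x. ennreal (gkern a l t u x)) \<in> borel_measurable \<mu>" by measurable
    qed
    also have "\<dots> = emeasure (density lborel ?d) A"
    proof (rule emeasure_density[symmetric])
      have "(\<lambda>w. kern a l t (fst w) (snd w)) \<in> borel_measurable (lborel \<Otimes>\<^sub>M \<mu>)"
        by (intro kern_measurable a; measurable)
      then show "?d \<in> borel_measurable lborel"
        by (intro \<mu>.borel_measurable_nn_integral) (simp add: case_prod_unfold)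
    qed simp
    finally show "emeasure (\<mu> \<bind> f') A = emeasure (density lborel ?d) A" .
  qed
qed

section \<open>The density of the path relative to the gamma law\<close>

lemmas integrable_dominated = Bochner_Integration.integrable_bound
lemmas integrable_minus = Bochner_Integration.integrable_diff

text \<open>A coarser product form: the dependence on the starting point is confined to
  \<open>kern * (1 + x)\<close>, so integration over \<open>x\<close> leaves one weighted kernel
  integral.\<close>

lemma kern_du_bound':
  assumes "a \<ge> 1/2" "l > 0" "0 < t" "t < 1" "x \<ge> 0" "u \<ge> 0"
  shows "\<bar>kern_du a l t u x\<bar> \<le> (kA l t + 2 * kB l t) * (kern a l t u x * (1 + x))"
proof -
  have nn: "0 \<le> kA l t" "0 \<le> kB l t" using kA_nonneg kB_nonneg assms by auto
  have "\<bar>kern_du a l t u x\<bar> \<le> kern a l t u x * (kA l t + 2 * kB l t * x)"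
    using assms by (rule kern_du_bound)
  also have "\<dots> \<le> kern a l t u x * ((kA l t + 2 * kB l t) * (1 + x))"
    using nn assms kern_pos[OF assms] by (intro mult_left_mono) (auto simp: algebra_simps)
  finally show ?thesis by (simp add: mult_ac)
qed

lemma kern_dt_bound':
  assumes "a \<ge> 1/2" "l > 0" "0 < t" "t < 1" "x \<ge> 0" "u \<ge> 0"
  shows "\<bar>kern_dt a l t u x\<bar> \<le> (a / (1 - t) + kA' l t + 2 * kB' l t) * (1 + u) * (kern a l t u x * (1 + x))"
proof -
  define c where "c = a / (1 - t)"
  have nn: "0 \<le> kA' l t" "0 \<le> kB' l t" "0 \<le> c" using kA'_nonneg kB'_nonneg assms by (auto simp: c_def)
  have xu: "0 \<le> x * u" "0 \<le> x" "0 \<le> u" using assms by auto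
  have "0 \<le> c * x" "0 \<le> c * u" "0 \<le> c * (x * u)" "0 \<le> kA' l t * (x * u)" "0 \<le> kB' l t * x" "0 \<le> kB' l t * u"
    using nn xu by auto
  then have "c + kA' l t * (x + u) + 2 * kB' l t * x * u \<le> (c + kA' l t + 2 * kB' l t) * (1 + u) * (1 + x)"
    using nn by (simp add: algebra_simps)
  then have "kern a l t u x * (c + kA' l t * (x + u) + 2 * kB' l t * x * u)
     \<le> kern a l t u x * ((c + kA' l t + 2 * kB' l t) * (1 + u) * (1 + x))"
    using kern_pos[OF assms] by (intro mult_left_mono) auto
  then show ?thesis
    using kern_dt_bound[OF assms] unfolding c_def by (simp add: mult_ac)
qed

locale smart_path = prob_space \<mu> for \<mu> :: "real measure" +
  fixes a l :: real
  assumes a: "a \<ge> 1/2" and l: "l > 0"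
    and sets_mu [measurable_cong]: "sets \<mu> = sets borel"
    and pos: "AE x in \<mu>. x > 0"
    and m4: "integrable \<mu> (\<lambda>x. x ^ 4)"
    and mean: "(\<integral>x. x \<partial>\<mu>) = a / l"
begin

lemma a0: "a > 0" using a by simp

lemma space_mu [simp]: "space \<mu> = UNIV"
  using sets_eq_imp_space_eq[OF sets_mu] by simp

lemma prob_UNIV [simp]: "prob UNIV = 1"
  using prob_space by simp

lemmas kern_meas [measurable] = kern_measurable[OF a0] kern_du_measurable[OF a0] kern_dt_measurable[OF a0]

definition h :: "real \<Rightarrow> real \<Rightarrow> real" where "h t u = (\<integral>x. kern a l t u x \<partial>\<mu>)"
definition h_du :: "real \<Rightarrow> real \<Rightarrow> real" where "h_du t u = (\<integral>x. kern_du a l t u x \<partial>\<mu>)"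
definition h_dt :: "real \<Rightarrow> real \<Rightarrow> real" where "h_dt t u = (\<integral>x. kern_dt a l t u x \<partial>\<mu>)"
text \<open>The square is what Cauchy-Schwarz requires for the Fisher term. It also dominates the
  weights \<open>1\<close> and \<open>1 + x\<close>, so that one function serves all
  estimates.\<close>

definition W :: "real \<Rightarrow> real \<Rightarrow> real" where "W t u = (\<integral>x. kern a l t u x * (1 + x)\<^sup>2 \<partial>\<mu>)"

lemma h_measurable [measurable]:
  assumes [measurable]: "f \<in> borel_measurable M" "g \<in> borel_measurable M"
  shows "(\<lambda>w. h (f w) (g w)) \<in> borel_measurable M" "(\<lambda>w. h_du (f w) (g w)) \<in> borel_measurable M"
    "(\<lambda>w. h_dt (f w) (g w)) \<in> borel_measurable M" "(\<lambda>w. W (f w) (g w)) \<in> borel_measurable M"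
  unfolding h_def h_du_def h_dt_def W_def
  by (intro borel_measurable_lebesgue_integral; simp add: case_prod_unfold)+

lemma power_int_mu: "n \<le> 4 \<Longrightarrow> integrable \<mu> (\<lambda>x. x ^ n)"
proof (rule integrable_dominated[OF Bochner_Integration.integrable_add[OF integrable_const[of 1] m4]])
  assume n: "n \<le> 4"
  show "AE x in \<mu>. norm (x ^ n) \<le> norm (1 + x ^ 4)"
    using pos
  proof eventually_elim
    case (elim x)
    show ?case
    proof (cases "x \<le> 1")
      case True
      then have "x ^ n \<le> 1" using elim by (intro power_le_one) auto
      moreover have "0 \<le> x ^ 4" by simp
      ultimately have "x ^ n \<le> 1 + x ^ 4" by linarith
      then show ?thesis using elim by simp
    next
      case False
      then have "x ^ n \<le> x ^ 4" using n by (intro power_increasing) auto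
      then show ?thesis using elim by simp
    qed
  qed
qed measurable

lemma int_x: "integrable \<mu> (\<lambda>x. x)" using power_int_mu[of 1] by simp

lemma int_1x: "integrable \<mu> (\<lambda>x. 1 + x)" using int_x by simp

lemma int_1x2: "integrable \<mu> (\<lambda>x. (1 + x)\<^sup>2)"
proof -
  have "integrable \<mu> (\<lambda>x. 1 + 2 * x + x ^ 2)"
    using int_x power_int_mu[of 2] by simp
  then show ?thesis by (simp add: power2_sum algebra_simps)
qed

lemma int_1x4: "integrable \<mu> (\<lambda>x. (1 + x) ^ 4)"
proof -
  have "integrable \<mu> (\<lambda>x. 1 + 4 * x + 6 * x ^ 2 + 4 * x ^ 3 + x ^ 4)"
    using int_x power_int_mu[of 2] power_int_mu[of 3] m4 by simp
  then show ?thesis by (simp add: power4_eq_xxxx power2_eq_square power3_eq_cube algebra_simps)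
qed

section \<open>Integrability and growth bounds at a fixed time and position\<close>

context
  fixes t u :: real
  assumes t: "0 < t" "t < 1" and u: "u \<ge> 0"
begin

lemma kern_int_aux:
  assumes "integrable \<mu> w" and "\<And>x. x > 0 \<Longrightarrow> w x \<ge> 0"
  shows "integrable \<mu> (\<lambda>x. kern a l t u x * w x)"
proof (rule integrable_dominated)
  show "integrable \<mu> (\<lambda>x. (1 - t) powr (- a) * exp (l * u) * w x)"
    using assms by simp
  show "AE x in \<mu>. norm (kern a l t u x * w x) \<le> norm ((1 - t) powr (- a) * exp (l * u) * w x)"
    using pos
  proof eventually_elim
    case (elim x)
    then have "0 \<le> w x" "0 < kern a l t u x" "kern a l t u x \<le> (1 - t) powr (- a) * exp (l * u)"
      using assms kern_le[OF a l t, of x u] kern_pos[OF a l t, of x u] u by auto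
    then show ?case by (auto simp: abs_mult intro!: mult_right_mono)
  qed
  have "w \<in> borel_measurable \<mu>" using assms by simp
  then show "(\<lambda>x. kern a l t u x * w x) \<in> borel_measurable \<mu>" by measurable
qed

lemma kern_int: "integrable \<mu> (\<lambda>x. kern a l t u x)"
  using kern_int_aux[of "\<lambda>_. 1"] by simp

lemma kern_int1: "integrable \<mu> (\<lambda>x. kern a l t u x * (1 + x))"
  by (intro kern_int_aux int_1x) simp

lemma kern_int2: "integrable \<mu> (\<lambda>x. kern a l t u x * (1 + x)\<^sup>2)"
  by (intro kern_int_aux int_1x2) simp

lemma kern_du_int: "integrable \<mu> (\<lambda>x. kern_du a l t u x)"
proof (rule integrable_dominated)
  show "integrable \<mu> (\<lambda>x. (kA l t + 2 * kB l t) * (kern a l t u x * (1 + x)))"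
    using kern_int1 by simp
  show "AE x in \<mu>. norm (kern_du a l t u x) \<le> norm ((kA l t + 2 * kB l t) * (kern a l t u x * (1 + x)))"
    using pos by eventually_elim (use kern_du_bound'[OF a l t _ u] in \<open>force intro: order_trans[OF _ abs_ge_self]\<close>)
qed measurable

lemma kern_dt_int: "integrable \<mu> (\<lambda>x. kern_dt a l t u x)"
proof (rule integrable_dominated)
  show "integrable \<mu> (\<lambda>x. (a / (1 - t) + kA' l t + 2 * kB' l t) * (1 + u) * (kern a l t u x * (1 + x)))"
    using kern_int1 by simp
  show "AE x in \<mu>. norm (kern_dt a l t u x) \<le> norm ((a / (1 - t) + kA' l t + 2 * kB' l t) * (1 + u) * (kern a l t u x * (1 + x)))"
    using pos by eventually_elim (use kern_dt_bound'[OF a l t _ u] in \<open>force intro: order_trans[OF _ abs_ge_self]\<close>)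
qed measurable

lemma kern1_le_W: "(\<integral>x. kern a l t u x * (1 + x) \<partial>\<mu>) \<le> W t u"
  unfolding W_def
proof (rule integral_mono_AE[OF kern_int1 kern_int2])
  show "AE x in \<mu>. kern a l t u x * (1 + x) \<le> kern a l t u x * (1 + x)\<^sup>2"
    using pos
  proof eventually_elim
    case (elim x)
    then have "1 + x \<le> (1 + x)\<^sup>2" by (simp add: power2_eq_square algebra_simps)
    then show ?case using kern_pos[OF a l t, of x u] elim u by (intro mult_left_mono) auto
  qed
qed

lemma h_le_W: "h t u \<le> W t u"
  unfolding W_def h_def
proof (rule integral_mono_AE[OF kern_int kern_int2])
  show "AE x in \<mu>. kern a l t u x \<le> kern a l t u x * (1 + x)\<^sup>2"
    using pos
  proof eventually_elim
    case (elim x)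
    then have "1 \<le> (1 + x)\<^sup>2" by (simp add: power2_eq_square algebra_simps)
    then have "kern a l t u x * 1 \<le> kern a l t u x * (1 + x)\<^sup>2" using kern_pos[OF a l t, of x u] elim u by (intro mult_left_mono) auto
    then show ?case by simp
  qed
qed

text \<open>Jensen's inequality for the exponential in \<open>kern_ge\<close>, in tangent form: the
  tangent is taken at the mean \<open>a / l\<close>, where its linear part averages out. It yields
  the linear lower bound on \<open>ln h\<close>.\<close>

lemma h_ge: "exp (- (kA l t * (u + a / l))) \<le> h t u"
proof -
  define c where "c = a / l"
  have A: "0 \<le> kA l t" using kA_nonneg l t by simp
  have "(\<integral>x. exp (- (kA l t * (u + c))) * (1 + kA l t * c - kA l t * x) \<partial>\<mu>) \<le> h t u"
    unfolding h_def
  proof (rule integral_mono_AE)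
    show "integrable \<mu> (\<lambda>x. exp (- (kA l t * (u + c))) * (1 + kA l t * c - kA l t * x))"
      using int_x by simp
    show "AE x in \<mu>. exp (- (kA l t * (u + c))) * (1 + kA l t * c - kA l t * x) \<le> kern a l t u x"
      using pos
    proof eventually_elim
      case (elim x)
      have "1 + (kA l t * (c - x)) \<le> exp (kA l t * (c - x))" by (rule exp_ge_add_one_self)
      then have "exp (- (kA l t * (u + c))) * (1 + kA l t * c - kA l t * x) \<le> exp (- (kA l t * (u + c))) * exp (kA l t * (c - x))"
        by (intro mult_left_mono) (auto simp: algebra_simps)
      also have "\<dots> = exp (- (kA l t * (x + u)))" by (simp add: exp_add[symmetric] algebra_simps)
      also have "\<dots> \<le> kern a l t u x" using kern_ge[OF a l t] elim u by simp
      finally show ?case .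
    qed
  qed (rule kern_int)
  also have "(\<integral>x. exp (- (kA l t * (u + c))) * (1 + kA l t * c - kA l t * x) \<partial>\<mu>) = exp (- (kA l t * (u + c)))"
    using int_x mean by (simp add: c_def prob_space)
  finally show ?thesis by (simp add: c_def)
qed

lemma h_pos: "0 < h t u"
  by (rule less_le_trans[OF _ h_ge]) simp

lemma h_le: "h t u \<le> (1 - t) powr (- a) * exp (l * u)"
proof -
  have "h t u \<le> (\<integral>x. (1 - t) powr (- a) * exp (l * u) \<partial>\<mu>)"
    unfolding h_def
  proof (rule integral_mono_AE[OF kern_int])
    show "AE x in \<mu>. kern a l t u x \<le> (1 - t) powr (- a) * exp (l * u)"
      using pos by eventually_elim (use kern_le[OF a l t] u in auto)
  qed simp
  then show ?thesis by (simp add: prob_space)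
qed

lemma ln_h_bound: "\<bar>ln (h t u)\<bar> \<le> (- a * ln (1 - t) + l + kA l t + kA l t * (a / l)) * (1 + u)"
proof -
  have A: "0 \<le> kA l t" using kA_nonneg l t by simp
  have L: "0 \<le> - a * ln (1 - t)" using a0 t by (simp add: mult_nonneg_nonpos)
  have "ln (h t u) \<le> ln ((1 - t) powr (- a) * exp (l * u))"
    using h_le h_pos t by (subst ln_le_cancel_iff) auto
  also have "\<dots> = - a * ln (1 - t) + l * u"
    using t by (simp add: ln_mult ln_powr)
  finally have up: "ln (h t u) \<le> - a * ln (1 - t) + l * u" .
  have "ln (exp (- (kA l t * (u + a / l)))) \<le> ln (h t u)"
    using h_ge h_pos by (subst ln_le_cancel_iff) auto
  then have lo: "- (kA l t * (u + a / l)) \<le> ln (h t u)" by simp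
  define L' c where "L' = - a * ln (1 - t)" and "c = kA l t * (a / l)"
  have "0 \<le> L' * u" "0 \<le> l * u" "0 \<le> kA l t * u" "0 \<le> c * u" "0 \<le> L'" "0 \<le> c"
    using L A l a0 u unfolding L'_def[symmetric] by (auto simp: c_def)
  then show ?thesis using up lo l A unfolding L'_def[symmetric] c_def[symmetric] distrib_left
    by (simp add: algebra_simps abs_le_iff)
qed

lemma h_du_bound: "\<bar>h_du t u\<bar> \<le> (kA l t + 2 * kB l t) * (\<integral>x. kern a l t u x * (1 + x) \<partial>\<mu>)"
proof -
  have "\<bar>h_du t u\<bar> \<le> (\<integral>x. (kA l t + 2 * kB l t) * (kern a l t u x * (1 + x)) \<partial>\<mu>)"
    unfolding h_du_def
  proof (rule order_trans[OF integral_abs_bound integral_mono_AE])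
    show "AE x in \<mu>. \<bar>kern_du a l t u x\<bar> \<le> (kA l t + 2 * kB l t) * (kern a l t u x * (1 + x))"
      using pos by eventually_elim (use kern_du_bound'[OF a l t _ u] in simp)
  qed (use kern_du_int kern_int1 in auto)
  then show ?thesis by simp
qed

lemma h_dt_bound: "\<bar>h_dt t u\<bar> \<le> (a / (1 - t) + kA' l t + 2 * kB' l t) * (1 + u) * W t u"
proof -
  have "\<bar>h_dt t u\<bar> \<le> (\<integral>x. (a / (1 - t) + kA' l t + 2 * kB' l t) * (1 + u) * (kern a l t u x * (1 + x)) \<partial>\<mu>)"
    unfolding h_dt_def
  proof (rule order_trans[OF integral_abs_bound integral_mono_AE])
    show "AE x in \<mu>. \<bar>kern_dt a l t u x\<bar> \<le> (a / (1 - t) + kA' l t + 2 * kB' l t) * (1 + u) * (kern a l t u x * (1 + x))"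
      using pos by eventually_elim (use kern_dt_bound'[OF a l t _ u] in simp)
  qed (use kern_dt_int kern_int1 in auto)
  also have "\<dots> = (a / (1 - t) + kA' l t + 2 * kB' l t) * (1 + u) * (\<integral>x. kern a l t u x * (1 + x) \<partial>\<mu>)"
    by simp
  also have "\<dots> \<le> (a / (1 - t) + kA' l t + 2 * kB' l t) * (1 + u) * W t u"
    using kern1_le_W a0 l t u kA'_nonneg[of l t] kB'_nonneg[of l t] by (intro mult_left_mono) auto
  finally show ?thesis .
qed

text \<open>Cauchy-Schwarz for the measure weighted by the kernel, obtained by expanding the
  nonnegative integral of \<open>((1 + x) - c)^2\<close> at the weighted mean \<open>c\<close> of
  \<open>1 + x\<close>. The quotient by \<open>h\<close> thus costs no lower bound on
  \<open>h\<close>.\<close>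

lemma h_du_sq_bound: "(h_du t u)\<^sup>2 / h t u \<le> (kA l t + 2 * kB l t)\<^sup>2 * W t u"
proof -
  define W1 where "W1 = (\<integral>x. kern a l t u x * (1 + x) \<partial>\<mu>)"
  have nn: "0 \<le> kA l t + 2 * kB l t" using kA_nonneg[of l t] kB_nonneg[of l t] l t by simp
  define c where "c = W1 / h t u"
  have "0 \<le> (\<integral>x. kern a l t u x * ((1 + x) - c)\<^sup>2 \<partial>\<mu>)"
    by (rule integral_nonneg_AE, use pos in eventually_elim) (use kern_pos[OF a l t] u in \<open>auto simp: less_imp_le\<close>)
  also have "\<dots> = (\<integral>x. kern a l t u x * (1 + x)\<^sup>2 - 2 * c * (kern a l t u x * (1 + x)) + c\<^sup>2 * kern a l t u x \<partial>\<mu>)"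
    by (intro Bochner_Integration.integral_cong refl) (simp add: power2_eq_square algebra_simps)
  also have "\<dots> = W t u - 2 * c * W1 + c\<^sup>2 * h t u"
    unfolding W_def W1_def h_def using kern_int kern_int1 kern_int2 by simp
  also have "\<dots> = W t u - W1\<^sup>2 / h t u"
    using h_pos by (simp add: c_def power2_eq_square)
  finally have CS: "W1\<^sup>2 / h t u \<le> W t u" by simp
  have "(h_du t u)\<^sup>2 \<le> ((kA l t + 2 * kB l t) * W1)\<^sup>2"
    using h_du_bound unfolding W1_def[symmetric] by (rule abs_le_square_iff[THEN iffD1, OF order_trans[OF _ abs_ge_self]])
  then have "(h_du t u)\<^sup>2 / h t u \<le> ((kA l t + 2 * kB l t) * W1)\<^sup>2 / h t u"
    using h_pos by (intro divide_right_mono) auto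
  also have "\<dots> = (kA l t + 2 * kB l t)\<^sup>2 * (W1\<^sup>2 / h t u)" by (simp add: power_mult_distrib)
  also have "\<dots> \<le> (kA l t + 2 * kB l t)\<^sup>2 * W t u"
    using CS by (intro mult_left_mono) auto
  finally show ?thesis .
qed

end

section \<open>Differentiation of \<open>h\<close> under the expectation\<close>

lemma h_has_du:
  assumes t: "0 < t" "t < 1" and u: "u > 0"
  shows "((\<lambda>u. h t u) has_real_derivative h_du t u) (at u)"
  unfolding h_def[abs_def] h_du_def
proof (rule has_derivative_under_integral(1)[where U="{0<..<u+1}" and P="\<lambda>x. x > 0"
    and g="\<lambda>x. (kA l t + 2 * kB l t) * ((1 - t) powr (- a) * exp (l * (u + 1)) * (1 + x))" and f'="\<lambda>u x. kern_du a l t u x"])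
  fix v x assume v: "v \<in> {0<..<u+1}" and x: "(0::real) < x"
  show "((\<lambda>u. kern a l t u x) has_real_derivative kern_du a l t v x) (at v)"
    by (rule kern_has_du[OF a0])
  have "\<bar>kern_du a l t v x\<bar> \<le> (kA l t + 2 * kB l t) * (kern a l t v x * (1 + x))"
    using v x by (intro kern_du_bound' a l t) auto
  also have "\<dots> \<le> (kA l t + 2 * kB l t) * ((1 - t) powr (- a) * exp (l * v) * (1 + x))"
    using v x t l kA_nonneg[of l t] kB_nonneg[of l t] by (intro mult_left_mono mult_right_mono kern_le a) auto
  also have "\<dots> \<le> (kA l t + 2 * kB l t) * ((1 - t) powr (- a) * exp (l * (u + 1)) * (1 + x))"
    using v x t l kA_nonneg[of l t] kB_nonneg[of l t] by (intro mult_left_mono mult_right_mono) auto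
  finally show "\<bar>kern_du a l t v x\<bar> \<le> (kA l t + 2 * kB l t) * ((1 - t) powr (- a) * exp (l * (u + 1)) * (1 + x))" .
qed (use t u pos int_1x in \<open>auto intro: kern_int\<close>)

lemma h_has_dt:
  assumes t: "0 < t" "t < 1" and u: "u > 0"
  shows "((\<lambda>t. h t u) has_real_derivative h_dt t u) (at t)"
  unfolding h_def[abs_def] h_dt_def
proof -
  \<comment> \<open>The constants in the bounds blow up at time 1. Stopping the neighbourhood of
    \<open>t\<close> halfway there keeps them finite, and by monotonicity their values at
    \<open>s\<close> dominate throughout.\<close>
  define s where "s = (t + 1) / 2"
  have s: "t < s" "s < 1" "0 < s" using t by (auto simp: s_def)
  define D where "D t = (a / (1 - t) + kA' l t + 2 * kB' l t) * (1 + u)" for t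
  have Ds: "0 \<le> D v" "D v \<le> D s" "(1 - v) powr (- a) \<le> (1 - s) powr (- a)" if "0 < v" "v < s" for v
  proof -
    have v: "v < 1" using that s by simp
    show "0 \<le> D v" using that v u l a0 kA'_nonneg[of l v] kB'_nonneg[of l v] by (simp add: D_def)
    show "D v \<le> D s" unfolding D_def
      using that s u l a0 kA'_mono[of l v s] kB'_mono[of l v s]
      by (intro mult_right_mono add_mono mult_left_mono divide_left_mono) auto
    show "(1 - v) powr (- a) \<le> (1 - s) powr (- a)"
      using that s a0 by (intro powr_mono2') auto
  qed
  show "((\<lambda>t. \<integral>x. kern a l t u x \<partial>\<mu>) has_real_derivative (\<integral>x. kern_dt a l t u x \<partial>\<mu>)) (at t)"
  proof (rule has_derivative_under_integral(1)[where U="{0<..<s}" and P="\<lambda>x. x > 0"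
      and g="\<lambda>x. D s * ((1 - s) powr (- a) * exp (l * u) * (1 + x))" and f'="\<lambda>t x. kern_dt a l t u x"])
    fix v x assume v: "v \<in> {0<..<s}" and x: "(0::real) < x"
    have v': "0 < v" "v < s" "v < 1" using v s by auto
    show "((\<lambda>t. kern a l t u x) has_real_derivative kern_dt a l v u x) (at v)"
      using v' by (intro kern_has_dt a0)
    have "\<bar>kern_dt a l v u x\<bar> \<le> D v * (kern a l v u x * (1 + x))"
      unfolding D_def using v' x u by (intro kern_dt_bound' a l) auto
    also have "\<dots> \<le> D v * ((1 - v) powr (- a) * exp (l * u) * (1 + x))"
      using v' x u l Ds(1)[of v] by (intro mult_left_mono mult_right_mono kern_le a) auto
    also have "\<dots> \<le> D s * ((1 - s) powr (- a) * exp (l * u) * (1 + x))"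
      using v' x Ds[of v] by (intro mult_mono mult_right_mono) auto
    finally show "\<bar>kern_dt a l v u x\<bar> \<le> D s * ((1 - s) powr (- a) * exp (l * u) * (1 + x))" .
  qed (use s t u pos int_1x in \<open>auto intro: kern_int\<close>)
qed

lemma h_pde:
  assumes t: "0 < t" "t < 1" and u: "u > 0"
  shows "((\<lambda>u. u * h_du t u) has_real_derivative (- l * t * h_dt t u - (a - 1 - l * u) * h_du t u)) (at u)"
proof -
  \<comment> \<open>\<open>D\<close> and \<open>E\<close> bound the contributions of
    \<open>kern_dt\<close> and of \<open>kern_du\<close> to the right-hand side, uniformly for
    positions below \<open>u + 1\<close>.\<close>
  define D where "D = l * t * (a / (1 - t) + kA' l t + 2 * kB' l t) * (1 + (u + 1))"
  define E where "E = (\<bar>a - 1\<bar> + l * (u + 1)) * (kA l t + 2 * kB l t)"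
  have D: "0 \<le> D" using t u l a0 kA'_nonneg[of l t] kB'_nonneg[of l t] by (simp add: D_def)
  have C: "0 \<le> kA l t + 2 * kB l t" using kA_nonneg[of l t] kB_nonneg[of l t] t l by simp
  have E: "0 \<le> E" unfolding E_def using u l by (intro mult_nonneg_nonneg[OF _ C]) auto
  have "((\<lambda>u. \<integral>x. u * kern_du a l t u x \<partial>\<mu>) has_real_derivative
     (\<integral>x. - l * t * kern_dt a l t u x - (a - 1 - l * u) * kern_du a l t u x \<partial>\<mu>)) (at u)"
  proof (rule has_derivative_under_integral(1)[where U="{0<..<u+1}" and P="\<lambda>x. x > 0"
    and g="\<lambda>x. (D + E) * ((1 - t) powr (- a) * exp (l * (u + 1)) * (1 + x))"
    and f'="\<lambda>u x. - l * t * kern_dt a l t u x - (a - 1 - l * u) * kern_du a l t u x"])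
    fix v x assume v: "v \<in> {0<..<u+1}" and x: "(0::real) < x"
    show "((\<lambda>u. u * kern_du a l t u x) has_real_derivative - l * t * kern_dt a l t v x - (a - 1 - l * v) * kern_du a l t v x) (at v)"
      by (rule kern_pde[OF a0 t(2)])
    let ?k = "kern a l t v x * (1 + x)"
    have k: "0 \<le> ?k" using kern_pos[OF a l t, of x v] v x by simp
    have "l * t * \<bar>kern_dt a l t v x\<bar> \<le> l * t * ((a / (1 - t) + kA' l t + 2 * kB' l t) * (1 + v) * ?k)"
      using v x l t by (intro mult_left_mono kern_dt_bound' a) auto
    also have "\<dots> = l * t * (a / (1 - t) + kA' l t + 2 * kB' l t) * (1 + v) * ?k" by simp
    also have "\<dots> \<le> D * ?k"
      unfolding D_def using k v t l a0 kA'_nonneg[of l t] kB'_nonneg[of l t]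
      by (intro mult_right_mono mult_left_mono) auto
    finally have 1: "l * t * \<bar>kern_dt a l t v x\<bar> \<le> D * ?k" .
    have "\<bar>l * v\<bar> \<le> l * (u + 1)" using v l by (simp add: abs_mult)
    then have "\<bar>a - 1 - l * v\<bar> \<le> \<bar>a - 1\<bar> + l * (u + 1)" by linarith
    then have "\<bar>a - 1 - l * v\<bar> * \<bar>kern_du a l t v x\<bar> \<le> (\<bar>a - 1\<bar> + l * (u + 1)) * ((kA l t + 2 * kB l t) * ?k)"
      using v x by (intro mult_mono kern_du_bound' a l t) auto
    then have 2: "\<bar>a - 1 - l * v\<bar> * \<bar>kern_du a l t v x\<bar> \<le> E * ?k" by (simp add: E_def mult.assoc)
    have "\<bar>- l * t * kern_dt a l t v x - (a - 1 - l * v) * kern_du a l t v x\<bar> \<le> \<bar>- l * t * kern_dt a l t v x\<bar> + \<bar>(a - 1 - l * v) * kern_du a l t v x\<bar>"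
      by linarith
    also have "\<dots> = l * t * \<bar>kern_dt a l t v x\<bar> + \<bar>a - 1 - l * v\<bar> * \<bar>kern_du a l t v x\<bar>"
      using l t by (simp add: abs_mult)
    also have "\<dots> \<le> (D + E) * ?k" using 1 2 by (simp add: distrib_right)
    also have "\<dots> \<le> (D + E) * ((1 - t) powr (- a) * exp (l * v) * (1 + x))"
      using v x D E by (intro mult_left_mono mult_right_mono kern_le a l t) auto
    also have "\<dots> \<le> (D + E) * ((1 - t) powr (- a) * exp (l * (u + 1)) * (1 + x))"
      using v x l D E by (intro mult_left_mono mult_right_mono) auto
    finally show "\<bar>- l * t * kern_dt a l t v x - (a - 1 - l * v) * kern_du a l t v x\<bar>
       \<le> (D + E) * ((1 - t) powr (- a) * exp (l * (u + 1)) * (1 + x))" .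
  qed (use t u pos int_1x in \<open>auto intro!: kern_du_int\<close>)
  moreover have "(\<lambda>u. \<integral>x. u * kern_du a l t u x \<partial>\<mu>) = (\<lambda>u. u * h_du t u)"
    by (simp add: h_du_def)
  moreover have "(\<integral>x. - l * t * kern_dt a l t u x - (a - 1 - l * u) * kern_du a l t u x \<partial>\<mu>) = - l * t * h_dt t u - (a - 1 - l * u) * h_du t u"
    using kern_du_int[OF t, of u] kern_dt_int[OF t, of u] u by (simp add: h_du_def h_dt_def)
  ultimately show ?thesis by (simp only:)
qed

end

section \<open>De Bruijn's identity\<close>

text \<open>The constant is free of \<open>t\<close>: all powers of \<open>t\<close> and
  \<open>1 - t\<close> in the second moment are estimated by 1. This gives control uniform in time,
  which Fubini over a time interval needs.\<close>

lemma nn_integral_gamma_kern_poly: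
  assumes a: "a > 0" and l: "l > 0" and t: "0 \<le> t" "t < 1" and x: "x \<ge> 0"
  shows "(\<integral>\<^sup>+u. ennreal (gkern a l t u x) * ennreal ((1 + u)\<^sup>2) \<partial>lborel)
    \<le> ennreal ((2 + 2 * ((a / l + 1)\<^sup>2 + a / l\<^sup>2 + 2 / l)) * (1 + x)\<^sup>2)"
proof -
  have km [measurable]: "(\<lambda>u. kern a l t u x) \<in> borel_measurable lborel"
    by (intro kern_measurable a; measurable)
  have "(\<integral>\<^sup>+u. ennreal (gkern a l t u x) * ennreal ((1 + u)\<^sup>2) \<partial>lborel)
    \<le> (\<integral>\<^sup>+u. 2 * ennreal (gkern a l t u x) + 2 * (ennreal (gkern a l t u x) * ennreal (u\<^sup>2)) \<partial>lborel)"
  proof (rule nn_integral_mono)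
    fix u :: real
    have "(1 + u)\<^sup>2 \<le> 2 + 2 * u\<^sup>2"
      using zero_le_power2[of "1 - u"] by (simp add: power2_eq_square algebra_simps)
    then have "ennreal ((1 + u)\<^sup>2) \<le> ennreal (2 + 2 * u\<^sup>2)" by (rule ennreal_leI)
    also have "\<dots> = 2 + 2 * ennreal (u\<^sup>2)" by (simp add: ennreal_plus ennreal_mult)
    finally have "ennreal (gkern a l t u x) * ennreal ((1 + u)\<^sup>2)
       \<le> ennreal (gkern a l t u x) * (2 + 2 * ennreal (u\<^sup>2))"
      by (rule mult_left_mono) simp
    then show "ennreal (gkern a l t u x) * ennreal ((1 + u)\<^sup>2)
      \<le> 2 * ennreal (gkern a l t u x) + 2 * (ennreal (gkern a l t u x) * ennreal (u\<^sup>2))"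
      by (simp add: distrib_left mult_ac)
  qed
  also have "\<dots> = 2 * (\<integral>\<^sup>+u. ennreal (gkern a l t u x) \<partial>lborel)
     + 2 * (\<integral>\<^sup>+u. ennreal (gkern a l t u x) * ennreal (u\<^sup>2) \<partial>lborel)"
    by (subst nn_integral_add, measurable, subst nn_integral_cmult, measurable, subst nn_integral_cmult, measurable)
  also have "\<dots> = ennreal (2 + 2 * (((1 - t) * a / l + t * x)\<^sup>2 + (1 - t)\<^sup>2 * a / l\<^sup>2 + 2 * t * (1 - t) * x / l))"
    unfolding gamma_kern_mass[OF a l t x] gamma_kern_moment2[OF a l t x]
  proof -
    have "2 * 1 + 2 * ennreal m = ennreal (2 + 2 * m)" if "m \<ge> 0" for m
      using that by (simp add: ennreal_plus ennreal_mult)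
    then show "2 * 1 + 2 * ennreal (((1 - t) * a / l + t * x)\<^sup>2 + (1 - t)\<^sup>2 * a / l\<^sup>2 + 2 * t * (1 - t) * x / l)
      = ennreal (2 + 2 * (((1 - t) * a / l + t * x)\<^sup>2 + (1 - t)\<^sup>2 * a / l\<^sup>2 + 2 * t * (1 - t) * x / l))"
      using a l t x by simp
  qed
  also have "\<dots> \<le> ennreal ((2 + 2 * ((a / l + 1)\<^sup>2 + a / l\<^sup>2 + 2 / l)) * (1 + x)\<^sup>2)"
  proof (rule ennreal_leI)
    have x2: "1 \<le> (1 + x)\<^sup>2" "x \<le> (1 + x)\<^sup>2" using x by (auto simp: power2_eq_square algebra_simps)
    have "(1 - t) * (a / l) + t * x \<le> 1 * (a / l) + 1 * x" using a l t x by (intro add_mono mult_right_mono) auto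
    also have "\<dots> \<le> (a / l + 1) * (1 + x)"
    proof -
      have "0 \<le> a / l * x" using a l x by simp
      then show ?thesis by (simp only: distrib_left distrib_right)
    qed
    finally have "((1 - t) * (a / l) + t * x)\<^sup>2 \<le> ((a / l + 1) * (1 + x))\<^sup>2"
      using a l t x by (intro power_mono) auto
    then have 1: "((1 - t) * a / l + t * x)\<^sup>2 \<le> (a / l + 1)\<^sup>2 * (1 + x)\<^sup>2"
      by (simp add: power_mult_distrib)
    have "(1 - t)\<^sup>2 * (a / l\<^sup>2) \<le> 1 * (a / l\<^sup>2)" using a t by (intro mult_right_mono power_le_one) auto
    also have "\<dots> \<le> (a / l\<^sup>2) * (1 + x)\<^sup>2" using mult_left_mono[OF x2(1), of "a / l\<^sup>2"] a by simp
    finally have 2: "(1 - t)\<^sup>2 * a / l\<^sup>2 \<le> a / l\<^sup>2 * (1 + x)\<^sup>2" by simp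
    have "(t * (1 - t)) * (2 / l * x) \<le> 1 * (2 / l * x)"
      using t l x by (intro mult_right_mono mult_le_one) auto
    also have "\<dots> \<le> 2 / l * (1 + x)\<^sup>2" using mult_left_mono[OF x2(2), of "2 / l"] l by simp
    finally have 3: "2 * t * (1 - t) * x / l \<le> 2 / l * (1 + x)\<^sup>2" by (simp add: mult_ac)
    show "2 + 2 * (((1 - t) * a / l + t * x)\<^sup>2 + (1 - t)\<^sup>2 * a / l\<^sup>2 + 2 * t * (1 - t) * x / l)
       \<le> (2 + 2 * ((a / l + 1)\<^sup>2 + a / l\<^sup>2 + 2 / l)) * (1 + x)\<^sup>2"
      using 1 2 3 x2(1) by (simp only: distrib_right distrib_left mult.assoc)
  qed
  finally show ?thesis .
qed

context smart_path begin

abbreviation "\<gamma> \<equiv> gamma_density a l"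
abbreviation "p \<equiv> gkern a l"

lemma gam_nonneg: "0 \<le> \<gamma> u" by (rule gamma_density_nonneg[OF a0])

lemma trans_nonneg:
  assumes "0 < t" "t < 1" "x > 0"
  shows "0 \<le> p t u x"
  using kern_pos[OF a l assms(1,2), of x u] assms gam_nonneg[of u] by (cases "u > 0") auto

lemma ennreal_gamma_kern_integral:
  assumes t: "0 < t" "t < 1" and v [measurable]: "v \<in> borel_measurable borel" "\<And>x. x > 0 \<Longrightarrow> 0 \<le> v x"
    and int: "u > 0 \<Longrightarrow> integrable \<mu> (\<lambda>x. kern a l t u x * v x)"
  shows "ennreal (\<gamma> u * (\<integral>x. kern a l t u x * v x \<partial>\<mu>)) = (\<integral>\<^sup>+x. ennreal (v x) * ennreal (p t u x) \<partial>\<mu>)"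
proof (cases "u > 0")
  case True
  have "(\<integral>\<^sup>+x. ennreal (v x) * ennreal (p t u x) \<partial>\<mu>) = (\<integral>\<^sup>+x. ennreal (\<gamma> u * (kern a l t u x * v x)) \<partial>\<mu>)"
  proof (rule nn_integral_cong_AE, use pos in eventually_elim)
    case (elim x)
    then show ?case using trans_nonneg[OF t, of x u] v(2)[of x] by (simp add: ennreal_mult[symmetric] mult_ac)
  qed
  also have "\<dots> = ennreal (\<integral>x. \<gamma> u * (kern a l t u x * v x) \<partial>\<mu>)"
  proof (rule nn_integral_eq_integral)
    show "AE x in \<mu>. 0 \<le> \<gamma> u * (kern a l t u x * v x)"
      using pos by eventually_elim (use trans_nonneg[OF t] v(2) in \<open>simp add: mult.assoc[symmetric]\<close>)
  qed (use int[OF True] in auto)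
  finally show ?thesis by simp
qed simp

lemma nn_integral_gamma_kern_integral:
  assumes t: "0 < t" "t < 1" and v [measurable]: "v \<in> borel_measurable borel" "\<And>x. x > 0 \<Longrightarrow> 0 \<le> v x"
    and int: "\<And>u. u > 0 \<Longrightarrow> integrable \<mu> (\<lambda>x. kern a l t u x * v x)"
    and w [measurable]: "w \<in> borel_measurable borel"
  shows "(\<integral>\<^sup>+u. ennreal (\<gamma> u * (\<integral>x. kern a l t u x * v x \<partial>\<mu>)) * w u \<partial>lborel)
     = (\<integral>\<^sup>+x. ennreal (v x) * (\<integral>\<^sup>+u. ennreal (p t u x) * w u \<partial>lborel) \<partial>\<mu>)"
proof -
  interpret P: pair_sigma_finite \<mu> lborel by unfold_locales
  have "(\<integral>\<^sup>+u. ennreal (\<gamma> u * (\<integral>x. kern a l t u x * v x \<partial>\<mu>)) * w u \<partial>lborel)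
     = (\<integral>\<^sup>+u. (\<integral>\<^sup>+x. ennreal (v x) * (ennreal (p t u x) * w u) \<partial>\<mu>) \<partial>lborel)"
  proof (rule nn_integral_cong)
    fix u
    have "ennreal (\<gamma> u * (\<integral>x. kern a l t u x * v x \<partial>\<mu>)) * w u = (\<integral>\<^sup>+x. ennreal (v x) * ennreal (p t u x) * w u \<partial>\<mu>)"
      using ennreal_gamma_kern_integral[OF t v int, of u] by (subst nn_integral_multc) auto
    then show "ennreal (\<gamma> u * (\<integral>x. kern a l t u x * v x \<partial>\<mu>)) * w u = (\<integral>\<^sup>+x. ennreal (v x) * (ennreal (p t u x) * w u) \<partial>\<mu>)"
      by (simp only: mult.assoc)
  qed
  also have "\<dots> = (\<integral>\<^sup>+x. (\<integral>\<^sup>+u. ennreal (v x) * (ennreal (p t u x) * w u) \<partial>lborel) \<partial>\<mu>)"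
    by (rule P.Fubini') (simp add: case_prod_unfold)
  also have "\<dots> = (\<integral>\<^sup>+x. ennreal (v x) * (\<integral>\<^sup>+u. ennreal (p t u x) * w u \<partial>lborel) \<partial>\<mu>)"
    by (intro nn_integral_cong nn_integral_cmult) measurable
  finally show ?thesis .
qed

text \<open>After exchanging the integrals, the weight \<open>(1 + u)^2\<close> costs a factor
  \<open>(1 + x)^2\<close> by the previous moment bound. Together with the \<open>(1 + x)^2\<close>
  inside \<open>W\<close> this is where the fourth moment is spent.\<close>

lemma nn_integral_W_le:
  obtains C where "C \<ge> 0"
    and "\<And>t. 0 < t \<Longrightarrow> t < 1 \<Longrightarrow> (\<integral>\<^sup>+u. ennreal (\<gamma> u * W t u * (1 + u)\<^sup>2) \<partial>lborel) \<le> ennreal C"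
proof -
  define K where "K = 2 + 2 * ((a / l + 1)\<^sup>2 + a / l\<^sup>2 + 2 / l)"
  have K: "0 \<le> K" using a0 l by (simp add: K_def)
  define C where "C = K * (\<integral>x. (1 + x) ^ 4 \<partial>\<mu>)"
  have "(\<integral>\<^sup>+u. ennreal (\<gamma> u * W t u * (1 + u)\<^sup>2) \<partial>lborel) \<le> ennreal C" if t: "0 < t" "t < 1" for t
  proof -
    have "(\<integral>\<^sup>+u. ennreal (\<gamma> u * W t u * (1 + u)\<^sup>2) \<partial>lborel) = (\<integral>\<^sup>+u. ennreal (\<gamma> u * W t u) * ennreal ((1 + u)\<^sup>2) \<partial>lborel)"
      by (intro nn_integral_cong) (simp add: ennreal_mult'')
    also have "\<dots> = (\<integral>\<^sup>+x. ennreal ((1 + x)\<^sup>2) * (\<integral>\<^sup>+u. ennreal (p t u x) * ennreal ((1 + u)\<^sup>2) \<partial>lborel) \<partial>\<mu>)"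
      unfolding W_def using kern_int2[OF t] by (intro nn_integral_gamma_kern_integral t) auto
    also have "\<dots> \<le> (\<integral>\<^sup>+x. ennreal (K * (1 + x) ^ 4) \<partial>\<mu>)"
    proof (rule nn_integral_mono_AE, use pos in eventually_elim)
      case (elim x)
      have "ennreal ((1 + x)\<^sup>2) * (\<integral>\<^sup>+u. ennreal (p t u x) * ennreal ((1 + u)\<^sup>2) \<partial>lborel)
        \<le> ennreal ((1 + x)\<^sup>2) * ennreal (K * (1 + x)\<^sup>2)"
        unfolding K_def using t elim by (intro mult_left_mono nn_integral_gamma_kern_poly a0 l) auto
      also have "\<dots> = ennreal (K * (1 + x) ^ 4)"
        using K by (simp add: ennreal_mult[symmetric] power4_eq_xxxx power2_eq_square mult_ac)
      finally show ?case .
    qed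
    also have "\<dots> = ennreal C"
      unfolding C_def using int_1x4 K by (subst nn_integral_eq_integral) auto
    finally show ?thesis .
  qed
  moreover have "C \<ge> 0" unfolding C_def using K by (intro mult_nonneg_nonneg integral_nonneg) auto
  ultimately show ?thesis using that by blast
qed

text \<open>The common majorant: up to factors depending on time alone it bounds the entropy
  integrand, its time derivative, the Fisher integrand and the boundary function of the integration
  by parts.\<close>

definition Wb :: "real \<Rightarrow> real \<Rightarrow> real" where "Wb t u = \<gamma> u * W t u * (1 + u)\<^sup>2"

lemma Wb_measurable [measurable]:
  assumes [measurable]: "f \<in> borel_measurable M" "g \<in> borel_measurable M"
  shows "(\<lambda>w. Wb (f w) (g w)) \<in> borel_measurable M"
  unfolding Wb_def by measurable

text \<open>These are the time-dependent constants in the bounds on \<open>h_du\<close>,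
  \<open>h_dt\<close> and \<open>ln h\<close>, in this order.\<close>

definition kC :: "real \<Rightarrow> real" where "kC t = kA l t + 2 * kB l t"
definition kD :: "real \<Rightarrow> real" where "kD t = a / (1 - t) + kA' l t + 2 * kB' l t"
definition kL :: "real \<Rightarrow> real" where "kL t = - a * ln (1 - t) + l + kA l t + kA l t * (a / l)"

lemma k_nonneg: assumes "0 < t" "t < 1" shows "0 \<le> kC t" "0 \<le> kD t" "0 \<le> kL t"
proof -
  have "a * ln (1 - t) \<le> 0" using assms a0 by (simp add: mult_nonneg_nonpos)
  moreover have "0 \<le> kA l t * (a / l)" using kA_nonneg[of l t] assms l a0 by simp
  ultimately show "0 \<le> kC t" "0 \<le> kD t" "0 \<le> kL t"
    using kA_nonneg[of l t] kB_nonneg[of l t] kA'_nonneg[of l t] kB'_nonneg[of l t] assms l a0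
    by (auto simp: kC_def kD_def kL_def)
qed

lemma k_mono: assumes "0 < s" "s \<le> t" "t < 1" shows "kD s \<le> kD t" "kL s \<le> kL t"
proof -
  show "kD s \<le> kD t"
    unfolding kD_def using assms l a0 kA'_mono[of l s t] kB'_mono[of l s t]
    by (intro add_mono mult_left_mono divide_left_mono) auto
  have "a * ln (1 - t) \<le> a * ln (1 - s)" using assms a0 by (intro mult_left_mono) auto
  then show "kL s \<le> kL t"
    unfolding kL_def using assms l a0 kA_mono[of l s t] by (intro add_mono mult_right_mono) auto
qed

section \<open>Entropy and Fisher integrands\<close>

definition ent :: "real \<Rightarrow> real \<Rightarrow> real" where "ent t u = \<gamma> u * (h t u * ln (h t u))"
definition ent_dt :: "real \<Rightarrow> real \<Rightarrow> real" where "ent_dt t u = \<gamma> u * ((1 + ln (h t u)) * h_dt t u)"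
text \<open>The path has density \<open>\<gamma> * h\<close>, so its score minus that of the gamma
  law is \<open>h_du / h\<close>, and this is the integrand of the Stein-Fisher information;
  \<open>stein_fisher_eq\<close> makes it precise.\<close>

definition fish :: "real \<Rightarrow> real \<Rightarrow> real" where "fish t u = \<gamma> u * (u * ((h_du t u)\<^sup>2 / h t u))"

lemma ent_measurable [measurable]:
  assumes [measurable]: "f \<in> borel_measurable M" "g \<in> borel_measurable M"
  shows "(\<lambda>w. ent (f w) (g w)) \<in> borel_measurable M" "(\<lambda>w. ent_dt (f w) (g w)) \<in> borel_measurable M"
    "(\<lambda>w. fish (f w) (g w)) \<in> borel_measurable M"
  unfolding ent_def ent_dt_def fish_def by measurable

context
  fixes t :: real
  assumes t: "0 < t" "t < 1"
begin

lemma Wb_nonneg: "0 \<le> Wb t u"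
  using gam_nonneg[of u] h_le_W[OF t, of u] h_pos[OF t, of u] by (cases "u > 0") (auto simp: Wb_def)

lemma Wb_int: "integrable lborel (Wb t)"
proof (rule integrableI_nonneg)
  obtain C where C: "C \<ge> 0" "(\<integral>\<^sup>+u. ennreal (\<gamma> u * W t u * (1 + u)\<^sup>2) \<partial>lborel) \<le> ennreal C"
    using nn_integral_W_le t by metis
  then show "(\<integral>\<^sup>+u. ennreal (Wb t u) \<partial>lborel) < \<infinity>"
    unfolding Wb_def using le_less_trans ennreal_less_top by (metis infinity_ennreal_def)
qed (use Wb_nonneg in auto)

lemma le_1u: "u \<ge> 0 \<Longrightarrow> 1 + u \<le> (1 + u)\<^sup>2" "u \<ge> 0 \<Longrightarrow> 1 \<le> (1 + u)\<^sup>2" "u \<ge> 0 \<Longrightarrow> u \<le> (1 + u)\<^sup>2" for u :: real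
  by (auto simp: power2_eq_square algebra_simps)

lemma gW_le: 
  assumes "u > 0" "w \<le> (1 + u)\<^sup>2"
  shows "\<gamma> u * W t u * w \<le> Wb t u"
  unfolding Wb_def using assms gam_nonneg[of u] h_le_W[OF t, of u] h_pos[OF t, of u] by (intro mult_left_mono) auto

lemma ln_h_le: "u \<ge> 0 \<Longrightarrow> \<bar>ln (h t u)\<bar> \<le> kL t * (1 + u)"
  unfolding kL_def using t by (intro ln_h_bound) auto

lemma ln_h_le1: "u \<ge> 0 \<Longrightarrow> \<bar>1 + ln (h t u)\<bar> \<le> (1 + kL t) * (1 + u)"
  using ln_h_le[of u] k_nonneg[OF t] by (auto simp: algebra_simps abs_le_iff)

lemma ent_bound: "\<bar>ent t u\<bar> \<le> kL t * Wb t u"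
proof (cases "u > 0")
  case True
  have "\<bar>ent t u\<bar> = \<gamma> u * (h t u * \<bar>ln (h t u)\<bar>)"
    using gam_nonneg h_pos[OF t, of u] True by (simp add: ent_def abs_mult)
  also have "\<dots> \<le> \<gamma> u * (W t u * (kL t * (1 + u)))"
    using gam_nonneg h_pos[OF t, of u] h_le_W[OF t, of u] ln_h_le[of u] True by (intro mult_left_mono mult_mono) auto
  also have "\<dots> = kL t * (\<gamma> u * W t u * (1 + u))" by simp
  also have "\<dots> \<le> kL t * Wb t u"
    using k_nonneg[OF t] True le_1u by (intro mult_left_mono gW_le) auto
  finally show ?thesis .
qed (simp add: ent_def Wb_def)

lemma ent_dt_bound: "\<bar>ent_dt t u\<bar> \<le> (1 + kL t) * kD t * Wb t u"
proof (cases "u > 0")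
  case True
  have "\<bar>ent_dt t u\<bar> = \<gamma> u * (\<bar>1 + ln (h t u)\<bar> * \<bar>h_dt t u\<bar>)"
    using gam_nonneg True by (simp add: ent_dt_def abs_mult)
  also have "\<dots> \<le> \<gamma> u * (((1 + kL t) * (1 + u)) * (kD t * (1 + u) * W t u))"
    unfolding kD_def using gam_nonneg h_dt_bound[OF t, of u] ln_h_le1[of u] True k_nonneg[OF t] by (intro mult_left_mono mult_mono) auto
  also have "\<dots> = (1 + kL t) * kD t * Wb t u" by (simp add: Wb_def power2_eq_square mult_ac)
  finally show ?thesis .
qed (simp add: ent_dt_def Wb_def)

lemma fish_nonneg: "0 \<le> fish t u"
  using gam_nonneg[of u] h_pos[OF t, of u] by (cases "u > 0") (auto simp: fish_def)

lemma fish_bound: "fish t u \<le> (kC t)\<^sup>2 * Wb t u"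
proof (cases "u > 0")
  case True
  have "fish t u \<le> \<gamma> u * (u * ((kC t)\<^sup>2 * W t u))"
    unfolding fish_def kC_def using gam_nonneg h_du_sq_bound[OF t, of u] True by (intro mult_left_mono) auto
  also have "\<dots> = (kC t)\<^sup>2 * (\<gamma> u * W t u * u)" by simp
  also have "\<dots> \<le> (kC t)\<^sup>2 * Wb t u"
    using True le_1u by (intro mult_left_mono gW_le) auto
  finally show ?thesis .
qed (simp add: fish_def Wb_def)

lemma ent_int: "integrable lborel (ent t)"
  by (rule integrable_dominated[OF integrable_mult_right[OF Wb_int, of "kL t"]])
    (use ent_bound Wb_nonneg k_nonneg[OF t] in \<open>auto simp: abs_mult\<close>)

lemma ent_dt_int: "integrable lborel (ent_dt t)"
  by (rule integrable_dominated[OF integrable_mult_right[OF Wb_int, of "(1 + kL t) * kD t"]])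
    (use ent_dt_bound Wb_nonneg k_nonneg[OF t] in \<open>auto simp: abs_mult\<close>)

lemma fish_int: "integrable lborel (fish t)"
  by (rule integrable_dominated[OF integrable_mult_right[OF Wb_int, of "(kC t)\<^sup>2"]])
    (use fish_bound Wb_nonneg fish_nonneg in \<open>auto simp: abs_mult\<close>)

lemma gamma_density_deriv:
  assumes "u > 0"
  shows "(\<gamma> has_real_derivative ((a - 1) / u - l) * \<gamma> u) (at u)"
proof -
  have "((\<lambda>u. l powr a / Gamma a * u powr (a - 1) * exp (- l * u)) has_real_derivative ((a - 1) / u - l) * \<gamma> u) (at u)"
  proof -
    have "((\<lambda>u. u powr (a - 1)) has_real_derivative (a - 1) / u * u powr (a - 1)) (at u)"
      by (rule DERIV_cong[OF has_real_derivative_powr[OF assms]]) (use assms in \<open>simp add: powr_diff power2_eq_square\<close>)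
    moreover have "((\<lambda>u. exp (- l * u)) has_real_derivative - l * exp (- l * u)) (at u)"
      by (auto intro!: derivative_eq_intros)
    ultimately have "((\<lambda>u. l powr a / Gamma a * (u powr (a - 1) * exp (- l * u))) has_real_derivative
       l powr a / Gamma a * ((a - 1) / u * u powr (a - 1) * exp (- l * u) + - l * exp (- l * u) * u powr (a - 1))) (at u)"
      by (intro DERIV_cmult DERIV_mult)
    then have D: "((\<lambda>u. l powr a / Gamma a * u powr (a - 1) * exp (- l * u)) has_real_derivative
       l powr a / Gamma a * ((a - 1) / u * u powr (a - 1) * exp (- l * u) + - l * exp (- l * u) * u powr (a - 1))) (at u)"
      by (simp only: mult.assoc)
    define c where "c = l powr a / Gamma a"
    have "c * ((a - 1) / u * u powr (a - 1) * exp (- l * u) + - l * exp (- l * u) * u powr (a - 1)) = ((a - 1) / u - l) * \<gamma> u"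
      using assms unfolding gamma_density_def c_def[symmetric] by (simp add: algebra_simps)
    then show ?thesis using D unfolding c_def by (rule DERIV_cong[rotated])
  qed
  then show ?thesis
    by (rule has_field_derivative_transform_within_open[where S="{0<..}"]) (use assms in \<open>auto simp: gamma_density_def\<close>)
qed

text \<open>Integration by parts in \<open>u\<close>. In the derivative of \<open>F\<close> the
  drift term of \<open>h_pde\<close> cancels against the derivative of the gamma density, leaving
  \<open>fish - l * t * ent_dt\<close>. The factor \<open>u\<close> in \<open>F\<close> makes
  \<open>F u / u\<close> integrable through the majorant \<open>Wb\<close>.\<close>

lemma fisher_eq_ent_dt: "(\<integral>u. fish t u \<partial>lborel) = l * t * (\<integral>u. ent_dt t u \<partial>lborel)"
proof -
  define F where "F u = (1 + ln (h t u)) * (\<gamma> u * (u * h_du t u))" for u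
  define f where "f u = fish t u - l * t * ent_dt t u" for u
  have "(LINT u:{0<..}|lborel. f u) = 0"
  proof (rule integral_deriv_halfline_eq_0[where F=F])
    fix u :: real assume u: "u > 0"
    have "((\<lambda>u. 1 + ln (h t u)) has_real_derivative h_du t u / h t u) (at u)"
      using h_has_du[OF t u] h_pos[OF t, of u] u by (auto intro!: derivative_eq_intros)
    then show "(F has_real_derivative f u) (at u)"
      unfolding F_def
      by (rule DERIV_cong[OF DERIV_mult[OF _ DERIV_mult[OF gamma_density_deriv[OF u] h_pde[OF t u]]]])
        (use u in \<open>simp add: f_def fish_def ent_dt_def field_simps power2_eq_square\<close>)
  next
    have "integrable lborel f" unfolding f_def using fish_int ent_dt_int by simp
    then show "set_integrable lborel {0<..} f"
      unfolding set_integrable_def by (intro integrable_mult_indicator) auto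
    show "set_integrable lborel {0<..} (\<lambda>u. F u / u)"
      unfolding set_integrable_def
    proof (rule integrable_dominated[OF integrable_mult_right[OF Wb_int, of "(1 + kL t) * kC t"]])
      show "AE u in lborel. norm (indicator {0<..} u *\<^sub>R (F u / u)) \<le> norm ((1 + kL t) * kC t * Wb t u)"
      proof (rule AE_I2)
        fix u :: real
        show "norm (indicator {0<..} u *\<^sub>R (F u / u)) \<le> norm ((1 + kL t) * kC t * Wb t u)"
        proof (cases "u > 0")
          case True
          have "\<bar>h_du t u\<bar> \<le> kC t * (\<integral>x. kern a l t u x * (1 + x) \<partial>\<mu>)"
            unfolding kC_def using True by (intro h_du_bound t) auto
          also have "\<dots> \<le> kC t * W t u"
            using True k_nonneg[OF t] by (intro mult_left_mono kern1_le_W t) auto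
          finally have du: "\<bar>h_du t u\<bar> \<le> kC t * W t u" .
          have "norm (indicator {0<..} u *\<^sub>R (F u / u)) = \<bar>1 + ln (h t u)\<bar> * (\<gamma> u * \<bar>h_du t u\<bar>)"
            using True gam_nonneg by (simp add: F_def abs_mult)
          also have "\<dots> \<le> ((1 + kL t) * (1 + u)) * (\<gamma> u * (kC t * W t u))"
            using True gam_nonneg du k_nonneg[OF t] ln_h_le1[of u] by (intro mult_mono mult_left_mono) auto
          also have "\<dots> = (1 + kL t) * kC t * (\<gamma> u * W t u * (1 + u))" by simp
          also have "\<dots> \<le> (1 + kL t) * kC t * Wb t u"
            using k_nonneg[OF t] True le_1u by (intro mult_left_mono gW_le) auto
          also have "\<dots> \<le> norm ((1 + kL t) * kC t * Wb t u)" by simp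
          finally show ?thesis .
        qed simp
      qed
    qed (simp add: F_def)
  qed
  moreover have "(LINT u:{0<..}|lborel. f u) = (\<integral>u. f u \<partial>lborel)"
    unfolding set_lebesgue_integral_def
    by (intro Bochner_Integration.integral_cong refl) (auto simp: f_def fish_def ent_dt_def indicator_def)
  moreover have "(\<integral>u. f u \<partial>lborel) = (\<integral>u. fish t u \<partial>lborel) - l * t * (\<integral>u. ent_dt t u \<partial>lborel)"
    unfolding f_def using fish_int ent_dt_int by simp
  ultimately show ?thesis by simp
qed

end

definition Ent :: "real \<Rightarrow> real" where "Ent t = (\<integral>u. ent t u \<partial>lborel)"

text \<open>At fixed \<open>u\<close> the fundamental theorem in time gives
  \<open>ent t u - ent s u\<close>; integrating in \<open>u\<close> and exchanging the integrals
  gives the entropy difference. Monotonicity of \<open>Ent\<close> comes from \<open>fish\<close>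
  being nonnegative.\<close>

lemma de_Bruijn:
  assumes s: "0 < s" "s \<le> t" "t < 1"
  shows "(\<integral>\<^sup>+\<tau>\<in>{s..t}. ennreal (1 / (l * \<tau>)) * (\<integral>\<^sup>+u. ennreal (fish \<tau> u) \<partial>lborel) \<partial>lborel) = ennreal (Ent t - Ent s)"
    and "Ent s \<le> Ent t"
proof -
  have t1: "0 < t" "s < 1" using s by auto
  define K where "K = (\<lambda>(\<tau>, u). indicator {s..t} \<tau> * ent_dt \<tau> u)"
  have Km [measurable]: "K \<in> borel_measurable (lborel \<Otimes>\<^sub>M lborel)" unfolding K_def by measurable
  obtain C where C: "C \<ge> 0" "\<And>\<tau>. 0 < \<tau> \<Longrightarrow> \<tau> < 1 \<Longrightarrow> (\<integral>\<^sup>+u. ennreal (Wb \<tau> u) \<partial>lborel) \<le> ennreal C"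
    using nn_integral_W_le unfolding Wb_def by metis
  \<comment> \<open>\<open>kL\<close> and \<open>kD\<close> are nondecreasing in time, so their
    values at the right endpoint give a bound on the whole strip.\<close>
  define c where "c = (1 + kL t) * kD t"
  have c: "0 \<le> c" using k_nonneg[of t] s t1 by (simp add: c_def)
  have Kint: "integrable (lborel \<Otimes>\<^sub>M lborel) K"
  proof (rule integrableI_bounded)
    have "(\<integral>\<^sup>+w. ennreal (norm (K w)) \<partial>(lborel \<Otimes>\<^sub>M lborel)) = (\<integral>\<^sup>+\<tau>. (\<integral>\<^sup>+u. ennreal (norm (K (\<tau>, u))) \<partial>lborel) \<partial>lborel)"
      by (rule lborel.nn_integral_fst[symmetric]) measurable
    also have "\<dots> \<le> (\<integral>\<^sup>+\<tau>. ennreal (c * C) * indicator {s..t} \<tau> \<partial>lborel)"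
    proof (rule nn_integral_mono)
      fix \<tau> :: real
      show "(\<integral>\<^sup>+u. ennreal (norm (K (\<tau>, u))) \<partial>lborel) \<le> ennreal (c * C) * indicator {s..t} \<tau>"
      proof (cases "\<tau> \<in> {s..t}")
        case True
        then have \<tau>: "0 < \<tau>" "\<tau> < 1" "\<tau> \<le> t" using s by auto
        have "(1 + kL \<tau>) * kD \<tau> \<le> c"
          unfolding c_def using k_mono[of \<tau> t] k_nonneg[of \<tau>] k_nonneg[of t] \<tau> s t1 by (intro mult_mono) auto
        then have "(1 + kL \<tau>) * kD \<tau> * Wb \<tau> u \<le> c * Wb \<tau> u" for u
          using Wb_nonneg[of \<tau> u] \<tau> by (intro mult_right_mono) auto
        then have "\<bar>ent_dt \<tau> u\<bar> \<le> c * Wb \<tau> u" for u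
          using ent_dt_bound[of \<tau> u] \<tau> order_trans by blast
        then have "(\<integral>\<^sup>+u. ennreal (norm (K (\<tau>, u))) \<partial>lborel) \<le> (\<integral>\<^sup>+u. ennreal c * ennreal (Wb \<tau> u) \<partial>lborel)"
          using True c Wb_nonneg[of \<tau>] \<tau> by (intro nn_integral_mono) (auto simp: K_def ennreal_mult[symmetric] intro!: ennreal_leI)
        also have "\<dots> = ennreal c * (\<integral>\<^sup>+u. ennreal (Wb \<tau> u) \<partial>lborel)" by (rule nn_integral_cmult) measurable
        also have "\<dots> \<le> ennreal c * ennreal C" using C \<tau> by (intro mult_left_mono) auto
        finally show ?thesis using True c C by (simp add: ennreal_mult)
      qed (simp add: K_def)
    qed
    also have "\<dots> < \<infinity>" using s(2) by (simp add: nn_integral_cmult_indicator ennreal_mult_less_top)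
    finally show "(\<integral>\<^sup>+w. ennreal (norm (K w)) \<partial>(lborel \<Otimes>\<^sub>M lborel)) < \<infinity>" .
  qed simp
  have in_s: "(\<integral>u. K (\<tau>, u) \<partial>lborel) = indicator {s..t} \<tau> * (\<integral>u. ent_dt \<tau> u \<partial>lborel)" for \<tau>
    by (simp add: K_def)
  have Iint: "integrable lborel (\<lambda>\<tau>. \<integral>u. K (\<tau>, u) \<partial>lborel)"
    using lborel_pair.integrable_fst'[OF Kint] .
  have ent_dt_nonneg: "0 \<le> (\<integral>u. ent_dt \<tau> u \<partial>lborel)" if "0 < \<tau>" "\<tau> < 1" for \<tau>
  proof -
    have "0 \<le> (\<integral>u. fish \<tau> u \<partial>lborel)" using fish_nonneg[OF that] by simp
    then have "0 \<le> (l * \<tau>) * (\<integral>u. ent_dt \<tau> u \<partial>lborel)" using fisher_eq_ent_dt[OF that] by simp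
    moreover have "0 < l * \<tau>" using that l by simp
    ultimately show ?thesis using mult_le_cancel_left_pos[of "l * \<tau>" 0] by simp
  qed
  have nonneg: "0 \<le> (\<integral>u. K (\<tau>, u) \<partial>lborel)" for \<tau>
    unfolding in_s using ent_dt_nonneg[of \<tau>] s by (auto simp: indicator_def)
  have eq: "(\<integral>\<tau>. (\<integral>u. K (\<tau>, u) \<partial>lborel) \<partial>lborel) = Ent t - Ent s"
  proof -
    have "(\<integral>\<tau>. (\<integral>u. K (\<tau>, u) \<partial>lborel) \<partial>lborel) = (\<integral>u. (\<integral>\<tau>. K (\<tau>, u) \<partial>lborel) \<partial>lborel)"
      using lborel_pair.Fubini_integral[of "\<lambda>\<tau> u. K (\<tau>, u)"] Kint by (simp add: case_prod_unfold)
    also have "\<dots> = (\<integral>u. ent t u - ent s u \<partial>lborel)"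
    proof (rule integral_cong_AE)
      have "AE u in lborel. integrable lborel (\<lambda>\<tau>. K (\<tau>, u))"
        using lborel_pair.AE_integrable_snd[of "\<lambda>\<tau> u. K (\<tau>, u)"] Kint by (simp add: case_prod_unfold)
      then show "AE u in lborel. (\<integral>\<tau>. K (\<tau>, u) \<partial>lborel) = ent t u - ent s u"
      proof eventually_elim
        case (elim u)
        show ?case
        proof (cases "u > 0")
          case True
          have i: "set_integrable lborel {s..t} (\<lambda>\<tau>. ent_dt \<tau> u)"
            using elim by (simp add: K_def set_integrable_def)
          have "(\<integral>\<tau>. K (\<tau>, u) \<partial>lborel) = (LINT \<tau>:{s..t}|lborel. ent_dt \<tau> u)"
            by (simp add: K_def set_lebesgue_integral_def)
          also have "\<dots> = ent t u - ent s u"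
          proof (rule integral_FTC_interval[OF s(2) _ i])
            fix \<tau> assume "s \<le> \<tau>" "\<tau> \<le> t"
            then have \<tau>: "0 < \<tau>" "\<tau> < 1" using s by auto
            show "((\<lambda>\<tau>. ent \<tau> u) has_real_derivative ent_dt \<tau> u) (at \<tau>)"
              unfolding ent_def ent_dt_def using h_has_dt[OF \<tau> True] h_pos[OF \<tau>, of u] True
              by (auto intro!: derivative_eq_intros simp: algebra_simps)
          qed
          finally show ?thesis .
        qed (simp add: K_def ent_def ent_dt_def)
      qed
    qed measurable
    also have "\<dots> = Ent t - Ent s"
      unfolding Ent_def using ent_int[of t] ent_int[of s] s t1 by simp
    finally show ?thesis .
  qed
  then show "Ent s \<le> Ent t" using Bochner_Integration.integral_nonneg[of lborel "\<lambda>\<tau>. \<integral>u. K (\<tau>, u) \<partial>lborel"] nonneg by simp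
  have "(\<integral>\<^sup>+\<tau>\<in>{s..t}. ennreal (1 / (l * \<tau>)) * (\<integral>\<^sup>+u. ennreal (fish \<tau> u) \<partial>lborel) \<partial>lborel)
     = (\<integral>\<^sup>+\<tau>. ennreal (\<integral>u. K (\<tau>, u) \<partial>lborel) \<partial>lborel)"
  proof (rule nn_integral_cong)
    fix \<tau> :: real
    show "ennreal (1 / (l * \<tau>)) * (\<integral>\<^sup>+u. ennreal (fish \<tau> u) \<partial>lborel) * indicator {s..t} \<tau> = ennreal (\<integral>u. K (\<tau>, u) \<partial>lborel)"
    proof (cases "\<tau> \<in> {s..t}")
      case True
      then have \<tau>: "0 < \<tau>" "\<tau> < 1" using s by auto
      have "(\<integral>\<^sup>+u. ennreal (fish \<tau> u) \<partial>lborel) = ennreal (\<integral>u. fish \<tau> u \<partial>lborel)"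
        using fish_int[OF \<tau>] fish_nonneg[OF \<tau>] by (intro nn_integral_eq_integral) auto
      also have "\<dots> = ennreal (l * \<tau> * (\<integral>u. ent_dt \<tau> u \<partial>lborel))" using fisher_eq_ent_dt[OF \<tau>] by simp
      finally have "ennreal (1 / (l * \<tau>)) * (\<integral>\<^sup>+u. ennreal (fish \<tau> u) \<partial>lborel) = ennreal (1 / (l * \<tau>) * (l * \<tau> * (\<integral>u. ent_dt \<tau> u \<partial>lborel)))"
        using \<tau> l ent_dt_nonneg[OF \<tau>] by (subst ennreal_mult) auto
      then show ?thesis using True \<tau> l by (simp add: in_s)
    qed (simp add: in_s)
  qed
  also have "\<dots> = ennreal (\<integral>\<tau>. (\<integral>u. K (\<tau>, u) \<partial>lborel) \<partial>lborel)"
    using nonneg by (intro nn_integral_eq_integral[OF Iint] AE_I2)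
  finally show "(\<integral>\<^sup>+\<tau>\<in>{s..t}. ennreal (1 / (l * \<tau>)) * (\<integral>\<^sup>+u. ennreal (fish \<tau> u) \<partial>lborel) \<partial>lborel) = ennreal (Ent t - Ent s)"
    unfolding eq .
qed

end

section \<open>Entropy and Stein--Fisher information along the path\<close>

text \<open>A convex function lies above its tangent, here at \<open>c\<close>. Taking
  \<open>c\<close> to be a mean and integrating gives Jensen's inequality, \<open>c = 1\<close>
  gives nonnegativity of the entropy, and \<open>c = exp \<psi>\<close> the dual inequality. At
  \<open>y = 0\<close> the product is 0 whatever \<open>ln 0\<close> is.\<close>

lemma ln_mult_ge_tangent:
  fixes c y :: real
  assumes "c > 0" "y \<ge> 0"
  shows "c * ln c + (1 + ln c) * (y - c) \<le> y * ln y"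
proof (cases "y = 0")
  case False
  then have y: "y > 0" using assms by simp
  have "ln (c / y) \<le> c / y - 1" using assms y by (intro ln_le_minus_one) auto
  then have "y * ln (c / y) \<le> y * (c / y - 1)" using y by (intro mult_left_mono) auto
  then have "y * ln c - y * ln y \<le> c - y" using y assms by (simp add: ln_div algebra_simps)
  then show ?thesis by (simp add: algebra_simps)
qed (simp add: algebra_simps assms less_imp_le)

context smart_path begin

lemma nn_integral_path:
  assumes t: "0 < t" "t < 1" and "w \<in> borel_measurable borel"
  shows "(\<integral>\<^sup>+u. ennreal (\<gamma> u * h t u) * w u \<partial>lborel)
     = (\<integral>\<^sup>+x. (\<integral>\<^sup>+u. ennreal (p t u x) * w u \<partial>lborel) \<partial>\<mu>)"
  using nn_integral_gamma_kern_integral[OF t, of "\<lambda>_. 1" w] kern_int[OF t] assms(3) by (simp add: h_def)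

lemma gamma_integral: "integrable lborel \<gamma>" "(\<integral>u. \<gamma> u \<partial>lborel) = 1"
  using nn_integral_gamma_density[OF a0 l] gam_nonneg
    nn_integral_eq_integrable[of \<gamma> lborel 1] by (auto simp: ennreal_1[symmetric] simp del: ennreal_1)

text \<open>An unnormalised posterior mean: \<open>post s u / h s u\<close> is the conditional
  expectation of the starting point given that the path at time \<open>s\<close> is at
  \<open>u\<close>.\<close>

definition post :: "real \<Rightarrow> real \<Rightarrow> real" where "post s u = (\<integral>x. kern a l s u x * x \<partial>\<mu>)"

context
  fixes t :: real
  assumes t: "0 < t" "t < 1"
begin

lemma gh_nonneg: "0 \<le> \<gamma> u * h t u"
  using gam_nonneg[of u] h_pos[OF t, of u] by (cases "u > 0") auto

lemma path_mass: "integrable lborel (\<lambda>u. \<gamma> u * h t u)" "(\<integral>u. \<gamma> u * h t u \<partial>lborel) = 1"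
proof -
  have "(\<integral>\<^sup>+u. ennreal (\<gamma> u * h t u) * 1 \<partial>lborel) = (\<integral>\<^sup>+x. 1 \<partial>\<mu>)"
  proof (subst nn_integral_path[OF t], simp, rule nn_integral_cong_AE, use pos in eventually_elim)
    case (elim x)
    then show ?case using gamma_kern_mass[OF a0 l, of t x] t by simp
  qed
  then have "(\<integral>\<^sup>+u. ennreal (\<gamma> u * h t u) \<partial>lborel) = ennreal 1" by (simp add: emeasure_space_1[simplified])
  then show "integrable lborel (\<lambda>u. \<gamma> u * h t u)" "(\<integral>u. \<gamma> u * h t u \<partial>lborel) = 1"
    using nn_integral_eq_integrable[of "\<lambda>u. \<gamma> u * h t u" lborel 1] gh_nonneg by auto
qed

text \<open>From \<open>x\<close> the mean moves to \<open>(1 - t) * a / l + t * x\<close>, a convex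
  combination with the gamma mean; averaging over starting points of mean \<open>a / l\<close>
  leaves it fixed.\<close>

lemma path_mean: "integrable lborel (\<lambda>u. \<gamma> u * h t u * u)" "(\<integral>u. \<gamma> u * h t u * u \<partial>lborel) = a / l"
proof -
  have "(\<integral>\<^sup>+u. ennreal (\<gamma> u * h t u * u) \<partial>lborel) = (\<integral>\<^sup>+u. ennreal (\<gamma> u * h t u) * ennreal u \<partial>lborel)"
  proof (rule nn_integral_cong)
    fix u show "ennreal (\<gamma> u * h t u * u) = ennreal (\<gamma> u * h t u) * ennreal u"
      using gh_nonneg[of u] by (cases "u > 0") (auto simp: ennreal_mult)
  qed
  also have "\<dots> = (\<integral>\<^sup>+x. ennreal ((1 - t) * a / l + t * x) \<partial>\<mu>)"
  proof (subst nn_integral_path[OF t], simp, rule nn_integral_cong_AE, use pos in eventually_elim)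
    case (elim x)
    then show ?case using gamma_kern_mean[OF a0 l, of t x] t by simp
  qed
  also have "\<dots> = ennreal (\<integral>x. (1 - t) * a / l + t * x \<partial>\<mu>)"
  proof (rule nn_integral_eq_integral)
    show "AE x in \<mu>. 0 \<le> (1 - t) * a / l + t * x"
      using pos by eventually_elim (use a0 l t in auto)
  qed (use int_x in auto)
  also have "(\<integral>x. (1 - t) * a / l + t * x \<partial>\<mu>) = a / l"
    using int_x mean by (simp add: diff_divide_distrib[symmetric] add_divide_distrib[symmetric] algebra_simps)
  finally have "(\<integral>\<^sup>+u. ennreal (\<gamma> u * h t u * u) \<partial>lborel) = ennreal (a / l)" .
  moreover have "0 \<le> \<gamma> u * h t u * u" for u using gh_nonneg[of u] by (cases "u > 0") auto
  ultimately show "integrable lborel (\<lambda>u. \<gamma> u * h t u * u)" "(\<integral>u. \<gamma> u * h t u * u \<partial>lborel) = a / l"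
    using nn_integral_eq_integrable[of "\<lambda>u. \<gamma> u * h t u * u" lborel "a / l"] a0 l by auto
qed

lemma kern_x_int: "u \<ge> 0 \<Longrightarrow> integrable \<mu> (\<lambda>x. kern a l t u x * x)"
  using integrable_minus[OF kern_int1[OF t, of u] kern_int[OF t, of u]]
  by (simp add: algebra_simps)

lemma path_post: "integrable lborel (\<lambda>u. \<gamma> u * post t u)" "(\<integral>u. \<gamma> u * post t u \<partial>lborel) = a / l"
proof -
  have [measurable]: "post t \<in> borel_measurable borel"
    unfolding post_def[abs_def] by (intro borel_measurable_lebesgue_integral) (simp add: case_prod_unfold)
  have "(\<integral>\<^sup>+u. ennreal (\<gamma> u * post t u) * 1 \<partial>lborel) = (\<integral>\<^sup>+x. ennreal x * (\<integral>\<^sup>+u. ennreal (p t u x) * 1 \<partial>lborel) \<partial>\<mu>)"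
    unfolding post_def using kern_x_int by (intro nn_integral_gamma_kern_integral t) auto
  also have "\<dots> = (\<integral>\<^sup>+x. ennreal x \<partial>\<mu>)"
    by (rule nn_integral_cong_AE, use pos in eventually_elim) (use gamma_kern_mass[OF a0 l, of t] t in simp)
  also have "\<dots> = ennreal (a / l)"
    using int_x pos mean by (subst nn_integral_eq_integral) (auto elim: eventually_mono)
  finally have "(\<integral>\<^sup>+u. ennreal (\<gamma> u * post t u) \<partial>lborel) = ennreal (a / l)" by simp
  moreover have "0 \<le> \<gamma> u * post t u" for u
  proof (cases "u > 0")
    case True
    have "AE x in \<mu>. 0 \<le> kern a l t u x * x"
      using pos by eventually_elim (use kern_pos[OF a l t] True in \<open>auto simp: less_imp_le\<close>)
    then show ?thesis unfolding post_def using gam_nonneg by (intro mult_nonneg_nonneg integral_nonneg_AE)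
  qed simp
  ultimately show "integrable lborel (\<lambda>u. \<gamma> u * post t u)" "(\<integral>u. \<gamma> u * post t u \<partial>lborel) = a / l"
    using nn_integral_eq_integrable[of "\<lambda>u. \<gamma> u * post t u" lborel "a / l"] a0 l by auto
qed

lemma Ent_nonneg: "0 \<le> Ent t"
proof -
  have "(\<integral>u. \<gamma> u * h t u - \<gamma> u \<partial>lborel) \<le> Ent t"
    unfolding Ent_def
  proof (rule integral_mono_AE)
    show "AE u in lborel. \<gamma> u * h t u - \<gamma> u \<le> ent t u"
    proof (rule AE_I2)
      fix u :: real
      show "\<gamma> u * h t u - \<gamma> u \<le> ent t u"
      proof (cases "u > 0")
        case True
        have "h t u - 1 \<le> h t u * ln (h t u)"
          using ln_mult_ge_tangent[of 1 "h t u"] h_pos[OF t, of u] True by simp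
        then have "\<gamma> u * (h t u - 1) \<le> \<gamma> u * (h t u * ln (h t u))" using gam_nonneg by (intro mult_left_mono)
        then show ?thesis by (simp add: ent_def algebra_simps)
      qed (simp add: ent_def)
    qed
  qed (use path_mass gamma_integral ent_int[OF t] in auto)
  then show ?thesis using path_mass gamma_integral by simp
qed

text \<open>As \<open>h\<close> is a mixture of kernels, \<open>h * ln h\<close> is at most the
  mixture of \<open>kern * ln kern\<close>; this is the tangent inequality at
  \<open>c = h t u\<close>. Then \<open>ln_kern_le\<close> applies, and its terms in
  \<open>x\<close> and in \<open>u\<close> each have mean \<open>a / l\<close>, whence the factor
  2.\<close>

lemma Ent_le: "Ent t \<le> - a * ln (1 - t) + sqrt (kB l t) * (2 * a / l)"
proof -
  define L S where "L = - a * ln (1 - t)" and "S = sqrt (kB l t)"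
  have "Ent t \<le> (\<integral>u. L * (\<gamma> u * h t u) + S * (\<gamma> u * h t u * u) + S * (\<gamma> u * post t u) \<partial>lborel)"
    unfolding Ent_def
  proof (rule integral_mono_AE)
    show "AE u in lborel. ent t u \<le> L * (\<gamma> u * h t u) + S * (\<gamma> u * h t u * u) + S * (\<gamma> u * post t u)"
    proof (rule AE_I2)
      fix u :: real
      show "ent t u \<le> L * (\<gamma> u * h t u) + S * (\<gamma> u * h t u * u) + S * (\<gamma> u * post t u)"
      proof (cases "u > 0")
        case True
        define c where "c = h t u"
        have c: "c > 0" using h_pos[OF t, of u] True by (simp add: c_def)
        have k: "integrable \<mu> (\<lambda>x. kern a l t u x)" "integrable \<mu> (\<lambda>x. kern a l t u x * x)"
          using kern_int[OF t, of u] kern_x_int[of u] True by auto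
        have "(\<integral>x. c * ln c + (1 + ln c) * (kern a l t u x - c) \<partial>\<mu>)
          \<le> (\<integral>x. (L + S * u) * kern a l t u x + S * (kern a l t u x * x) \<partial>\<mu>)"
        proof (rule integral_mono_AE)
          show "AE x in \<mu>. c * ln c + (1 + ln c) * (kern a l t u x - c) \<le> (L + S * u) * kern a l t u x + S * (kern a l t u x * x)"
            using pos
          proof eventually_elim
            case (elim x)
            have kp: "0 < kern a l t u x" using kern_pos[OF a l t] elim True by simp
            have "kern a l t u x * ln (kern a l t u x) \<le> kern a l t u x * (L + S * (x + u))"
              using ln_kern_le[OF a l t, of x u] elim True kp unfolding L_def S_def by (intro mult_left_mono) auto
            then show ?case using ln_mult_ge_tangent[OF c, of "kern a l t u x"] kp by (simp add: algebra_simps)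
          qed
        qed (use k in auto)
        also have "(\<integral>x. (L + S * u) * kern a l t u x + S * (kern a l t u x * x) \<partial>\<mu>) = (L + S * u) * c + S * post t u"
          using k by (simp add: c_def h_def post_def)
        also have "(\<integral>x. c * ln c + (1 + ln c) * (kern a l t u x - c) \<partial>\<mu>) = c * ln c"
          using k by (simp add: c_def h_def)
        finally have "\<gamma> u * (c * ln c) \<le> \<gamma> u * ((L + S * u) * c + S * post t u)"
          using gam_nonneg by (intro mult_left_mono)
        then show ?thesis by (simp add: ent_def c_def algebra_simps)
      qed (simp add: ent_def)
    qed
  qed (use path_mass path_mean path_post ent_int[OF t] in auto)
  also have "\<dots> = L + S * (2 * a / l)"
    using path_mass path_mean path_post by simp
  finally show ?thesis by (simp add: L_def S_def)
qed

lemma smart_path_density: "smart_path_law a l \<mu> t = density lborel (\<lambda>u. ennreal (indicator {0<..} u * (\<gamma> u * h t u)))"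
proof -
  have "smart_path_law a l \<mu> t = density lborel (\<lambda>u. \<integral>\<^sup>+x. ennreal (p t u x) \<partial>\<mu>)"
    by (rule smart_path_law_eq[OF a0 l t _ sets_mu pos]) (unfold_locales)
  also have "(\<lambda>u. \<integral>\<^sup>+x. ennreal (p t u x) \<partial>\<mu>) = (\<lambda>u. ennreal (indicator {0<..} u * (\<gamma> u * h t u)))"
    using ennreal_gamma_kern_integral[OF t, of "\<lambda>_. 1"] kern_int[OF t] by (auto simp: fun_eq_iff h_def indicator_def)
  finally show ?thesis .
qed

text \<open>The definition picks some differentiable density by \<open>SOME\<close>. It can only be
  \<open>\<gamma> * h\<close> on the positive axis, because densities of one law agree almost
  everywhere and both are continuous there; hence also the derivatives agree.\<close>

lemma stein_fisher_eq: "stein_fisher_gamma a l (smart_path_law a l \<mu> t) = (\<integral>\<^sup>+u. ennreal (fish t u) \<partial>lborel)"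
proof -
  define \<nu> where "\<nu> = smart_path_law a l \<mu> t"
  define f0 where "f0 u = \<gamma> u * h t u" for u
  have f0m [measurable]: "f0 \<in> borel_measurable borel" unfolding f0_def[abs_def] by measurable
  have f0_pos: "0 < f0 u" if "u > 0" for u
    using gamma_density_pos[OF a0 l that] h_pos[OF t, of u] that by (simp add: f0_def)
  have f0_D: "(f0 has_real_derivative (((a - 1) / u - l) * f0 u + \<gamma> u * h_du t u)) (at u)" if "u > 0" for u
    unfolding f0_def
    by (rule DERIV_cong[OF DERIV_mult[OF gamma_density_deriv[OF t that] h_has_du[OF t that]]]) (simp add: algebra_simps)
  have d0: "diff_pos_density \<nu> f0"
    unfolding diff_pos_density_def using f0_pos f0_D real_differentiable_def
    by (auto simp: \<nu>_def smart_path_density f0_def)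
  define f where "f = (SOME f. diff_pos_density \<nu> f)"
  have d: "diff_pos_density \<nu> f" unfolding f_def by (rule someI[where P="diff_pos_density \<nu>", OF d0])
  have f_pos: "0 < f u" and f_diff: "f differentiable (at u)" if "u > 0" for u
    using d that by (auto simp: diff_pos_density_def)
  have f_cont: "continuous_on {0<..} f"
    using f_diff by (intro continuous_at_imp_continuous_on ballI differentiable_imp_continuous_within) auto
  have f0_cont: "continuous_on {0<..} f0"
    using f0_D by (intro continuous_at_imp_continuous_on) (auto intro: DERIV_isCont)
  have [measurable]: "(\<lambda>u. indicator {0<..} u * f u) \<in> borel_measurable borel"
  proof -
    have "(\<lambda>u. indicator {0<..} u *\<^sub>R f u) \<in> borel_measurable borel"
      using f_cont by (intro borel_measurable_continuous_on_indicator) auto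
    then show ?thesis by simp
  qed
  have "density lborel (\<lambda>u. ennreal (indicator {0<..} u * f u)) = density lborel (\<lambda>u. ennreal (indicator {0<..} u * f0 u))"
    using d d0 by (auto simp: diff_pos_density_def)
  then have "AE u in lborel. ennreal (indicator {0<..} u * f u) = ennreal (indicator {0<..} u * f0 u)"
    by (intro sigma_finite_measure.density_unique[OF lborel.sigma_finite_measure_axioms]) auto
  then have AEeq: "AE u in lborel. \<not> (u \<in> {0<..} \<and> f u - f0 u \<noteq> 0)"
  proof eventually_elim
    case (elim u)
    then show ?case using f_pos[of u] f0_pos[of u] by (auto simp: ennreal_inj)
  qed
  \<comment> \<open>The set of disagreement is open by continuity and null by uniqueness of
    densities, so it is empty.\<close>
  define U where "U = {u \<in> {0<..}. f u - f0 u \<noteq> 0}"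
  have "open U"
  proof -
    have "open ((\<lambda>u. f u - f0 u) -` (- {0}) \<inter> {0<..})"
      using continuous_on_diff[OF f_cont f0_cont] by (subst (asm) continuous_on_open_vimage) auto
    moreover have "(\<lambda>u. f u - f0 u) -` (- {0}) \<inter> {0<..} = U" by (auto simp: U_def)
    ultimately show ?thesis by simp
  qed
  moreover have "negligible U"
  proof -
    have "U \<in> null_sets lborel"
    proof -
      have "AE u in lborel. u \<notin> U" using AEeq by (simp add: U_def)
      then show ?thesis using AE_iff_null_sets[of U lborel] \<open>open U\<close> by simp
    qed
    then have "U \<in> null_sets lebesgue" by (rule null_sets_completionI)
    then show ?thesis by (simp add: negligible_iff_null_sets)
  qed
  ultimately have "U = {}" using open_not_negligible by blast
  then have eq: "f u = f0 u" if "u > 0" for u using that by (auto simp: U_def)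
  have "stein_fisher_gamma a l \<nu> = (\<integral>\<^sup>+u\<in>{0<..}. ennreal (f u * (u * (deriv (\<lambda>v. ln (f v)) u - (a - 1) / u + l)\<^sup>2)) \<partial>lborel)"
    unfolding stein_fisher_gamma_def using d0 by (auto simp: f_def Let_def)
  also have "\<dots> = (\<integral>\<^sup>+u. ennreal (fish t u) \<partial>lborel)"
  proof (rule nn_integral_cong)
    fix u :: real
    show "ennreal (f u * (u * (deriv (\<lambda>v. ln (f v)) u - (a - 1) / u + l)\<^sup>2)) * indicator {0<..} u = ennreal (fish t u)"
    proof (cases "u > 0")
      case True
      have D: "((\<lambda>v. ln (f0 v)) has_real_derivative (((a - 1) / u - l) * f0 u + \<gamma> u * h_du t u) / f0 u) (at u)"
        using f0_D[OF True] f0_pos[OF True] by (auto intro!: derivative_eq_intros)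
      have "((\<lambda>v. ln (f v)) has_real_derivative (((a - 1) / u - l) * f0 u + \<gamma> u * h_du t u) / f0 u) (at u)"
        by (rule has_field_derivative_transform_within_open[OF D, where S="{0<..}"]) (use True eq in auto)
      then have "deriv (\<lambda>v. ln (f v)) u = (((a - 1) / u - l) * f0 u + \<gamma> u * h_du t u) / f0 u"
        by (rule DERIV_imp_deriv)
      also have "\<dots> = (a - 1) / u - l + h_du t u / h t u"
        using h_pos[OF t, of u] True gamma_density_pos[OF a0 l True] by (simp add: f0_def add_divide_distrib)
      finally have "deriv (\<lambda>v. ln (f v)) u - (a - 1) / u + l = h_du t u / h t u" by simp
      then show ?thesis
        using True h_pos[OF t, of u] by (simp add: eq f0_def fish_def power2_eq_square)
    qed (simp add: fish_def)
  qed
  finally show ?thesis by (simp add: \<nu>_def)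
qed

end

section \<open>Lower semicontinuity at the end of the path\<close>

lemma gamma_kern_moments:
  assumes t: "0 < t" "t < 1" and x: "x \<ge> 0"
  shows "integrable lborel (\<lambda>u. p t u x)" "(\<integral>u. p t u x \<partial>lborel) = 1"
    and "integrable lborel (\<lambda>u. p t u x * (u - x)\<^sup>2)"
    and "(\<integral>u. p t u x * (u - x)\<^sup>2 \<partial>lborel)
      = ((1 - t) * (a / l - x))\<^sup>2 + (1 - t)\<^sup>2 * a / l\<^sup>2 + 2 * t * (1 - t) * x / l"
proof -
  have nn: "0 \<le> p t u x" for u
    using kern_pos[OF a l t x, of u] gam_nonneg[of u] by (cases "u > 0") auto
  have nn1: "0 \<le> p t u x * u" for u using nn[of u] by (cases "u > 0") auto
  define m1 m2 where "m1 = (1 - t) * a / l + t * x"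
    and "m2 = m1\<^sup>2 + (1 - t)\<^sup>2 * a / l\<^sup>2 + 2 * t * (1 - t) * x / l"
  have m: "0 \<le> m1" "0 \<le> m2" using a0 l t x by (auto simp: m1_def m2_def)
  have t': "0 \<le> t" using t by simp
  have 0: "integrable lborel (\<lambda>u. p t u x)" "(\<integral>u. p t u x \<partial>lborel) = 1"
    using nn_integral_eq_integrable[of "\<lambda>u. p t u x" lborel 1] nn gamma_kern_mass[OF a0 l t' t(2) x] by auto
  then show "integrable lborel (\<lambda>u. p t u x)" "(\<integral>u. p t u x \<partial>lborel) = 1" .
  have "(\<integral>\<^sup>+u. ennreal (p t u x * u) \<partial>lborel) = (\<integral>\<^sup>+u. ennreal (p t u x) * ennreal u \<partial>lborel)"
  proof (rule nn_integral_cong)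
    fix u show "ennreal (p t u x * u) = ennreal (p t u x) * ennreal u"
      using nn[of u] by (cases "u > 0") (auto simp: ennreal_mult)
  qed
  then have 1: "integrable lborel (\<lambda>u. p t u x * u)" "(\<integral>u. p t u x * u \<partial>lborel) = m1"
    using nn_integral_eq_integrable[of "\<lambda>u. p t u x * u" lborel m1] nn1 m gamma_kern_mean[OF a0 l t' t(2) x] by (auto simp: m1_def)
  have "(\<integral>\<^sup>+u. ennreal (p t u x * u\<^sup>2) \<partial>lborel) = (\<integral>\<^sup>+u. ennreal (p t u x) * ennreal (u\<^sup>2) \<partial>lborel)"
    using nn by (intro nn_integral_cong) (simp add: ennreal_mult)
  then have 2: "integrable lborel (\<lambda>u. p t u x * u\<^sup>2)" "(\<integral>u. p t u x * u\<^sup>2 \<partial>lborel) = m2"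
    using nn_integral_eq_integrable[of "\<lambda>u. p t u x * u\<^sup>2" lborel m2] nn m gamma_kern_moment2[OF a0 l t' t(2) x]
    by (auto simp: m1_def m2_def)
  have eq: "(\<lambda>u. p t u x * (u - x)\<^sup>2) =
     (\<lambda>u. p t u x * u\<^sup>2 - 2 * x * (p t u x * u) + x\<^sup>2 * (p t u x))"
    by (simp add: fun_eq_iff power2_eq_square algebra_simps)
  show "integrable lborel (\<lambda>u. p t u x * (u - x)\<^sup>2)"
    unfolding eq using 0 1 2 by simp
  have "(\<integral>u. p t u x * (u - x)\<^sup>2 \<partial>lborel) = m2 - 2 * x * m1 + x\<^sup>2"
    unfolding eq using 0 1 2 by simp
  also have "\<dots> = (m1 - x)\<^sup>2 + (1 - t)\<^sup>2 * a / l\<^sup>2 + 2 * t * (1 - t) * x / l"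
    by (simp add: m2_def power2_eq_square algebra_simps)
  also have "m1 - x = (1 - t) * (a / l - x)" by (simp add: m1_def algebra_simps)
  finally show "(\<integral>u. p t u x * (u - x)\<^sup>2 \<partial>lborel)
      = ((1 - t) * (a / l - x))\<^sup>2 + (1 - t)\<^sup>2 * a / l\<^sup>2 + 2 * t * (1 - t) * x / l" .
qed

text \<open>Starting at 1/2 ensures \<open>1 - T n \<le> T n\<close>, so that the intervals
  \<open>{1 - T n..T n}\<close> increase to the open unit interval in
  \<open>entropy_identity\<close>.\<close>

definition T :: "nat \<Rightarrow> real" where "T n = 1 - inverse (real (Suc (Suc n)))"

lemma T_bounds: "0 < T n" "T n < 1"
  by (auto simp: T_def field_simps)

lemma T_mono: "m \<le> n \<Longrightarrow> T m \<le> T n"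
  by (simp add: T_def frac_le inverse_eq_divide)

lemma T_lim: "T \<longlonglongrightarrow> 1"
proof -
  have "(\<lambda>n. 1 - inverse (real (Suc (Suc n)))) \<longlonglongrightarrow> 1 - 0"
    by (intro tendsto_intros LIMSEQ_Suc[OF LIMSEQ_inverse_real_of_nat])
  then show ?thesis by (simp add: T_def[abs_def])
qed

text \<open>Chebyshev's argument: within distance \<open>d\<close> of \<open>x\<close> continuity
  gives \<open>e / 2\<close>, farther away \<open>2 * B\<close> is at most
  \<open>2 * B * (u - x)^2 / d^2\<close>, and the second moment \<open>V\<close> of the kernel about
  \<open>x\<close> tends to 0.\<close>

lemma gamma_kern_weak:
  assumes x: "x > 0" and cont: "isCont \<psi> x" and bnd: "\<And>u. \<bar>\<psi> u\<bar> \<le> B"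
    and [measurable]: "\<psi> \<in> borel_measurable borel"
  shows "(\<lambda>n. \<integral>u. p (T n) u x * \<psi> u \<partial>lborel) \<longlonglongrightarrow> \<psi> x"
proof (rule LIMSEQ_I)
  fix e :: real assume e: "e > 0"
  have B: "0 \<le> B" using bnd[of 0] by linarith
  obtain d where d: "d > 0" "\<And>u. \<bar>u - x\<bar> < d \<Longrightarrow> \<bar>\<psi> u - \<psi> x\<bar> < e / 2"
  proof -
    have "\<exists>d>0. \<forall>u. dist u x < d \<longrightarrow> dist (\<psi> u) (\<psi> x) < e / 2"
      using cont half_gt_zero[OF e] unfolding continuous_at_eps_delta by blast
    then show ?thesis using that by (auto simp only: dist_real_def)
  qed
  define V where "V t = ((1 - t) * (a / l - x))\<^sup>2 + (1 - t)\<^sup>2 * a / l\<^sup>2 + 2 * t * (1 - t) * x / l" for t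
  have "(\<lambda>n. V (T n)) \<longlonglongrightarrow> ((1 - 1) * (a / l - x))\<^sup>2 + (1 - 1)\<^sup>2 * a / l\<^sup>2 + 2 * 1 * (1 - 1) * x / l"
    unfolding V_def using l by (intro tendsto_intros T_lim) auto
  then have "(\<lambda>n. 2 * B / d\<^sup>2 * V (T n)) \<longlonglongrightarrow> 2 * B / d\<^sup>2 * 0"
    by (intro tendsto_mult_left) simp
  then have "\<forall>\<^sub>F n in sequentially. 2 * B / d\<^sup>2 * V (T n) < e / 2"
    using e by (intro order_tendstoD(2)[where y="2 * B / d\<^sup>2 * 0"]) auto
  then obtain N where N: "\<And>n. n \<ge> N \<Longrightarrow> 2 * B / d\<^sup>2 * V (T n) < e / 2"
    by (auto simp: eventually_sequentially)
  have pt: "\<bar>\<psi> u - \<psi> x\<bar> \<le> e / 2 + 2 * B / d\<^sup>2 * (u - x)\<^sup>2" for u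
  proof (cases "\<bar>u - x\<bar> < d")
    case True
    have "0 \<le> 2 * B / d\<^sup>2 * (u - x)\<^sup>2" using B by simp
    then show ?thesis using d(2)[OF True] by linarith
  next
    case False
    then have "d\<^sup>2 \<le> (u - x)\<^sup>2" using d(1) abs_le_square_iff[of d "u - x"] by simp
    then have "2 * B * 1 \<le> 2 * B * ((u - x)\<^sup>2 / d\<^sup>2)" using B d(1) by (intro mult_left_mono) auto
    moreover have "\<bar>\<psi> u - \<psi> x\<bar> \<le> 2 * B" using bnd[of u] bnd[of x] by linarith
    ultimately show ?thesis using e by simp
  qed
  show "\<exists>N. \<forall>n\<ge>N. norm ((\<integral>u. p (T n) u x * \<psi> u \<partial>lborel) - \<psi> x) < e"
  proof (intro exI allI impI)
    fix n assume n: "N \<le> n"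
    let ?k = "\<lambda>u. p (T n) u x"
    have x0: "x \<ge> 0" using x by simp
    note mom = gamma_kern_moments[OF T_bounds[of n] x0]
    have nn: "0 \<le> ?k u" for u by (rule trans_nonneg[OF T_bounds x])
    have int: "integrable lborel (\<lambda>u. ?k u * \<psi> u)"
    proof (rule integrable_dominated[OF integrable_mult_right[OF mom(1), of B]])
      show "AE u in lborel. norm (?k u * \<psi> u) \<le> norm (B * ?k u)"
      proof (rule AE_I2)
        fix u show "norm (?k u * \<psi> u) \<le> norm (B * ?k u)"
          unfolding real_norm_def abs_mult[of "?k u"] abs_mult[of B] abs_of_nonneg[OF B] mult.commute[of B]
          by (rule mult_left_mono[OF bnd abs_ge_zero])
      qed
    qed measurable
    have diff: "(\<integral>u. ?k u * \<psi> u \<partial>lborel) - \<psi> x = (\<integral>u. ?k u * \<psi> u - \<psi> x * ?k u \<partial>lborel)"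
      using int mom by simp
    have "\<bar>\<integral>u. ?k u * \<psi> u - \<psi> x * ?k u \<partial>lborel\<bar> \<le> (\<integral>u. e / 2 * ?k u + 2 * B / d\<^sup>2 * (?k u * (u - x)\<^sup>2) \<partial>lborel)"
    proof (rule order_trans[OF integral_abs_bound integral_mono_AE])
      show "AE u in lborel. \<bar>?k u * \<psi> u - \<psi> x * ?k u\<bar> \<le> e / 2 * ?k u + 2 * B / d\<^sup>2 * (?k u * (u - x)\<^sup>2)"
      proof (rule AE_I2)
        fix u
        have "\<bar>?k u * \<psi> u - \<psi> x * ?k u\<bar> = ?k u * \<bar>\<psi> u - \<psi> x\<bar>"
        proof -
          have "?k u * \<psi> u - \<psi> x * ?k u = ?k u * (\<psi> u - \<psi> x)" by (simp add: algebra_simps)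
          then show ?thesis by (simp only: abs_mult[of "?k u" "\<psi> u - \<psi> x"] abs_of_nonneg[OF nn[of u]])
        qed
        also have "\<dots> \<le> ?k u * (e / 2 + 2 * B / d\<^sup>2 * (u - x)\<^sup>2)"
          using pt nn by (intro mult_left_mono)
        finally show "\<bar>?k u * \<psi> u - \<psi> x * ?k u\<bar> \<le> e / 2 * ?k u + 2 * B / d\<^sup>2 * (?k u * (u - x)\<^sup>2)"
          by (simp add: algebra_simps)
      qed
      show "integrable lborel (\<lambda>u. \<bar>?k u * \<psi> u - \<psi> x * ?k u\<bar>)"
        by (intro integrable_abs integrable_minus integrable_mult_right int mom)
      show "integrable lborel (\<lambda>u. e / 2 * ?k u + 2 * B / d\<^sup>2 * (?k u * (u - x)\<^sup>2))"
        by (intro Bochner_Integration.integrable_add integrable_mult_right mom)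
    qed
    also have "\<dots> = (\<integral>u. e / 2 * ?k u \<partial>lborel) + (\<integral>u. 2 * B / d\<^sup>2 * (?k u * (u - x)\<^sup>2) \<partial>lborel)"
      by (rule Bochner_Integration.integral_add[OF integrable_mult_right[OF mom(1)] integrable_mult_right[OF mom(3)]])
    also have "\<dots> = e / 2 * (\<integral>u. ?k u \<partial>lborel) + 2 * B / d\<^sup>2 * (\<integral>u. ?k u * (u - x)\<^sup>2 \<partial>lborel)"
      by (simp only: integral_mult_right_zero)
    also have "\<dots> = e / 2 + 2 * B / d\<^sup>2 * V (T n)"
      by (simp only: mom(2) mom(4) V_def mult_1_right)
    also have "\<dots> < e" using N[OF n] by simp
    finally show "norm ((\<integral>u. ?k u * \<psi> u \<partial>lborel) - \<psi> x) < e"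
      unfolding diff real_norm_def .
  qed
qed

text \<open>The path converges weakly to its initial law as time tends to 1: after exchanging the
  integrals, the kernel averages converge at each starting point and are dominated by
  \<open>B\<close>.\<close>

lemma path_weak:
  assumes cont: "continuous_on UNIV \<psi>" and bnd: "\<And>u. \<bar>\<psi> u\<bar> \<le> B"
  shows "(\<lambda>n. \<integral>u. \<gamma> u * h (T n) u * \<psi> u \<partial>lborel) \<longlonglongrightarrow> (\<integral>x. \<psi> x \<partial>\<mu>)"
proof -
  have B: "0 \<le> B" using bnd[of 0] by linarith
  have [measurable]: "\<psi> \<in> borel_measurable borel" using cont by (rule borel_measurable_continuous_onI)
  interpret P: pair_sigma_finite \<mu> lborel by unfold_locales
  let ?P = "\<lambda>n x. \<integral>u. p (T n) u x * \<psi> u \<partial>lborel"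
  note nn = trans_nonneg[OF T_bounds]
  have Pb: "(\<integral>\<^sup>+u. ennreal (norm (p (T n) u x * \<psi> u)) \<partial>lborel) \<le> ennreal B" if x: "x > 0" for n x
  proof -
    have "(\<integral>\<^sup>+u. ennreal (norm (p (T n) u x * \<psi> u)) \<partial>lborel) \<le> (\<integral>\<^sup>+u. ennreal B * ennreal (p (T n) u x) \<partial>lborel)"
    proof (rule nn_integral_mono)
      fix u
      have "norm (p (T n) u x * \<psi> u) \<le> B * (p (T n) u x)"
        unfolding norm_mult[of _ "\<psi> u"] using nn[OF x, of u n] bnd[of u] by (simp add: abs_of_nonneg mult.commute mult_right_mono)
      then show "ennreal (norm (p (T n) u x * \<psi> u)) \<le> ennreal B * ennreal (p (T n) u x)"
        using B nn[OF x, of u n] by (simp add: ennreal_mult[symmetric] ennreal_leI)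
    qed
    also have "\<dots> = ennreal B"
      using gamma_kern_mass[OF a0 l, of "T n" x] T_bounds[of n] x by (subst nn_integral_cmult) auto
    finally show ?thesis .
  qed
  have swap: "(\<integral>u. \<gamma> u * h (T n) u * \<psi> u \<partial>lborel) = (\<integral>x. ?P n x \<partial>\<mu>)" for n
  proof -
    have "integrable (\<mu> \<Otimes>\<^sub>M lborel) (\<lambda>(x, u). p (T n) u x * \<psi> u)"
    proof (rule integrableI_bounded)
      show "(\<lambda>(x, u). p (T n) u x * \<psi> u) \<in> borel_measurable (\<mu> \<Otimes>\<^sub>M lborel)"
        by (simp add: case_prod_unfold)
      then have "(\<integral>\<^sup>+w. ennreal (norm (case w of (x, u) \<Rightarrow> p (T n) u x * \<psi> u)) \<partial>(\<mu> \<Otimes>\<^sub>M lborel))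
        = (\<integral>\<^sup>+x. (\<integral>\<^sup>+u. ennreal (norm (p (T n) u x * \<psi> u)) \<partial>lborel) \<partial>\<mu>)"
        by (subst lborel.nn_integral_fst[symmetric]) (auto simp: case_prod_unfold)
      also have "\<dots> \<le> (\<integral>\<^sup>+x. ennreal B \<partial>\<mu>)"
        by (rule nn_integral_mono_AE, use pos in eventually_elim) (rule Pb)
      also have "\<dots> < \<infinity>" by (simp add: emeasure_space_1[simplified])
      finally show "(\<integral>\<^sup>+w. ennreal (norm (case w of (x, u) \<Rightarrow> p (T n) u x * \<psi> u)) \<partial>(\<mu> \<Otimes>\<^sub>M lborel)) < \<infinity>" .
    qed
    then have "(\<integral>x. ?P n x \<partial>\<mu>) = (\<integral>u. (\<integral>x. p (T n) u x * \<psi> u \<partial>\<mu>) \<partial>lborel)"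
      by (rule P.Fubini_integral[symmetric])
    then show ?thesis by (simp add: h_def)
  qed
  have "(\<lambda>n. \<integral>x. ?P n x \<partial>\<mu>) \<longlonglongrightarrow> (\<integral>x. \<psi> x \<partial>\<mu>)"
  proof (rule integral_dominated_convergence[where w="\<lambda>_. B"])
    show "AE x in \<mu>. (\<lambda>n. ?P n x) \<longlonglongrightarrow> \<psi> x"
      using pos by eventually_elim
        (use cont bnd in \<open>auto intro!: gamma_kern_weak simp: continuous_on_eq_continuous_at\<close>)
    show "AE x in \<mu>. norm (?P n x) \<le> B" for n
      using pos
    proof eventually_elim
      case (elim x)
      have "ennreal (norm (?P n x)) \<le> (\<integral>\<^sup>+u. ennreal (norm (p (T n) u x * \<psi> u)) \<partial>lborel)"
      proof (cases "integrable lborel (\<lambda>u. p (T n) u x * \<psi> u)")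
        case True
        then show ?thesis by (rule integral_norm_bound_ennreal)
      qed (simp add: not_integrable_integral_eq)
      also have "\<dots> \<le> ennreal B" by (rule Pb[OF elim])
      finally show ?case using B by simp
    qed
    show "(\<lambda>x. ?P n x) \<in> borel_measurable \<mu>" for n
      by (intro lborel.borel_measurable_lebesgue_integral) (simp add: case_prod_unfold)
  qed auto
  then show ?thesis unfolding swap .
qed

section \<open>Dual bounds and their passage to the limit\<close>

lemma Ent_variational:
  assumes t: "0 < t" "t < 1" and [measurable]: "\<psi> \<in> borel_measurable borel" and bnd: "\<And>u. \<bar>\<psi> u\<bar> \<le> B"
  shows "(\<integral>u. \<gamma> u * h t u * \<psi> u \<partial>lborel) - (\<integral>u. \<gamma> u * exp (\<psi> u) \<partial>lborel) + 1 \<le> Ent t"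
proof -
  have B: "0 \<le> B" using bnd[of 0] by linarith
  have i1: "integrable lborel (\<lambda>u. \<gamma> u * h t u * \<psi> u)"
  proof (rule integrable_dominated[OF integrable_mult_right[OF path_mass(1)[OF t], of B]])
    show "AE u in lborel. norm (\<gamma> u * h t u * \<psi> u) \<le> norm (B * (\<gamma> u * h t u))"
    proof (rule AE_I2)
      fix u
      show "norm (\<gamma> u * h t u * \<psi> u) \<le> norm (B * (\<gamma> u * h t u))"
        using mult_left_mono[OF bnd[of u] abs_ge_zero[of "\<gamma> u * h t u"]] B by (simp add: abs_mult mult_ac)
    qed
  qed measurable
  have i2: "integrable lborel (\<lambda>u. \<gamma> u * exp (\<psi> u))"
  proof (rule integrable_dominated[OF integrable_mult_right[OF gamma_integral(1), of "exp B"]])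
    show "AE u in lborel. norm (\<gamma> u * exp (\<psi> u)) \<le> norm (exp B * \<gamma> u)"
    proof (rule AE_I2)
      fix u
      have e: "exp (\<psi> u) \<le> exp B" using bnd[of u] by simp
      show "norm (\<gamma> u * exp (\<psi> u)) \<le> norm (exp B * \<gamma> u)"
        using mult_right_mono[OF e gam_nonneg[of u]] gam_nonneg[of u] by (simp add: abs_mult mult.commute)
    qed
  qed measurable
  have "(\<integral>u. \<gamma> u * h t u * \<psi> u - \<gamma> u * exp (\<psi> u) + \<gamma> u * h t u \<partial>lborel) \<le> Ent t"
    unfolding Ent_def
  proof (rule integral_mono_AE)
    show "AE u in lborel. \<gamma> u * h t u * \<psi> u - \<gamma> u * exp (\<psi> u) + \<gamma> u * h t u \<le> ent t u"
    proof (rule AE_I2)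
      fix u :: real
      show "\<gamma> u * h t u * \<psi> u - \<gamma> u * exp (\<psi> u) + \<gamma> u * h t u \<le> ent t u"
      proof (cases "u > 0")
        case True
        have "h t u * \<psi> u - exp (\<psi> u) + h t u \<le> h t u * ln (h t u)"
          using ln_mult_ge_tangent[of "exp (\<psi> u)" "h t u"] h_pos[OF t, of u] True by (simp add: algebra_simps)
        then have "\<gamma> u * (h t u * \<psi> u - exp (\<psi> u) + h t u) \<le> \<gamma> u * (h t u * ln (h t u))"
          using gam_nonneg by (intro mult_left_mono)
        then show ?thesis by (simp add: ent_def algebra_simps)
      qed (simp add: ent_def)
    qed
  qed (use i1 i2 path_mass[OF t] ent_int[OF t] in auto)
  then show ?thesis using i1 i2 path_mass[OF t] by simp
qed

abbreviation dual :: "(real \<Rightarrow> real) \<Rightarrow> real" where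
  "dual \<psi> \<equiv> (\<integral>x. \<psi> x \<partial>\<mu>) - (\<integral>u. \<gamma> u * exp (\<psi> u) \<partial>lborel) + 1"

lemma lsc_continuous:
  assumes S: "\<And>n. Ent (T n) \<le> S" and cont: "continuous_on UNIV \<psi>" and bnd: "\<And>u. \<bar>\<psi> u\<bar> \<le> B"
  shows "dual \<psi> \<le> S"
proof (rule LIMSEQ_le_const2)
  show "(\<lambda>n. (\<integral>u. \<gamma> u * h (T n) u * \<psi> u \<partial>lborel) - (\<integral>u. \<gamma> u * exp (\<psi> u) \<partial>lborel) + 1)
    \<longlonglongrightarrow> dual \<psi>"
    by (intro tendsto_intros path_weak[OF cont bnd])
  have m: "\<psi> \<in> borel_measurable borel" using cont by (rule borel_measurable_continuous_onI)
  show "\<exists>N. \<forall>n\<ge>N. (\<integral>u. \<gamma> u * h (T n) u * \<psi> u \<partial>lborel) - (\<integral>u. \<gamma> u * exp (\<psi> u) \<partial>lborel) + 1 \<le> S"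
    by (intro exI[of _ 0] allI impI order_trans[OF Ent_variational[OF T_bounds m bnd] S])
qed

text \<open>Convergence is required almost everywhere for both measures, since one integral is taken
  under \<open>\<mu>\<close> and the other under the gamma law, and absolute continuity of
  \<open>\<mu>\<close> is itself derived from this lemma.\<close>

lemma lsc_limit:
  assumes S: "\<And>n. Ent (T n) \<le> S"
    and cont: "\<And>k::nat. continuous_on UNIV (\<psi>' k)" and bnd: "\<And>k u. \<bar>\<psi>' k u\<bar> \<le> B"
    and [measurable]: "\<psi> \<in> borel_measurable borel"
    and lim_mu: "AE x in \<mu>. (\<lambda>k. \<psi>' k x) \<longlonglongrightarrow> \<psi> x"
    and lim_leb: "AE x in lborel. (\<lambda>k. \<psi>' k x) \<longlonglongrightarrow> \<psi> x"
  shows "dual \<psi> \<le> S"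
proof (rule LIMSEQ_le_const2)
  have [measurable]: "\<psi>' k \<in> borel_measurable borel" for k using cont by (rule borel_measurable_continuous_onI)
  have 1: "(\<lambda>k. \<integral>x. \<psi>' k x \<partial>\<mu>) \<longlonglongrightarrow> (\<integral>x. \<psi> x \<partial>\<mu>)"
    using bnd lim_mu by (intro integral_dominated_convergence[where w="\<lambda>_. B"]) auto
  have 2: "(\<lambda>k. \<integral>u. \<gamma> u * exp (\<psi>' k u) \<partial>lborel) \<longlonglongrightarrow> (\<integral>u. \<gamma> u * exp (\<psi> u) \<partial>lborel)"
  proof (rule integral_dominated_convergence[where w="\<lambda>u. exp B * \<gamma> u"])
    show "AE u in lborel. (\<lambda>k. \<gamma> u * exp (\<psi>' k u)) \<longlonglongrightarrow> \<gamma> u * exp (\<psi> u)"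
      using lim_leb by eventually_elim (intro tendsto_intros)
    show "AE u in lborel. norm (\<gamma> u * exp (\<psi>' k u)) \<le> exp B * \<gamma> u" for k
    proof (rule AE_I2)
      fix u
      have e: "exp (\<psi>' k u) \<le> exp B" using bnd[of k u] by simp
      show "norm (\<gamma> u * exp (\<psi>' k u)) \<le> exp B * \<gamma> u"
        using mult_right_mono[OF e gam_nonneg[of u]] gam_nonneg[of u] by (simp add: abs_mult mult.commute)
    qed
  qed (use gamma_integral in auto)
  show "(\<lambda>k. dual (\<psi>' k))
    \<longlonglongrightarrow> dual \<psi>"
    by (intro tendsto_intros 1 2)
  show "\<exists>N. \<forall>k\<ge>N. dual (\<psi>' k) \<le> S"
    by (intro exI[of _ 0] allI impI lsc_continuous[OF S cont bnd])
qed

text \<open>Take the test function \<open>c\<close> times the indicator of a compact Lebesgue-null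
  set \<open>K\<close>. The exponential integral does not see \<open>K\<close>, so
  \<open>c * prob K \<le> S\<close> for every \<open>c \<ge> 0\<close>, which forces
  \<open>prob K = 0\<close>. Inner regularity passes from compact sets to all null sets.\<close>

lemma abs_continuous:
  assumes S: "\<And>n. Ent (T n) \<le> S"
  shows "absolutely_continuous lborel \<mu>"
  unfolding absolutely_continuous_def
proof
  fix N :: "real set" assume N: "N \<in> null_sets lborel"
  have K0: "emeasure \<mu> K = 0" if K: "K \<subseteq> N" "compact K" for K
  proof (cases "K = {}")
    case False
    have cK: "closed K" using K compact_imp_closed by blast
    have [measurable]: "K \<in> sets borel" using cK by simp
    have AEK: "AE x in lborel. x \<notin> K"
      using AE_not_in[OF N] by eventually_elim (use K in auto)
    have bound: "c * prob K \<le> S" if c: "c \<ge> 0" for c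
    proof -
      \<comment> \<open>Continuous functions decreasing to \<open>c\<close> times the indicator of
        \<open>K\<close>: off the closed set \<open>K\<close> the distance is positive, so they are
        eventually 0.\<close>
      define \<psi>' where "\<psi>' k x = c * max 0 (1 - real k * infdist x K)" for k x
      have "(\<integral>x. c * indicator K x \<partial>\<mu>) - (\<integral>u. \<gamma> u * exp (c * indicator K u) \<partial>lborel) + 1 \<le> S"
      proof (rule lsc_limit[where \<psi>'=\<psi>' and B=c, OF S])
        show "continuous_on UNIV (\<psi>' k)" for k
          unfolding \<psi>'_def by (intro continuous_intros)
        show "\<bar>\<psi>' k u\<bar> \<le> c" for k u
          using c mult_left_mono[of "max 0 (1 - real k * infdist u K)" 1 c] infdist_nonneg[of u K]
          by (auto simp: \<psi>'_def abs_mult)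
        have lim: "(\<lambda>k. \<psi>' k x) \<longlonglongrightarrow> c * indicator K x" for x
        proof (cases "x \<in> K")
          case True
          then show ?thesis by (simp add: \<psi>'_def)
        next
          case False
          then have d: "infdist x K > 0"
            using in_closed_iff_infdist_zero[OF cK \<open>K \<noteq> {}\<close>] infdist_nonneg[of x K] by (simp add: less_le)
          obtain k0 :: nat where k0: "1 / infdist x K < real k0" using reals_Archimedean2 by blast
          have "\<psi>' k x = 0" if "k \<ge> k0" for k
          proof -
            have "1 / infdist x K \<le> real k" using that k0 by linarith
            then have "1 \<le> real k * infdist x K" using d by (simp add: field_simps)
            then show ?thesis by (simp add: \<psi>'_def)
          qed
          then have "\<forall>\<^sub>F k in sequentially. \<psi>' k x = 0" by (auto simp: eventually_sequentially)
          then show ?thesis using False by (simp add: tendsto_eventually)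
        qed
        show "AE x in \<mu>. (\<lambda>k. \<psi>' k x) \<longlonglongrightarrow> c * indicator K x" "AE x in lborel. (\<lambda>k. \<psi>' k x) \<longlonglongrightarrow> c * indicator K x"
          using lim by auto
      qed measurable
      moreover have "(\<integral>u. \<gamma> u * exp (c * indicator K u) \<partial>lborel) = (\<integral>u. \<gamma> u \<partial>lborel)"
        using AEK by (intro integral_cong_AE) (auto elim: eventually_mono)
      moreover have "(\<integral>x. c * indicator K x \<partial>\<mu>) = c * prob K" by simp
      ultimately show ?thesis using gamma_integral by simp
    qed
    have "prob K = 0"
    proof (rule ccontr)
      assume "prob K \<noteq> 0"
      then have p: "prob K > 0" by (simp add: less_le)
      have "(\<bar>S\<bar> + 1) / prob K * prob K \<le> S" using p by (intro bound) auto
      then show False using p by simp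
    qed
    then show ?thesis by (simp add: emeasure_eq_measure)
  qed simp
  have "emeasure \<mu> N = (SUP K \<in> {K. K \<subseteq> N \<and> compact K}. emeasure \<mu> K)"
  proof (rule inner_regular[OF sets_mu])
    show "emeasure \<mu> (space \<mu>) \<noteq> \<infinity>" by (simp only: emeasure_space_1) simp
    show "N \<in> sets borel" using null_setsD2[OF N] by simp
  qed
  also have "\<dots> \<le> 0" by (intro SUP_least) (simp add: K0)
  finally have "emeasure \<mu> N = 0" by simp
  then show "N \<in> null_sets \<mu>" using null_setsD2[OF N] sets_mu by (intro null_setsI) auto
qed

text \<open>A Lebesgue measurable function is a limit of continuous ones off a negligible set, which
  is also null for \<open>\<mu>\<close> by \<open>abs_continuous\<close>. Clamping to
  \<open>{- B..B}\<close> keeps the approximants bounded and does not change the limit.\<close>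

lemma lsc_measurable:
  assumes S: "\<And>n. Ent (T n) \<le> S" and \<psi> [measurable]: "\<psi> \<in> borel_measurable borel"
    and bnd: "\<And>u. \<bar>\<psi> u\<bar> \<le> B"
  shows "dual \<psi> \<le> S"
proof -
  have B: "0 \<le> B" using bnd[of 0] by linarith
  have "\<psi> \<in> borel_measurable lebesgue"
    using \<psi> by (simp add: measurable_completion)
  then have "\<psi> measurable_on UNIV" by (intro lebesgue_measurable_imp_measurable_on) auto
  then obtain N g where N: "negligible N" and g: "\<And>n. continuous_on UNIV (g n)"
    and lim: "\<And>x. x \<notin> N \<Longrightarrow> (\<lambda>n. g n x) \<longlonglongrightarrow> \<psi> x"
    unfolding measurable_on_def by auto
  have "AE x in lebesgue. x \<notin> N"
    using N by (intro AE_not_in) (simp add: negligible_iff_null_sets)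
  then have AE1: "AE x in lborel. x \<notin> N" by (simp add: AE_completion_iff)
  have AE2: "AE x in \<mu>. x \<notin> N"
    by (rule absolutely_continuous_AE[OF _ abs_continuous[OF S] AE1]) (simp add: sets_mu)
  have clamp: "(\<lambda>n. max (- B) (min B (g n x))) \<longlonglongrightarrow> \<psi> x" if "x \<notin> N" for x
  proof -
    have "(\<lambda>n. max (- B) (min B (g n x))) \<longlonglongrightarrow> max (- B) (min B (\<psi> x))"
      by (intro tendsto_intros lim that)
    also have "max (- B) (min B (\<psi> x)) = \<psi> x" using bnd[of x] by (auto simp: abs_le_iff)
    finally show ?thesis .
  qed
  show ?thesis
  proof (rule lsc_limit[where \<psi>'="\<lambda>n x. max (- B) (min B (g n x))" and B=B, OF S])
    show "continuous_on UNIV (\<lambda>x. max (- B) (min B (g n x)))" for n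
      by (intro continuous_intros g)
    show "\<bar>max (- B) (min B (g n u))\<bar> \<le> B" for n u using B by (auto simp: abs_le_iff)
    show "AE x in \<mu>. (\<lambda>n. max (- B) (min B (g n x))) \<longlonglongrightarrow> \<psi> x"
      using AE2 by eventually_elim (rule clamp)
    show "AE x in lborel. (\<lambda>n. max (- B) (min B (g n x))) \<longlonglongrightarrow> \<psi> x"
      using AE1 by eventually_elim (rule clamp)
  qed (rule \<psi>)
qed

abbreviation dens :: "(real \<Rightarrow> real) \<Rightarrow> bool" where
  "dens f \<equiv> f \<in> borel_measurable borel \<and> (\<forall>u. 0 \<le> f u) \<and> \<mu> = density lborel (\<lambda>u. ennreal (f u))"

lemma density_if_bounded:
  assumes S: "\<And>n. Ent (T n) \<le> S"
  shows "Ex dens"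
proof -
  have ac: "absolutely_continuous lborel \<mu>" using S by (rule abs_continuous)
  obtain D where D: "D \<in> borel_measurable lborel" "AE x in lborel. RN_deriv lborel \<mu> x = ennreal (D x)" "\<And>x. 0 \<le> D x"
    using sigma_finite_measure.real_RN_deriv[OF lborel.sigma_finite_measure_axioms finite_measure_axioms ac] sets_mu sets_lborel by metis
  have "\<mu> = density lborel (RN_deriv lborel \<mu>)"
    using sigma_finite_measure.density_RN_deriv[OF lborel.sigma_finite_measure_axioms ac] sets_mu by simp
  also have "\<dots> = density lborel (\<lambda>u. ennreal (D u))"
    using D by (intro density_cong) auto
  finally show ?thesis using D by auto
qed

section \<open>The entropy integral of an initial law with density \<open>f\<close>\<close>

context
  fixes f :: "real \<Rightarrow> real"
  assumes f [measurable]: "f \<in> borel_measurable borel" and f_nonneg: "\<And>u. 0 \<le> f u"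
    and dens: "\<mu> = density lborel (\<lambda>u. ennreal (f u))"
begin

lemma f_pos_AE: "AE x in lborel. f x > 0 \<longrightarrow> x > 0"
proof -
  have "AE x in density lborel (\<lambda>u. ennreal (f u)). x > 0" by (subst dens[symmetric]) (rule pos)
  then show ?thesis by (subst (asm) AE_density) (auto elim!: eventually_mono)
qed

lemma integrable_mu_iff: "w \<in> borel_measurable borel \<Longrightarrow> integrable \<mu> w \<longleftrightarrow> integrable lborel (\<lambda>x. f x * w x)"
  by (subst dens, subst integrable_density) (auto simp: f_nonneg)

lemma integral_mu_eq: "w \<in> borel_measurable borel \<Longrightarrow> (\<integral>x. w x \<partial>\<mu>) = (\<integral>x. f x * w x \<partial>lborel)"
  for w :: "real \<Rightarrow> real"
  by (subst dens, subst integral_density) (auto simp: f_nonneg)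

lemma f_int: "integrable lborel f" "(\<integral>x. f x \<partial>lborel) = 1"
  using integrable_mu_iff[of "\<lambda>_. 1"] integral_mu_eq[of "\<lambda>_. 1"] by auto

definition eta :: "real \<Rightarrow> real" where "eta u = indicator {0<..} u * (f u * ln (f u / \<gamma> u))"

lemma eta_measurable [measurable]: "eta \<in> borel_measurable borel"
  unfolding eta_def[abs_def] by measurable

lemma eta_eq: "u > 0 \<Longrightarrow> eta u = \<gamma> u * (f u / \<gamma> u * ln (f u / \<gamma> u))"
  using gamma_density_pos[OF a0 l, of u] by (simp add: eta_def)

lemma eta_ge: "f u - \<gamma> u \<le> eta u \<or> u \<le> 0"
proof (cases "u > 0")
  case True
  have g: "\<gamma> u > 0" using gamma_density_pos[OF a0 l True] .
  have "f u / \<gamma> u - 1 \<le> f u / \<gamma> u * ln (f u / \<gamma> u)"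
    using ln_mult_ge_tangent[of 1 "f u / \<gamma> u"] g f_nonneg[of u] by simp
  then have "\<gamma> u * (f u / \<gamma> u - 1) \<le> eta u"
    unfolding eta_eq[OF True] using g by (intro mult_left_mono) auto
  then show ?thesis using g by (simp add: right_diff_distrib)
qed auto

text \<open>Thus the negative part of the entropy integrand is integrable whatever the density, and
  the entropy is well defined, possibly as plus infinity.\<close>

lemma eta_neg_le: "max 0 (- eta u) \<le> \<gamma> u"
proof (cases "u > 0")
  case True
  then show ?thesis using eta_ge[of u] f_nonneg[of u] gam_nonneg[of u] by auto
qed (simp add: eta_def gam_nonneg)

lemma eta_neg_int: "integrable lborel (\<lambda>u. max 0 (- eta u))"
  by (rule integrable_dominated[OF gamma_integral(1)])
    (use eta_neg_le gam_nonneg in auto)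

text \<open>Data processing: the kernel \<open>kern t u x * \<gamma> x\<close> is a probability density in \<open>x\<close>, so
  Jensen's inequality for \<open>y ln y\<close> applies, and it is one in \<open>u\<close> as well, by symmetry.\<close>

lemma Ent_le_entropy:
  assumes t: "0 < t" "t < 1" and eta_int: "integrable lborel eta"
  shows "Ent t \<le> (\<integral>u. eta u \<partial>lborel)"
proof -
  define q where "q u = (\<integral>x. kern a l t u x * eta x \<partial>lborel)" for u
  have eta0: "eta x = 0" if "\<not> x > 0" for x using that by (simp add: eta_def)
  have kpos: "0 < kern a l t u x" if "u > 0" "x > 0" for u x using kern_pos[OF a l t, of x u] that by simp
  have kint: "integrable lborel (\<lambda>x. kern a l t u x * eta x)" if u: "u > 0" for u
  proof (rule integrable_dominated[OF integrable_mult_right[OF eta_int, of "(1 - t) powr (- a) * exp (l * u)"]])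
    show "AE x in lborel. norm (kern a l t u x * eta x) \<le> norm ((1 - t) powr (- a) * exp (l * u) * eta x)"
    proof (rule AE_I2)
      fix x :: real
      show "norm (kern a l t u x * eta x) \<le> norm ((1 - t) powr (- a) * exp (l * u) * eta x)"
      proof (cases "x > 0")
        case True
        have "\<bar>kern a l t u x\<bar> \<le> \<bar>(1 - t) powr (- a) * exp (l * u)\<bar>"
          using kern_le[OF a l t, of x u] kpos[OF u True] u True by simp
        then show ?thesis
          unfolding real_norm_def abs_mult[of "kern a l t u x"] abs_mult[of "(1 - t) powr (- a) * exp (l * u)"]
          by (intro mult_right_mono) auto
      qed (simp add: eta0)
    qed
  qed measurable
  have jensen: "ent t u \<le> \<gamma> u * q u" for u
  proof (cases "u > 0")
    case True
    define c where "c = h t u"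
    have c: "c > 0" using h_pos[OF t, of u] True by (simp add: c_def)
    have k1: "integrable lborel (\<lambda>x. \<gamma> x * kern a l t u x)" "(\<integral>x. \<gamma> x * kern a l t u x \<partial>lborel) = 1"
      using gamma_kern_moments(1,2)[OF t, of u] True by (simp_all add: kern_sym[of a l t u])
    have k2: "integrable lborel (\<lambda>x. f x * kern a l t u x)" "(\<integral>x. f x * kern a l t u x \<partial>lborel) = c"
      using kern_int[OF t, of u] integrable_mu_iff[of "kern a l t u"] integral_mu_eq[of "kern a l t u"] True
      by (auto simp: c_def h_def)
    \<comment> \<open>The tangent inequality at \<open>c = h t u\<close>, integrated against the
      probability density \<open>\<gamma> x * kern a l t u x\<close>. The slope term vanishes
      because \<open>f x * kern a l t u x\<close> integrates to \<open>c\<close>.\<close>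
    have "(\<integral>x. c * ln c * (\<gamma> x * kern a l t u x) + (1 + ln c) * (f x * kern a l t u x - c * (\<gamma> x * kern a l t u x)) \<partial>lborel) \<le> q u"
      unfolding q_def
    proof (rule integral_mono_AE)
      show "AE x in lborel. c * ln c * (\<gamma> x * kern a l t u x) + (1 + ln c) * (f x * kern a l t u x - c * (\<gamma> x * kern a l t u x)) \<le> kern a l t u x * eta x"
        using f_pos_AE
      proof eventually_elim
        case (elim x)
        show ?case
        proof (cases "x > 0")
          case xp: True
          have g: "\<gamma> x > 0" using gamma_density_pos[OF a0 l xp] .
          have "c * ln c + (1 + ln c) * (f x / \<gamma> x - c) \<le> f x / \<gamma> x * ln (f x / \<gamma> x)"
            using g f_nonneg[of x] by (intro ln_mult_ge_tangent c) auto
          then have "kern a l t u x * (\<gamma> x * (c * ln c + (1 + ln c) * (f x / \<gamma> x - c))) \<le> kern a l t u x * eta x"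
            unfolding eta_eq[OF xp] using g kpos[OF True xp] by (intro mult_left_mono) auto
          moreover have "\<gamma> x * (c * ln c + (1 + ln c) * (f x / \<gamma> x - c)) = c * ln c * \<gamma> x + (1 + ln c) * (f x - c * \<gamma> x)"
            using g by (simp add: field_simps)
          ultimately have "kern a l t u x * (c * ln c * \<gamma> x + (1 + ln c) * (f x - c * \<gamma> x)) \<le> kern a l t u x * eta x"
            by (simp only:)
          then show ?thesis by (simp add: algebra_simps)
        next
          case False
          then show ?thesis using elim f_nonneg[of x] eta0[OF False] by simp
        qed
      qed
    qed (use k1 k2 kint[OF True] in auto)
    also have "(\<integral>x. c * ln c * (\<gamma> x * kern a l t u x) + (1 + ln c) * (f x * kern a l t u x - c * (\<gamma> x * kern a l t u x)) \<partial>lborel) = c * ln c"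
      using k1 k2 by simp
    finally show ?thesis unfolding ent_def c_def using gam_nonneg by (intro mult_left_mono)
  qed (simp add: ent_def)
  have Pint: "integrable (lborel \<Otimes>\<^sub>M lborel) (\<lambda>(x, u). p t u x * eta x)"
  proof (rule integrableI_bounded)
    show "(\<lambda>(x, u). p t u x * eta x) \<in> borel_measurable (lborel \<Otimes>\<^sub>M lborel)"
      by (simp add: case_prod_unfold)
    then have "(\<integral>\<^sup>+w. ennreal (norm (case w of (x, u) \<Rightarrow> p t u x * eta x)) \<partial>(lborel \<Otimes>\<^sub>M lborel))
      = (\<integral>\<^sup>+x. (\<integral>\<^sup>+u. ennreal (norm (p t u x * eta x)) \<partial>lborel) \<partial>lborel)"
      by (subst lborel.nn_integral_fst[symmetric]) (auto simp: case_prod_unfold)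
    also have "\<dots> = (\<integral>\<^sup>+x. ennreal (norm (eta x)) \<partial>lborel)"
    proof (rule nn_integral_cong)
      fix x :: real
      show "(\<integral>\<^sup>+u. ennreal (norm (p t u x * eta x)) \<partial>lborel) = ennreal (norm (eta x))"
      proof (cases "x > 0")
        case True
        have "(\<integral>\<^sup>+u. ennreal (norm (p t u x * eta x)) \<partial>lborel) = (\<integral>\<^sup>+u. ennreal (p t u x) * ennreal (norm (eta x)) \<partial>lborel)"
        proof (rule nn_integral_cong)
          fix u :: real
          have "0 \<le> p t u x" by (rule trans_nonneg[OF t True])
          then show "ennreal (norm (p t u x * eta x)) = ennreal (p t u x) * ennreal (norm (eta x))"
          proof -
            assume nn: "0 \<le> p t u x"
            have "norm (p t u x * eta x) = p t u x * norm (eta x)"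
              unfolding real_norm_def abs_mult[of "p t u x"] abs_of_nonneg[OF nn] ..
            then show ?thesis using nn by (simp only: ennreal_mult[OF nn norm_ge_zero])
          qed
        qed
        also have "\<dots> = ennreal (norm (eta x))"
          using gamma_kern_mass[OF a0 l, of t x] t True by (subst nn_integral_multc) auto
        finally show ?thesis .
      qed (simp add: eta0)
    qed
    also have "\<dots> < \<infinity>" using eta_int by (simp add: integrable_iff_bounded)
    finally show "(\<integral>\<^sup>+w. ennreal (norm (case w of (x, u) \<Rightarrow> p t u x * eta x)) \<partial>(lborel \<Otimes>\<^sub>M lborel)) < \<infinity>" .
  qed
  have q_eq: "(\<integral>x. p t u x * eta x \<partial>lborel) = \<gamma> u * q u" for u
    by (simp add: q_def mult.assoc)
  have "integrable lborel (\<lambda>u. \<gamma> u * q u)"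
    using lborel_pair.integrable_snd[OF Pint] by (simp add: q_eq)
  then have "Ent t \<le> (\<integral>u. \<gamma> u * q u \<partial>lborel)"
    unfolding Ent_def by (intro integral_mono ent_int[OF t] jensen)
  also have "\<dots> = (\<integral>x. (\<integral>u. p t u x * eta x \<partial>lborel) \<partial>lborel)"
    using lborel_pair.Fubini_integral[OF Pint] by (simp only: q_eq)
  also have "\<dots> = (\<integral>x. eta x \<partial>lborel)"
  proof (rule Bochner_Integration.integral_cong[OF refl])
    fix x :: real
    show "(\<integral>u. p t u x * eta x \<partial>lborel) = eta x"
    proof (cases "x > 0")
      case True
      then show ?thesis using gamma_kern_moments(2)[OF t, of x] by simp
    qed (simp add: eta0)
  qed
  finally show ?thesis .
qed

text \<open>The optimal test function is \<open>ln (f / \<gamma>)\<close>; truncated to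
  \<open>{- n..n}\<close> it is admissible in \<open>lsc_measurable\<close>. This bounds the
  truncated positive part \<open>r n\<close> up to an error \<open>exp (- n)\<close>, and Fatou's
  lemma removes the truncation.\<close>

lemma entropy_le_of_bounded:
  assumes S: "\<And>n. Ent (T n) \<le> S"
  shows "(\<integral>\<^sup>+u. ennreal (max 0 (eta u)) \<partial>lborel) \<le> ennreal (S + (\<integral>u. max 0 (- eta u) \<partial>lborel))"
proof -
  define Q where "Q = (\<integral>u. max 0 (- eta u) \<partial>lborel)"
  define r where "r n u = indicator {0<..} u * (f u * min (real n) (max 0 (ln (f u / \<gamma> u))))" for n u
  have pm [measurable]: "r n \<in> borel_measurable borel" for n unfolding r_def[abs_def] by measurable
  have p_nonneg: "0 \<le> r n u" for n u using f_nonneg[of u] by (auto simp: r_def)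
  have p_int: "integrable lborel (r n)" for n
  proof (rule integrable_dominated[OF integrable_mult_right[OF f_int(1), of "real n"]])
    show "AE u in lborel. norm (r n u) \<le> norm (real n * f u)"
    proof (rule AE_I2)
      fix u
      have "f u * min (real n) (max 0 (ln (f u / \<gamma> u))) \<le> f u * real n"
        using f_nonneg by (intro mult_left_mono) auto
      then show "norm (r n u) \<le> norm (real n * f u)"
        using f_nonneg[of u] p_nonneg[of n u] by (auto simp: r_def indicator_def mult.commute)
    qed
  qed measurable
  have p_bound: "(\<integral>u. r n u \<partial>lborel) \<le> S + exp (- real n) + Q" for n
  proof -
    \<comment> \<open>Where \<open>f\<close> vanishes the logarithm is meaningless, and the lower
      truncation level is taken instead: it does not contribute under \<open>\<mu>\<close> and costs
      only \<open>exp (- n)\<close> in the exponential integral.\<close>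
    define \<psi> where "\<psi> u = (if u > 0 \<and> f u > 0 then max (- real n) (min (real n) (ln (f u / \<gamma> u))) else - real n)" for u
    have \<psi>m [measurable]: "\<psi> \<in> borel_measurable borel" unfolding \<psi>_def[abs_def] by measurable
    have \<psi>b: "\<bar>\<psi> u\<bar> \<le> real n" for u by (auto simp: \<psi>_def abs_le_iff)
    have f\<psi>: "integrable lborel (\<lambda>u. f u * \<psi> u)"
      using integrable_mu_iff[OF \<psi>m] \<psi>b by (auto intro!: integrable_const_bound[where B="real n"])
    have e\<psi>: "\<gamma> u * exp (\<psi> u) \<le> f u + exp (- real n) * \<gamma> u" for u
    proof (cases "u > 0 \<and> f u > 0")
      case True
      have g: "\<gamma> u > 0" using gamma_density_pos[OF a0 l] True by simp
      \<comment> \<open>\<open>\<psi> u\<close> is at most the larger of \<open>- n\<close> and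
        \<open>ln (f u / \<gamma> u)\<close>. Hence the exponential integral is at most
        \<open>1 + exp (- n)\<close>, and its 1 cancels the 1 in \<open>dual\<close>.\<close>
      have "exp (\<psi> u) \<le> exp (- real n) + exp (ln (f u / \<gamma> u))"
        using True by (auto simp: \<psi>_def max_def min_def add_increasing add_increasing2)
      also have "exp (ln (f u / \<gamma> u)) = f u / \<gamma> u" using True g by simp
      finally have "\<gamma> u * exp (\<psi> u) \<le> \<gamma> u * (exp (- real n) + f u / \<gamma> u)" using g by (intro mult_left_mono) auto
      then show ?thesis using g by (simp add: distrib_left mult.commute)
    next
      case False
      then have "\<psi> u = - real n" by (auto simp: \<psi>_def)
      then show ?thesis using f_nonneg[of u] by (simp add: mult.commute)
    qed
    have "(\<integral>u. \<gamma> u * exp (\<psi> u) \<partial>lborel) \<le> (\<integral>u. f u + exp (- real n) * \<gamma> u \<partial>lborel)"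
    proof (rule integral_mono)
      show "integrable lborel (\<lambda>u. \<gamma> u * exp (\<psi> u))"
      proof (rule integrable_dominated)
        show "integrable lborel (\<lambda>u. f u + exp (- real n) * \<gamma> u)"
          using f_int(1) gamma_integral(1) by simp
        show "AE u in lborel. norm (\<gamma> u * exp (\<psi> u)) \<le> norm (f u + exp (- real n) * \<gamma> u)"
        proof (rule AE_I2)
          fix u
          have "norm (\<gamma> u * exp (\<psi> u)) = \<gamma> u * exp (\<psi> u)" using gam_nonneg[of u] by (simp add: abs_mult)
          also have "\<dots> \<le> norm (f u + exp (- real n) * \<gamma> u)" using e\<psi>[of u] by simp
          finally show "norm (\<gamma> u * exp (\<psi> u)) \<le> norm (f u + exp (- real n) * \<gamma> u)" .
        qed
      qed measurable
    qed (use f_int gamma_integral e\<psi> in auto)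
    also have "\<dots> = 1 + exp (- real n)" using f_int gamma_integral by simp
    finally have "(\<integral>x. \<psi> x \<partial>\<mu>) \<le> S + exp (- real n)"
      using lsc_measurable[OF S \<psi>m \<psi>b] by simp
    then have "(\<integral>u. f u * \<psi> u \<partial>lborel) \<le> S + exp (- real n)" by (simp add: integral_mu_eq)
    \<comment> \<open>Truncation from below only raises a negative logarithm, so subtracting the
      full negative part gives a lower bound independent of the lower truncation.\<close>
    moreover have "(\<integral>u. r n u - max 0 (- eta u) \<partial>lborel) \<le> (\<integral>u. f u * \<psi> u \<partial>lborel)"
    proof (rule integral_mono_AE)
      show "AE u in lborel. r n u - max 0 (- eta u) \<le> f u * \<psi> u"
        using f_pos_AE
      proof eventually_elim
        case (elim u)
        show ?case
        proof (cases "f u > 0")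
          case True
          then have u: "u > 0" using elim by simp
          define L where "L = ln (f u / \<gamma> u)"
          have \<psi>u: "\<psi> u = max (- real n) (min (real n) L)" and pu: "r n u = f u * min (real n) (max 0 L)"
            and eu: "eta u = f u * L"
            using True u by (simp_all add: \<psi>_def r_def eta_def L_def)
          show ?thesis
          proof (cases "L \<ge> 0")
            case L: True
            then have "\<psi> u = min (real n) (max 0 L)" by (simp add: \<psi>u)
            then show ?thesis by (simp add: pu)
          next
            case False
            then have "r n u = 0" "L \<le> \<psi> u" by (auto simp: pu \<psi>u)
            then have "f u * L \<le> f u * \<psi> u" using f_nonneg by (intro mult_left_mono)
            then show ?thesis using \<open>r n u = 0\<close> by (simp add: eu)
          qed
        next
          case False
          then have "f u = 0" using f_nonneg[of u] by simp
          then show ?thesis by (simp add: r_def)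
        qed
      qed
    qed (use p_int eta_neg_int f\<psi> in auto)
    moreover have "(\<integral>u. r n u - max 0 (- eta u) \<partial>lborel) = (\<integral>u. r n u \<partial>lborel) - Q"
      unfolding Q_def using p_int eta_neg_int by simp
    ultimately show ?thesis by simp
  qed
  have lim_p: "(\<lambda>n. ennreal (r n u)) \<longlonglongrightarrow> ennreal (max 0 (eta u))" for u
  proof (rule tendsto_eventually)
    obtain N :: nat where N: "max 0 (ln (f u / \<gamma> u)) < real N" using reals_Archimedean2 by blast
    show "\<forall>\<^sub>F n in sequentially. ennreal (r n u) = ennreal (max 0 (eta u))"
      using eventually_ge_at_top[of N]
    proof eventually_elim
      case (elim n)
      then have "min (real n) (max 0 (ln (f u / \<gamma> u))) = max 0 (ln (f u / \<gamma> u))" using N by simp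
      then have "r n u = indicator {0<..} u * (f u * max 0 (ln (f u / \<gamma> u)))" by (simp add: r_def)
      also have "\<dots> = max 0 (eta u)"
        using f_nonneg[of u] by (auto simp: eta_def indicator_def max_mult_distrib_left)
      finally show ?case by simp
    qed
  qed
  have "(\<integral>\<^sup>+u. ennreal (max 0 (eta u)) \<partial>lborel) = (\<integral>\<^sup>+u. liminf (\<lambda>n. ennreal (r n u)) \<partial>lborel)"
    by (intro nn_integral_cong) (simp add: lim_imp_Liminf[OF _ lim_p])
  also have "\<dots> \<le> liminf (\<lambda>n. \<integral>\<^sup>+u. ennreal (r n u) \<partial>lborel)"
    by (rule nn_integral_liminf) measurable
  also have "\<dots> \<le> liminf (\<lambda>n. ennreal (S + exp (- real n) + Q))"
  proof (rule Liminf_mono, rule always_eventually, rule allI)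
    fix n
    have "(\<integral>\<^sup>+u. ennreal (r n u) \<partial>lborel) = ennreal (\<integral>u. r n u \<partial>lborel)"
      using p_int p_nonneg by (intro nn_integral_eq_integral) auto
    then show "(\<integral>\<^sup>+u. ennreal (r n u) \<partial>lborel) \<le> ennreal (S + exp (- real n) + Q)"
      using p_bound by (simp add: ennreal_leI)
  qed
  also have "\<dots> = ennreal (S + 0 + Q)"
  proof (rule lim_imp_Liminf)
    have "(\<lambda>n. exp (- real n)) \<longlonglongrightarrow> 0"
      by (rule filterlim_compose[OF exp_at_bot filterlim_compose[OF filterlim_uminus_at_bot_at_top filterlim_real_sequentially]])
    then show "(\<lambda>n. ennreal (S + exp (- real n) + Q)) \<longlonglongrightarrow> ennreal (S + 0 + Q)"
      by (intro tendsto_intros)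
  qed simp
  finally show ?thesis by (simp add: Q_def)
qed

end

section \<open>The entropy identity\<close>

text \<open>The density handed out is the very one selected by \<open>SOME\<close> in the
  definition, so independence of the choice never comes up. Finiteness of the negative part excludes
  a difference of two infinities.\<close>

lemma rel_entropy_density:
  assumes "Ex dens"
  obtains f where "f \<in> borel_measurable borel" "\<And>u. 0 \<le> f u" "\<mu> = density lborel (\<lambda>u. ennreal (f u))"
    and "rel_entropy_gamma a l \<mu> = enn2ereal (\<integral>\<^sup>+u. ennreal (max 0 (eta f u)) \<partial>lborel)
       - ereal (\<integral>u. max 0 (- eta f u) \<partial>lborel)"
proof -
  define f where "f = (SOME f. dens f)"
  have f: "dens f"
    unfolding f_def by (rule someI_ex[OF assms])
  have nn: "\<And>u. 0 \<le> f u" using f by blast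
  have f_dens: "\<mu> = density lborel (\<lambda>u. ennreal (f u))" using f by blast
  have "rel_entropy_gamma a l \<mu> = enn2ereal (\<integral>\<^sup>+u\<in>{0<..}. ennreal (max 0 (f u * ln (f u / \<gamma> u))) \<partial>lborel)
     - enn2ereal (\<integral>\<^sup>+u\<in>{0<..}. ennreal (max 0 (- (f u * ln (f u / \<gamma> u)))) \<partial>lborel)"
    unfolding rel_entropy_gamma_def using assms by (simp only: if_True f_def Let_def)
  also have "(\<integral>\<^sup>+u\<in>{0<..}. ennreal (max 0 (f u * ln (f u / \<gamma> u))) \<partial>lborel) = (\<integral>\<^sup>+u. ennreal (max 0 (eta f u)) \<partial>lborel)"
    using f by (intro nn_integral_cong) (auto simp: eta_def[OF _ nn f_dens] indicator_def)
  also have "(\<integral>\<^sup>+u\<in>{0<..}. ennreal (max 0 (- (f u * ln (f u / \<gamma> u)))) \<partial>lborel) = (\<integral>\<^sup>+u. ennreal (max 0 (- eta f u)) \<partial>lborel)"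
    using f by (intro nn_integral_cong) (auto simp: eta_def[OF _ nn f_dens] indicator_def)
  also have "\<dots> = ennreal (\<integral>u. max 0 (- eta f u) \<partial>lborel)"
    using f by (intro nn_integral_eq_integral eta_neg_int[OF _ nn f_dens]) auto
  also have "enn2ereal \<dots> = ereal (\<integral>u. max 0 (- eta f u) \<partial>lborel)"
    by (simp add: enn2ereal_ennreal)
  finally show ?thesis using that f by blast
qed

text \<open>Only a density with integrable positive part needs the data processing inequality; in
  the remaining cases the relative entropy is plus infinity.\<close>

lemma rel_entropy_ge: "0 < t \<Longrightarrow> t < 1 \<Longrightarrow> ereal (Ent t) \<le> rel_entropy_gamma a l \<mu>"
proof (cases "Ex dens")
  case True
  assume t: "0 < t" "t < 1"
  obtain f where f: "f \<in> borel_measurable borel" "\<And>u. 0 \<le> f u" "\<mu> = density lborel (\<lambda>u. ennreal (f u))"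
    and D: "rel_entropy_gamma a l \<mu> = enn2ereal (\<integral>\<^sup>+u. ennreal (max 0 (eta f u)) \<partial>lborel) - ereal (\<integral>u. max 0 (- eta f u) \<partial>lborel)"
    using rel_entropy_density[OF True] by blast
  note [measurable] = eta_measurable[OF f]
  note neg = eta_neg_int[OF f]
  show ?thesis
  proof (cases "(\<integral>\<^sup>+u. ennreal (max 0 (eta f u)) \<partial>lborel) = \<infinity>")
    case False
    then have P: "integrable lborel (\<lambda>u. max 0 (eta f u))"
      by (intro integrableI_nonneg) (auto simp: less_top)
    have eq: "eta f = (\<lambda>u. max 0 (eta f u) - max 0 (- eta f u))" by (auto simp: fun_eq_iff max_def)
    have i: "integrable lborel (eta f)" by (subst eq) (intro integrable_minus P neg)
    have "Ent t \<le> (\<integral>u. eta f u \<partial>lborel)" by (rule Ent_le_entropy[OF f t i])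
    also have "\<dots> = (\<integral>u. max 0 (eta f u) \<partial>lborel) - (\<integral>u. max 0 (- eta f u) \<partial>lborel)"
      by (subst eq) (intro Bochner_Integration.integral_diff P neg)
    finally have "ereal (Ent t) \<le> ereal (\<integral>u. max 0 (eta f u) \<partial>lborel) - ereal (\<integral>u. max 0 (- eta f u) \<partial>lborel)"
      by simp
    moreover have "(\<integral>\<^sup>+u. ennreal (max 0 (eta f u)) \<partial>lborel) = ennreal (\<integral>u. max 0 (eta f u) \<partial>lborel)"
      using P by (intro nn_integral_eq_integral) auto
    ultimately show ?thesis unfolding D by (simp add: enn2ereal_ennreal)
  qed (simp add: D)
next
  case False
  then have "rel_entropy_gamma a l \<mu> = \<infinity>" unfolding rel_entropy_gamma_def by (simp only: if_False)
  then show ?thesis by simp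
qed

lemma rel_entropy_le:
  assumes S: "\<And>n. Ent (T n) \<le> S"
  shows "rel_entropy_gamma a l \<mu> \<le> ereal S"
proof -
  obtain f where f: "f \<in> borel_measurable borel" "\<And>u. 0 \<le> f u" "\<mu> = density lborel (\<lambda>u. ennreal (f u))"
    and D: "rel_entropy_gamma a l \<mu> = enn2ereal (\<integral>\<^sup>+u. ennreal (max 0 (eta f u)) \<partial>lborel) - ereal (\<integral>u. max 0 (- eta f u) \<partial>lborel)"
    using rel_entropy_density[OF density_if_bounded[OF S]] by blast
  have S0: "0 \<le> S" using Ent_nonneg[OF T_bounds[of 0]] S[of 0] by simp
  have "enn2ereal (\<integral>\<^sup>+u. ennreal (max 0 (eta f u)) \<partial>lborel) \<le> enn2ereal (ennreal (S + (\<integral>u. max 0 (- eta f u) \<partial>lborel)))"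
    using entropy_le_of_bounded[OF f S] by (simp add: less_eq_ennreal.rep_eq)
  also have "\<dots> = ereal (S + (\<integral>u. max 0 (- eta f u) \<partial>lborel))"
    using S0 by (intro enn2ereal_ennreal add_nonneg_nonneg) auto
  finally show ?thesis unfolding D
    by (cases "enn2ereal (\<integral>\<^sup>+u. ennreal (max 0 (eta f u)) \<partial>lborel)") auto
qed

text \<open>On \<open>{1 - T n..T n}\<close> de Bruijn's identity gives
  \<open>Ent (T n) - Ent (1 - T n)\<close>, and these values increase to the full integral
  \<open>I\<close>. Since \<open>Ent\<close> is nonnegative and at most the relative entropy, so is
  \<open>I\<close>. Conversely, a finite \<open>I\<close> bounds all \<open>Ent (T n)\<close>, and
  lower semicontinuity carries the bound over to the relative entropy.\<close>

lemma entropy_identity: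
  "rel_entropy_gamma a l \<mu> = enn2ereal (\<integral>\<^sup>+t\<in>{0<..<1}. ennreal (1 / (l * t)) * stein_fisher_gamma a l (smart_path_law a l \<mu> t) \<partial>lborel)"
proof -
  define j where "j t = ennreal (1 / (l * t)) * (\<integral>\<^sup>+u. ennreal (fish t u) \<partial>lborel)" for t
  have jm [measurable]: "j \<in> borel_measurable borel"
    unfolding j_def[abs_def] by (intro borel_measurable_times_ennreal lborel.borel_measurable_nn_integral) (auto simp: case_prod_unfold)
  define I where "I = (\<integral>\<^sup>+t\<in>{0<..<1}. j t \<partial>lborel)"
  have stein: "(\<integral>\<^sup>+t\<in>{0<..<1}. ennreal (1 / (l * t)) * stein_fisher_gamma a l (smart_path_law a l \<mu> t) \<partial>lborel) = I"
    unfolding I_def j_def by (intro nn_integral_cong) (auto simp: indicator_def stein_fisher_eq)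
  define s where "s n = 1 - T n" for n
  have s: "0 < s n" "s n < 1" "s n \<le> T n" for n
    using T_bounds[of n] by (auto simp: s_def T_def field_simps)
  have In: "(\<integral>\<^sup>+t\<in>{s n..T n}. j t \<partial>lborel) = ennreal (Ent (T n) - Ent (s n))" for n
    unfolding j_def by (rule de_Bruijn(1)[OF s(1) s(3) T_bounds(2)])
  have I_sup: "I = (SUP n. (\<integral>\<^sup>+t\<in>{s n..T n}. j t \<partial>lborel))"
  proof -
    have un: "(\<Union>n. {s n..T n}) = {0<..<1}"
    proof (rule set_eqI)
      fix x :: real
      show "x \<in> (\<Union>n. {s n..T n}) \<longleftrightarrow> x \<in> {0<..<1}"
      proof
        assume "x \<in> {0<..<1}"
        then have "0 < min x (1 - x)" by simp
        then obtain n where "inverse (real (Suc n)) < min x (1 - x)" using reals_Archimedean by blast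
        moreover have "inverse (real (Suc (Suc n))) \<le> inverse (real (Suc n))" by (simp add: frac_le inverse_eq_divide)
        ultimately have "inverse (real (Suc (Suc n))) < min x (1 - x)" by linarith
        then have "x \<in> {s n..T n}" by (simp add: s_def T_def)
        then show "x \<in> (\<Union>n. {s n..T n})" by blast
      next
        assume "x \<in> (\<Union>n. {s n..T n})"
        then show "x \<in> {0<..<1}" using s(1) T_bounds(2) by (auto intro: less_le_trans le_less_trans)
      qed
    qed
    have mono: "incseq (\<lambda>n. {s n..T n})"
      using T_mono by (intro monoI) (auto simp: s_def le_diff_eq diff_le_eq intro: order_trans)
    have ind: "indicator {0<..<1} t = (SUP n. indicator {s n..T n} t :: ennreal)" for t
    proof (cases "t \<in> {0<..<1}")
      case True
      then obtain m where "t \<in> {s m..T m}" using un by blast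
      then have "1 \<le> (SUP n. indicator {s n..T n} t :: ennreal)" by (intro SUP_upper2[of m]) auto
      moreover have "(SUP n. indicator {s n..T n} t :: ennreal) \<le> 1" by (intro SUP_least) (simp add: indicator_def)
      ultimately show ?thesis using True by simp
    next
      case False
      then have "t \<notin> {s n..T n}" for n using un by blast
      then show ?thesis using False by simp
    qed
    have "I = (\<integral>\<^sup>+t. (SUP n. j t * indicator {s n..T n} t) \<partial>lborel)"
      unfolding I_def ind by (simp add: SUP_mult_left_ennreal)
    also have "\<dots> = (SUP n. (\<integral>\<^sup>+t\<in>{s n..T n}. j t \<partial>lborel))"
    proof (rule nn_integral_monotone_convergence_SUP)
      show "incseq (\<lambda>n t. j t * indicator {s n..T n} t)"
        using mono by (auto simp: incseq_def le_fun_def indicator_def subset_eq intro!: mult_left_mono)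
    qed measurable
    finally show ?thesis .
  qed
  have D_ge: "enn2ereal I \<le> rel_entropy_gamma a l \<mu>"
  proof -
    have D0: "0 \<le> rel_entropy_gamma a l \<mu>"
      using rel_entropy_ge[OF T_bounds[of 0]] Ent_nonneg[OF T_bounds[of 0]] order_trans[of 0 "ereal (Ent (T 0))"] by simp
    have "I \<le> e2ennreal (rel_entropy_gamma a l \<mu>)"
      unfolding I_sup
    proof (rule SUP_least)
      fix n
      have "ereal (Ent (T n) - Ent (s n)) \<le> ereal (Ent (T n))" using Ent_nonneg[OF s(1,2)] by simp
      also have "\<dots> \<le> rel_entropy_gamma a l \<mu>" by (rule rel_entropy_ge[OF T_bounds])
      finally show "(\<integral>\<^sup>+t\<in>{s n..T n}. j t \<partial>lborel) \<le> e2ennreal (rel_entropy_gamma a l \<mu>)"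
        unfolding In by (metis e2ennreal_ereal e2ennreal_mono)
    qed
    then have "enn2ereal I \<le> enn2ereal (e2ennreal (rel_entropy_gamma a l \<mu>))" by (simp add: less_eq_ennreal.rep_eq)
    then show ?thesis using D0 by (simp add: enn2ereal_e2ennreal)
  qed
  have D_le: "rel_entropy_gamma a l \<mu> \<le> enn2ereal I"
  proof (cases I)
    case (real r)
    have lim: "(\<lambda>n. Ent (s n)) \<longlonglongrightarrow> 0"
    proof (rule tendsto_sandwich[OF _ _ tendsto_const])
      show "\<forall>\<^sub>F n in sequentially. 0 \<le> Ent (s n)" using Ent_nonneg[OF s(1,2)] by simp
      show "\<forall>\<^sub>F n in sequentially. Ent (s n) \<le> - a * ln (1 - s n) + sqrt (kB l (s n)) * (2 * a / l)"
        using Ent_le[OF s(1,2)] by simp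
      have s0: "s \<longlonglongrightarrow> 1 - 1" unfolding s_def by (intro tendsto_intros T_lim)
      have "(\<lambda>n. - a * ln (1 - s n) + sqrt (kB l (s n)) * (2 * a / l)) \<longlonglongrightarrow> - a * ln (1 - (1 - 1)) + sqrt (l\<^sup>2 * (1 - 1) / (1 - (1 - 1))\<^sup>2) * (2 * a / l)"
        unfolding kB_def by (intro tendsto_intros s0) (use l in auto)
      then show "(\<lambda>n. - a * ln (1 - s n) + sqrt (kB l (s n)) * (2 * a / l)) \<longlonglongrightarrow> 0" by simp
    qed
    \<comment> \<open>For fixed \<open>m\<close> and \<open>n \<ge> m\<close>, monotonicity gives
      \<open>Ent (T m) \<le> Ent (T n) \<le> r + Ent (s n)\<close>, and the last term tends to 0 as
      \<open>n\<close> grows.\<close>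
    have "Ent (T m) \<le> r" for m
    proof (rule LIMSEQ_le_const)
      show "(\<lambda>n. r + Ent (s n)) \<longlonglongrightarrow> r" using tendsto_add[OF tendsto_const lim, of r] by simp
      have "Ent (T m) \<le> r + Ent (s n)" if n: "n \<ge> m" for n
      proof -
        have "ennreal (Ent (T n) - Ent (s n)) \<le> I" unfolding I_sup In[symmetric] by (rule SUP_upper) simp
        then have "Ent (T n) - Ent (s n) \<le> r" using real by (simp add: ennreal_le_iff)
        moreover have "Ent (T m) \<le> Ent (T n)" using de_Bruijn(2)[of "T m" "T n"] T_bounds T_mono[OF n] by simp
        ultimately show ?thesis by simp
      qed
      then show "\<exists>N. \<forall>n\<ge>N. Ent (T m) \<le> r + Ent (s n)" by blast
    qed
    then have "rel_entropy_gamma a l \<mu> \<le> ereal r" by (rule rel_entropy_le)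
    then show ?thesis using real by (simp add: enn2ereal_ennreal)
  qed simp
  show ?thesis unfolding stein using D_ge D_le by (rule antisym[rotated])
qed

end

theorem theorem4p2:
  fixes M :: "'a measure" and X :: "'a \<Rightarrow> real" and \<alpha> lam :: real
  assumes "prob_space M"
    and "X \<in> borel_measurable M"
    and "\<alpha> \<ge> 1/2" and "lam > 0"
    and "AE \<omega> in M. X \<omega> > 0"
    and "integrable M (\<lambda>\<omega>. X \<omega> powr (\<alpha> + 4))"
    and "(\<integral>\<omega>. X \<omega> \<partial>M) = \<alpha> / lam"
  shows "rel_entropy_gamma \<alpha> lam (distr M borel X) =
         enn2ereal (\<integral>\<^sup>+ \<tau> \<in> {0<..<1}.
            ennreal (1 / (lam * \<tau>)) *
            stein_fisher_gamma \<alpha> lam (smart_path_law \<alpha> lam (distr M borel X) \<tau>) \<partial>lborel)"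
proof -
  interpret M: prob_space M by fact
  note X [measurable] = assms(2)
  interpret D: prob_space "distr M borel X" by (rule M.prob_space_distr) measurable
  interpret smart_path "distr M borel X" \<alpha> lam
  proof
    show "AE x in distr M borel X. 0 < x" using assms(5) by (subst AE_distr_iff) auto
    have "integrable M (\<lambda>\<omega>. X \<omega> ^ 4)"
    proof (rule integrable_dominated)
      show "integrable M (\<lambda>\<omega>. 1 + X \<omega> powr (\<alpha> + 4))" using assms(6) by simp
      show "AE \<omega> in M. norm (X \<omega> ^ 4) \<le> norm (1 + X \<omega> powr (\<alpha> + 4))"
        using assms(5)
      proof eventually_elim
        case (elim \<omega>)
        have "X \<omega> ^ 4 \<le> 1 + X \<omega> powr (\<alpha> + 4)"
        proof (cases "X \<omega> \<le> 1")
          case True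
          then have "X \<omega> ^ 4 \<le> 1" using elim by (intro power_le_one) auto
          then show ?thesis by (simp add: add_increasing2)
        next
          case False
          have "X \<omega> ^ 4 = X \<omega> powr 4" using elim by (simp add: powr_numeral)
          also have "\<dots> \<le> X \<omega> powr (\<alpha> + 4)" using False assms(3) by (intro powr_mono) auto
          finally show ?thesis by simp
        qed
        then show ?case using elim by simp
      qed
    qed measurable
    then show "integrable (distr M borel X) (\<lambda>x. x ^ 4)" by (subst integrable_distr_eq) auto
    show "(\<integral>x. x \<partial>distr M borel X) = \<alpha> / lam" using assms(7) by (subst integral_distr) auto
  qed (use assms(3,4) in auto)
  show ?thesis by (rule entropy_identity)
qed

end
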